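(* Let $n\ge1$, $s\in(0,1)$, let $\Omega\subset\mathbb{R}^n$ be a bounded Lipschitz domain, and let $\Omega_h$, $h\ge1$, be a sequence of uniformly Lipschitz domains such that $$\overline\Omega\subset\Omega_h\subseteq\{x\in\mathbb{R}^n: d(x,\Omega)<\tfrac1h\}.$$ Let $u\in\widetilde H^s(\Omega)$. Then i) $\displaystyle\lim_{h\to\infty}\langle(-\Delta_{\Omega_h})^su,u\rangle=\langle(-\Delta_\Omega)^su,u\rangle$; ii) $(-\Delta_{\Omega_h})^su\to(-\Delta_\Omega)^su$ weakly in $\widetilde H^s(\Omega)'$, that is, $\langle(-\Delta_{\Omega_h})^su,v\rangle\to\langle(-\Delta_\Omega)^su,v\rangle$ for every $v\in\widetilde H^s(\Omega)$.
   Context: For a bounded Lipschitz domain $A\subset\mathbb{R}^n$, $-\Delta_A$ is the self-adjoint Dirichlet Laplacian in $L^2(A)$ with quadratic form $\|\nabla u\|_2^2$, $u\in H^1_0(A)$; $\lambda_j$ ($j\ge1$) are its eigenvalues in non-decreasing order, repeated according to multiplicity, and $\varphi_j\in H^1_0(A)$ are corresponding eigenfunctions forming an orthonormal basis of $L^2(A)$. $\widetilde H^s(A)=\{u\in H^s(\mathbb{R}^n): u\equiv0\text{ on }\mathbb{R}^n\setminus\overline A\}$, with $H^s(\mathbb R^n)$ the usual Sobolev space; $\widetilde H^s(A)'$ is its dual. Since $\overline\Omega\subset\Omega_h$, one has $\widetilde H^s(\Omega)\subset\widetilde H^s(\Omega_h)$. The spectral (Navier) fractional Laplacian on $A$ is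 $(-\Delta_A)^su=\sum_j\lambda_j^s\big(\int_A u\varphi_j\big)\varphi_j$; its quadratic form has domain $\widetilde H^s(A)$, and $\langle(-\Delta_A)^su,v\rangle=\sum_j\lambda_j^s\big(\int_A u\varphi_j\big)\big(\int_A v\varphi_j\big)$ for $u,v\in\widetilde H^s(A)$. "Uniformly Lipschitz" means that the Lipschitz character of the boundary is uniform in $h$. *)

theory Defs
  imports "HOL-Analysis.Analysis"
begin

section \<open>Lipschitz domains\<close>

definition open_domain :: "'a::euclidean_space set \<Rightarrow> bool" where
  "open_domain A \<longleftrightarrow> open A \<and> connected A \<and> A \<noteq> {}"

text \<open>Inside the ball of radius \<open>r\<close> around \<open>p\<close>, the set \<open>A\<close> is the strict subgraph, in the
  direction of the unit vector \<open>e\<close>, of an \<open>L\<close>-Lipschitz function \<open>g\<close> defined on the hyperplane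
  orthogonal to \<open>e\<close> (a single point in dimension one).\<close>

definition lipschitz_chart :: "'a::euclidean_space set \<Rightarrow> 'a \<Rightarrow> real \<Rightarrow> real \<Rightarrow> bool" where
  "lipschitz_chart A p r L \<longleftrightarrow>
     (\<exists>e g. norm e = 1 \<and> L-lipschitz_on {y. y \<bullet> e = 0} (g :: 'a \<Rightarrow> real) \<and>
        (\<forall>x\<in>ball p r. x \<in> A \<longleftrightarrow> x \<bullet> e < g (x - (x \<bullet> e) *\<^sub>R e)))"

definition lipschitz_domain :: "'a::euclidean_space set \<Rightarrow> bool" where
  "lipschitz_domain A \<longleftrightarrow>
     open_domain A \<and> (\<forall>p\<in>frontier A. \<exists>r>0. \<exists>L. lipschitz_chart A p r L)"

text \<open>The chart radius and the Lipschitz constant serve all members of the family. Members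
  contained in a common bounded set then also admit boundary atlases with a common number of
  charts.\<close>

definition uniformly_lipschitz_domains :: "'a::euclidean_space set set \<Rightarrow> bool" where
  "uniformly_lipschitz_domains \<A> \<longleftrightarrow>
     (\<forall>A\<in>\<A>. open_domain A) \<and>
     (\<exists>r>0. \<exists>L. \<forall>A\<in>\<A>. \<forall>p\<in>frontier A. lipschitz_chart A p r L)"

section \<open>Function spaces\<close>

text \<open>Elements of \<open>L\<^sup>2(A)\<close> are represented by Borel functions on the whole space, whose values
  outside \<open>A\<close> are irrelevant; functions that agree almost everywhere on \<open>A\<close> are not identified.\<close>

definition L2_on :: "'a::euclidean_space set \<Rightarrow> ('a \<Rightarrow> 'b::euclidean_space) set" where
  "L2_on A = {f. set_borel_measurable lborel A f \<and> set_integrable lborel A (\<lambda>x. (norm (f x))\<^sup>2)}"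

definition grad :: "('a::euclidean_space \<Rightarrow> real) \<Rightarrow> 'a \<Rightarrow> 'a" where
  "grad f x = (\<Sum>b\<in>Basis. frechet_derivative f (at x) b *\<^sub>R b)"

primrec Ck :: "nat \<Rightarrow> ('a::euclidean_space \<Rightarrow> real) \<Rightarrow> bool" where
  "Ck 0 f \<longleftrightarrow> continuous_on UNIV f"
| "Ck (Suc k) f \<longleftrightarrow> f differentiable_on UNIV \<and> (\<forall>b\<in>Basis. Ck k (\<lambda>x. grad f x \<bullet> b))"

text \<open>\<open>C\<^sub>c\<^sup>\<infinity>(A)\<close>, with functions extended by zero.\<close>

definition test_functions :: "'a::euclidean_space set \<Rightarrow> ('a \<Rightarrow> real) set" where
  "test_functions A =
     {f. (\<forall>k. Ck k f) \<and> compact (closure {x. f x \<noteq> 0}) \<and> closure {x. f x \<noteq> 0} \<subseteq> A}"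

definition has_weak_grad ::
  "'a::euclidean_space set \<Rightarrow> ('a \<Rightarrow> real) \<Rightarrow> ('a \<Rightarrow> 'a) \<Rightarrow> bool" where
  "has_weak_grad A u G \<longleftrightarrow> u \<in> L2_on A \<and> G \<in> L2_on A \<and>
     (\<forall>f\<in>test_functions A.
        (LINT x:A|lborel. u x *\<^sub>R grad f x) = - (LINT x:A|lborel. f x *\<^sub>R G x))"

text \<open>Unique up to null sets when it exists.\<close>

definition weak_grad :: "'a::euclidean_space set \<Rightarrow> ('a \<Rightarrow> real) \<Rightarrow> 'a \<Rightarrow> 'a" where
  "weak_grad A u = (SOME G. has_weak_grad A u G)"

text \<open>\<open>H\<^sup>1\<^sub>0(A)\<close>: the closure of \<open>C\<^sub>c\<^sup>\<infinity>(A)\<close> in \<open>H\<^sup>1(A)\<close>.\<close>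

definition H1_0 :: "'a::euclidean_space set \<Rightarrow> ('a \<Rightarrow> real) set" where
  "H1_0 A = {u. (\<exists>G. has_weak_grad A u G) \<and>
     (\<exists>f. (\<forall>k. f k \<in> test_functions A) \<and>
        (\<lambda>k. LINT x:A|lborel.
            (f k x - u x)\<^sup>2 + (norm (grad (f k) x - weak_grad A u x))\<^sup>2) \<longlonglongrightarrow> 0)}"

text \<open>\<open>H\<^sup>s\<close> of the whole space for \<open>0 < s < 1\<close>, defined by the Gagliardo seminorm. The integrand
  is \<open>0\<close> on the diagonal because \<open>0 / 0 = 0\<close>.\<close>

definition Hs :: "real \<Rightarrow> ('a::euclidean_space \<Rightarrow> real) set" where
  "Hs s = {u. u \<in> L2_on UNIV \<and>
     (\<integral>\<^sup>+x. \<integral>\<^sup>+y. ennreal ((u x - u y)\<^sup>2 / norm (x - y) powr (real DIM('a) + 2 * s))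
        \<partial>lborel \<partial>lborel) < \<infinity>}"

definition Hs_tilde :: "real \<Rightarrow> 'a::euclidean_space set \<Rightarrow> ('a \<Rightarrow> real) set" where
  "Hs_tilde s A = {u \<in> Hs s. AE x in lborel. x \<notin> closure A \<longrightarrow> u x = 0}"

section \<open>The Dirichlet Laplacian and its fractional powers\<close>

definition L2_inner :: "'a::euclidean_space set \<Rightarrow> ('a \<Rightarrow> real) \<Rightarrow> ('a \<Rightarrow> real) \<Rightarrow> real" where
  "L2_inner A u v = (LINT x:A|lborel. u x * v x)"

definition dirichlet_form :: "'a::euclidean_space set \<Rightarrow> ('a \<Rightarrow> real) \<Rightarrow> ('a \<Rightarrow> real) \<Rightarrow> real" where
  "dirichlet_form A u v = (LINT x:A|lborel. weak_grad A u x \<bullet> weak_grad A v x)"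

text \<open>The graph of the self-adjoint operator \<open>-\<Delta>\<^sub>A\<close> associated with the quadratic form
  \<open>dirichlet_form A\<close> on \<open>H1_0 A\<close>: \<open>u\<close> is in the domain and \<open>-\<Delta>\<^sub>A u = f\<close>.\<close>

definition dirichlet_laplacian ::
  "'a::euclidean_space set \<Rightarrow> ('a \<Rightarrow> real) \<Rightarrow> ('a \<Rightarrow> real) \<Rightarrow> bool" where
  "dirichlet_laplacian A u f \<longleftrightarrow> u \<in> H1_0 A \<and> f \<in> L2_on A \<and>
     (\<forall>v\<in>H1_0 A. dirichlet_form A u v = L2_inner A f v)"

text \<open>Indices start at \<open>0\<close>. Since the eigenfunctions form an orthonormal basis, \<open>\<mu>\<close> enumerates all
  eigenvalues, each repeated according to its multiplicity.\<close>

definition dirichlet_eigenbasis ::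
  "'a::euclidean_space set \<Rightarrow> (nat \<Rightarrow> real) \<Rightarrow> (nat \<Rightarrow> 'a \<Rightarrow> real) \<Rightarrow> bool" where
  "dirichlet_eigenbasis A \<mu> \<phi> \<longleftrightarrow>
     incseq \<mu> \<and>
     (\<forall>j. dirichlet_laplacian A (\<phi> j) (\<lambda>x. \<mu> j * \<phi> j x)) \<and>
     (\<forall>i j. L2_inner A (\<phi> i) (\<phi> j) = (if i = j then 1 else 0)) \<and>
     (\<forall>u\<in>L2_on A. (\<lambda>N. LINT x:A|lborel.
        (u x - (\<Sum>j<N. L2_inner A u (\<phi> j) * \<phi> j x))\<^sup>2) \<longlonglongrightarrow> 0)"

text \<open>\<open>(-\<Delta>\<^sub>A)\<^sup>s u\<close> as the functional \<open>v \<mapsto> \<langle>(-\<Delta>\<^sub>A)\<^sup>s u, v\<rangle>\<close> on \<open>Hs_tilde s A\<close>, computed from an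
  eigenbasis \<open>\<mu>, \<phi>\<close> of \<open>-\<Delta>\<^sub>A\<close>; it does not depend on the choice of the eigenbasis.\<close>

definition spectral_frac_laplacian ::
  "'a::euclidean_space set \<Rightarrow> (nat \<Rightarrow> real) \<Rightarrow> (nat \<Rightarrow> 'a \<Rightarrow> real) \<Rightarrow> real
    \<Rightarrow> ('a \<Rightarrow> real) \<Rightarrow> ('a \<Rightarrow> real) \<Rightarrow> real" where
  "spectral_frac_laplacian A \<mu> \<phi> s u v =
     (\<Sum>j. \<mu> j powr s * L2_inner A u (\<phi> j) * L2_inner A v (\<phi> j))"

end

theory Submission
  imports Defs
begin

text \<open>
  For \<open>t > 0\<close> let \<open>K\<^sub>A(t, u)\<close> be the infimum of \<open>\<parallel>u - w\<parallel>\<^sup>2 + t \<parallel>\<nabla>w\<parallel>\<^sup>2\<close> over \<open>w \<in> H\<^sup>1\<^sub>0(A)\<close>. In terms of an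
  eigenbasis it is the sum of \<open>t \<mu>\<^sub>j / (1 + t \<mu>\<^sub>j) u\<^sub>j\<^sup>2\<close>, so that the integral of \<open>t\<^sup>-\<^sup>1\<^sup>-\<^sup>s K\<^sub>A(t, u)\<close> over
  \<open>t > 0\<close> is a constant multiple of the fractional form. The infimum may be taken over test functions,
  which makes \<open>K\<^sub>A\<close> decreasing in \<open>A\<close>. Conversely, a test function supported in a small neighbourhood of
  the Lipschitz domain \<open>\<Omega>\<close> can be pushed into \<open>\<Omega>\<close> by translating its pieces outwards, at the cost of a
  factor close to one in the Dirichlet integral. Hence the K-functionals of the domains \<open>\<Omega>\<^sub>h\<close> converge
  pointwise from below to that of \<open>\<Omega>\<close>, and the diagonal case follows by dominated convergence. Finiteness of
  the dominating integral for \<open>u\<close> in \<open>H\<^sup>s\<close> comes from pushing in mollifications of \<open>u\<close> at scale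
  \<open>\<surd>t\<close>. Polarization gives the weak convergence.
\<close>

section \<open>Smooth functions\<close>

text \<open>Eigenbases of different domains cannot be compared term by term. The K-functional trades
  the spectral sum for a variational quantity, comparable for nested domains at each fixed t. Its L2
  term must not change with the domain, so u has to vanish at every point off \<Omega>, whereas
  \<open>Hs_tilde\<close> gives this only almost everywhere off the closure; the boundary is
  therefore shown to be a null set.

  Pushing in by \<delta> costs only a relative O(\<delta>) in the Dirichlet integral although the
  cutoffs have gradients of order one: these gradients meet only differences w(x + \<delta> e) -
  w(x), whose L2 norm is at most \<delta> times that of grad w. This is used in two regimes. With t
  fixed and \<delta> -> 0 it gives convergence. With \<delta> proportional to sqrt t and constants
  independent of t it gives the majorant: K(r^2, u) is at most C r^-n times the integral of |u(x) -
  u(y)|^2 over |x - y| <= r, and integration in t turns this truncation into the Gagliardo kernel |x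
  - y|^(-n-2s).\<close>

lemma grad_eqI:
  fixes f :: "'a::euclidean_space \<Rightarrow> real"
  assumes "GDERIV f x :> D"
  shows "grad f x = D"
proof -
  have "frechet_derivative f (at x) = (\<lambda>h. h \<bullet> D)"
    using assms unfolding gderiv_def by (metis frechet_derivative_at)
  then show ?thesis
    unfolding grad_def by (simp add: inner_commute[of _ D] euclidean_representation)
qed

lemma GDERIV_grad:
  fixes f :: "'a::euclidean_space \<Rightarrow> real"
  assumes "f differentiable (at x)"
  shows "GDERIV f x :> grad f x"
proof -
  let ?f' = "frechet_derivative f (at x)"
  have f': "(f has_derivative ?f') (at x)"
    using assms by (simp add: frechet_derivative_works)
  then interpret linear ?f' by (rule has_derivative_linear)
  have "?f' h = h \<bullet> grad f x" for h
  proof -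
    have "?f' h = ?f' (\<Sum>b\<in>Basis. (h \<bullet> b) *\<^sub>R b)" by (simp add: euclidean_representation)
    also have "\<dots> = (\<Sum>b\<in>Basis. (h \<bullet> b) * ?f' b)" by (simp add: sum scaleR)
    also have "\<dots> = h \<bullet> grad f x" by (simp add: grad_def inner_sum_right mult.commute)
    finally show ?thesis .
  qed
  then have "?f' = (\<lambda>h. h \<bullet> grad f x)" by auto
  with f' show ?thesis unfolding gderiv_def by simp
qed

lemma GDERIV_imp_differentiable: "GDERIV f x :> D \<Longrightarrow> f differentiable (at x)"
  unfolding gderiv_def differentiable_def by blast

lemma GDERIV_imp_isCont:
  assumes "GDERIV f x :> D" shows "isCont f x"
  using GDERIV_imp_differentiable[OF assms] by (rule differentiable_imp_continuous_within)

text \<open>\<open>Ck\<close> recurses through \<open>grad\<close>, which is built from Frechet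
  derivatives along a basis. Exhibiting an explicit gradient field instead turns every closure
  property below into an induction on the order.\<close>

lemma Ck_SucI:
  fixes f :: "'a::euclidean_space \<Rightarrow> real"
  assumes "\<And>x. GDERIV f x :> G x" and "\<And>b. b \<in> Basis \<Longrightarrow> Ck k (\<lambda>x. G x \<bullet> b)"
  shows "Ck (Suc k) f"
proof -
  have "grad f = G" using grad_eqI[OF assms(1)] by auto
  then show ?thesis
    using assms GDERIV_imp_differentiable[OF assms(1)] by (simp add: differentiable_on_def)
qed

lemma Ck_Suc_GDERIV: "Ck (Suc k) f \<Longrightarrow> GDERIV f x :> grad f x"
  by (simp add: GDERIV_grad differentiable_on_def)

lemma Ck_Suc_grad: "Ck (Suc k) f \<Longrightarrow> b \<in> Basis \<Longrightarrow> Ck k (\<lambda>x. grad f x \<bullet> b)"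
  by simp

lemma Ck_SucD: "Ck (Suc k) f \<Longrightarrow> Ck k f"
proof (induction k arbitrary: f)
  case 0
  then show ?case by (simp add: differentiable_imp_continuous_on)
next
  case (Suc k)
  then show ?case by (auto simp del: Ck.simps(2) simp: Ck.simps(2)[of "Suc k"] Ck.simps(2)[of k f])
qed

lemma Ck_continuous_on: "Ck k f \<Longrightarrow> continuous_on UNIV f"
  by (induction k) (auto dest: Ck_SucD simp del: Ck.simps(2))

lemma Ck_const [simp]: "Ck k (\<lambda>x. c)"
proof (induction k arbitrary: c)
  case (Suc k)
  show ?case by (rule Ck_SucI[where G = "\<lambda>x. 0"]) (auto intro: GDERIV_const Suc)
qed simp

lemma GDERIV_inner: "GDERIV (\<lambda>x. x \<bullet> c) x :> c"
  unfolding gderiv_def by (rule bounded_linear_imp_has_derivative) (rule bounded_linear_inner_left)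

lemma Ck_inner: "Ck k (\<lambda>x. x \<bullet> c)"
proof (cases k)
  case 0
  then show ?thesis by (simp add: continuous_intros)
next
  case (Suc m)
  show ?thesis unfolding Suc by (rule Ck_SucI[where G = "\<lambda>x. c"]) (auto intro: GDERIV_inner)
qed

lemma Ck_add: "Ck k f \<Longrightarrow> Ck k g \<Longrightarrow> Ck k (\<lambda>x. f x + g x)"
proof (induction k arbitrary: f g)
  case (Suc k)
  show ?case
    by (rule Ck_SucI[where G = "\<lambda>x. grad f x + grad g x"])
      (use Suc.prems in \<open>auto intro: GDERIV_add Ck_Suc_GDERIV
        simp: inner_add_left intro!: Suc.IH simp del: Ck.simps(2) dest: Ck_Suc_grad\<close>)
qed (simp add: continuous_intros)

lemma Ck_mult: "Ck k f \<Longrightarrow> Ck k g \<Longrightarrow> Ck k (\<lambda>x. f x * g x)"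
proof (induction k arbitrary: f g)
  case (Suc k)
  show ?case
  proof (rule Ck_SucI[where G = "\<lambda>x. f x *\<^sub>R grad g x + g x *\<^sub>R grad f x"])
    show "Ck k (\<lambda>x. (f x *\<^sub>R grad g x + g x *\<^sub>R grad f x) \<bullet> b)" if "b \<in> Basis" for b
      using Suc.prems that unfolding inner_add_left inner_scaleR_left
      by (intro Ck_add Suc.IH Ck_Suc_grad) (auto dest: Ck_SucD simp del: Ck.simps(2))
  qed (use Suc.prems in \<open>auto intro!: GDERIV_mult Ck_Suc_GDERIV\<close>)
qed (simp add: continuous_intros)

lemma Ck_cmult: "Ck k f \<Longrightarrow> Ck k (\<lambda>x. c * f x)"
  by (intro Ck_mult) simp_all

lemma Ck_diff: "Ck k f \<Longrightarrow> Ck k g \<Longrightarrow> Ck k (\<lambda>x. f x - g x)"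
  using Ck_add[of k f "\<lambda>x. (-1) * g x"] Ck_cmult[of k g "-1"] by simp

lemma Ck_sum: "(\<And>i. i \<in> I \<Longrightarrow> Ck k (f i)) \<Longrightarrow> Ck k (\<lambda>x. \<Sum>i\<in>I. f i x)"
  by (induction I rule: infinite_finite_induct) (auto intro: Ck_add)

lemma Ck_prod: "(\<And>i. i \<in> I \<Longrightarrow> Ck k (f i)) \<Longrightarrow> Ck k (\<lambda>x. \<Prod>i\<in>I. f i x)"
  by (induction I rule: infinite_finite_induct) (auto intro: Ck_mult)

lemma GDERIV_translate:
  assumes "GDERIV f (x + c) :> D" shows "GDERIV (\<lambda>x. f (x + c)) x :> D"
proof -
  have "((\<lambda>x. x + c) has_derivative (\<lambda>h. h)) (at x)" by (auto intro!: derivative_eq_intros)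
  from has_derivative_compose[OF this] assms show ?thesis unfolding gderiv_def by auto
qed

lemma Ck_translate: "Ck k f \<Longrightarrow> Ck k (\<lambda>x. f (x + c))"
proof (induction k arbitrary: f)
  case 0
  then show ?case by (auto intro!: continuous_intros intro: continuous_on_compose2)
next
  case (Suc k)
  show ?case
  proof (rule Ck_SucI[where G = "\<lambda>x. grad f (x + c)"])
    show "Ck k (\<lambda>x. grad f (x + c) \<bullet> b)" if "b \<in> Basis" for b
      using Suc.IH[OF Ck_Suc_grad[OF Suc.prems that]] .
  qed (intro GDERIV_translate Ck_Suc_GDERIV[OF Suc.prems])
qed

text \<open>The gradient -(1/f)^2 grad f contains only the reciprocal itself, which is smooth to one
  order less by induction, so no general chain rule enters.\<close>

lemma Ck_inverse:
  assumes "\<And>x. f x \<noteq> 0"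
  shows "Ck k f \<Longrightarrow> Ck k (\<lambda>x. inverse (f x))"
proof (induction k)
  case 0
  then show ?case using assms by (auto intro!: continuous_intros)
next
  case (Suc k)
  show ?case
  proof (rule Ck_SucI[where G = "\<lambda>x. - (inverse (f x))\<^sup>2 *\<^sub>R grad f x"])
    show "GDERIV (\<lambda>x. inverse (f x)) x :> - (inverse (f x))\<^sup>2 *\<^sub>R grad f x" for x
      by (intro GDERIV_inverse Ck_Suc_GDERIV[OF Suc.prems] assms)
    show "Ck k (\<lambda>x. (- (inverse (f x))\<^sup>2 *\<^sub>R grad f x) \<bullet> b)" if "b \<in> Basis" for b
    proof -
      have inv: "Ck k (\<lambda>x. inverse (f x))" by (rule Suc.IH[OF Ck_SucD[OF Suc.prems]])
      have "Ck k (\<lambda>x. (-1) * (inverse (f x) * inverse (f x)) * (grad f x \<bullet> b))"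
        by (intro Ck_mult inv Ck_const Ck_Suc_grad[OF Suc.prems that])
      then show ?thesis by (simp add: power2_eq_square)
    qed
  qed
qed

text \<open>\<open>exp_flat 0\<close> is the standard flat function; \<open>(exp_flat m)' = exp_flat (m + 2) - m exp_flat (m + 1)\<close>,
  so the family is closed under differentiation up to linear combinations.\<close>

definition exp_flat :: "nat \<Rightarrow> real \<Rightarrow> real" where
  "exp_flat m x = (if x \<le> 0 then 0 else exp (- (1 / x)) / x ^ m)"

text \<open>With N = m + j and x > 0, the inequality exp (1 / (x N)) >= 1 / (x N) raised to the
  power N gives exp (1 / x) >= 1 / (N x)^N, whence the constant N^N. The exponent j is even so that
  the right-hand side stays nonnegative for x <= 0.\<close>

lemma exp_flat_bound: "\<exists>C\<ge>0. \<forall>x. \<bar>exp_flat m x\<bar> \<le> C * x ^ j"  if "even j"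
proof (intro exI conjI allI)
  let ?n = "m + j"
  show "0 \<le> real (?n ^ ?n)" by simp
  fix x :: real
  show "\<bar>exp_flat m x\<bar> \<le> real (?n ^ ?n) * x ^ j"
  proof (cases "x \<le> 0")
    case True
    then show ?thesis
      using zero_le_even_power[OF that, of x] by (simp add: exp_flat_def)
  next
    case False
    have "1 \<le> real (?n ^ ?n) * x ^ ?n * exp (1 / x)"
    proof (cases "?n = 0")
      case True
      with False show ?thesis by simp
    next
      case n: False
      define N where "N = real ?n"
      have N: "N > 0" using n unfolding N_def by linarith
      have "1 / (x * N) \<le> exp (1 / (x * N))"
        using exp_ge_add_one_self[of "1 / (x * N)"] by linarith
      then have "(1 / (x * N)) ^ ?n \<le> exp (1 / (x * N)) ^ ?n"
        using False N by (intro power_mono) auto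
      also have "\<dots> = exp (N * (1 / (x * N)))"
        unfolding N_def by (rule exp_of_nat_mult[symmetric])
      also have "N * (1 / (x * N)) = 1 / x" using N by simp
      finally have "1 \<le> N ^ ?n * x ^ ?n * exp (1 / x)"
        using N False by (simp add: field_simps power_mult_distrib power_divide)
      then show ?thesis by (simp add: N_def)
    qed
    then show ?thesis
      using False by (simp add: exp_flat_def exp_minus field_simps power_add)
  qed
qed

lemma DERIV_exp_flat:
  "(exp_flat m has_real_derivative (exp_flat (m + 2) x - real m * exp_flat (m + 1) x)) (at x)"
proof (cases x "0::real" rule: linorder_cases)
  case less
  have "((\<lambda>x. 0) has_real_derivative 0) (at x)" by simp
  then have "(exp_flat m has_real_derivative 0) (at x)"
    by (rule has_field_derivative_transform_within_open[of _ _ _ "{..<0}"])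
      (use less in \<open>auto simp: exp_flat_def\<close>)
  with less show ?thesis by (simp add: exp_flat_def)
next
  case greater
  have "((\<lambda>x. exp (- (1 / x)) / x ^ m) has_real_derivative
      (exp (- (1 / x)) / x\<^sup>2 * x ^ m - exp (- (1 / x)) * (real m * x ^ (m - 1))) / (x ^ m * x ^ m)) (at x)"
    using greater by (auto intro!: derivative_eq_intros simp: power2_eq_square)
  also have "(exp (- (1 / x)) / x\<^sup>2 * x ^ m - exp (- (1 / x)) * (real m * x ^ (m - 1))) / (x ^ m * x ^ m)
      = exp_flat (m + 2) x - real m * exp_flat (m + 1) x"
    using greater by (cases m) (auto simp: exp_flat_def field_simps power2_eq_square)
  finally show ?thesis
    by (rule has_field_derivative_transform_within_open[of _ _ _ "{0<..}"])
      (use greater in \<open>auto simp: exp_flat_def\<close>)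
next
  case equal
  \<comment> \<open>A quadratic bound at the origin makes the difference quotient there at most C
    |h|.\<close>
  obtain C where C: "C \<ge> 0" "\<And>x. \<bar>exp_flat m x\<bar> \<le> C * x ^ 2"
    using exp_flat_bound[of 2 m] by auto
  have "((\<lambda>h. exp_flat m h / h) \<longlongrightarrow> 0) (at 0)"
  proof (rule Lim_null_comparison)
    show "\<forall>\<^sub>F h in at 0. norm (exp_flat m h / h) \<le> C * \<bar>h\<bar>"
      by (intro always_eventually allI)
        (use C in \<open>auto simp: divide_simps power2_eq_square abs_mult mult.assoc abs_mult_self_eq\<close>)
    show "((\<lambda>h. C * \<bar>h\<bar>) \<longlongrightarrow> 0) (at 0)" by (auto intro!: tendsto_eq_intros)
  qed
  then have "(exp_flat m has_real_derivative 0) (at 0)"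
    by (simp add: DERIV_def exp_flat_def[of _ 0])
  with equal show ?thesis by (simp add: exp_flat_def)
qed

text \<open>Differentiation raises the index m, hence the generalisation over m in the
  induction.\<close>

lemma Ck_exp_flat_compose:
  assumes "\<And>k. Ck k q"
  shows "Ck k (\<lambda>x. exp_flat m (q x))"
proof (induction k arbitrary: m)
  case 0
  have "continuous_on UNIV (exp_flat m)"
    by (meson DERIV_exp_flat DERIV_isCont continuous_at_imp_continuous_on)
  with assms[of 0] show ?case by (auto intro: continuous_on_compose2)
next
  case (Suc k)
  let ?d = "\<lambda>x. exp_flat (m + 2) (q x) - real m * exp_flat (m + 1) (q x)"
  show ?case
  proof (rule Ck_SucI[where G = "\<lambda>x. ?d x *\<^sub>R grad q x"])
    show "GDERIV (\<lambda>x. exp_flat m (q x)) x :> ?d x *\<^sub>R grad q x" for x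
      by (rule GDERIV_DERIV_compose[OF Ck_Suc_GDERIV[OF assms] DERIV_exp_flat])
    show "Ck k (\<lambda>x. (?d x *\<^sub>R grad q x) \<bullet> b)" if "b \<in> Basis" for b
      unfolding inner_scaleR_left
      by (intro Ck_mult Ck_diff Ck_cmult Suc.IH Ck_Suc_grad assms that)
  qed
qed

lemma Ck_norm_diff_sq: "Ck k (\<lambda>x. (norm (x - p))\<^sup>2)"
proof -
  have "Ck k (\<lambda>x. \<Sum>b\<in>Basis. (x \<bullet> b - p \<bullet> b) * (x \<bullet> b - p \<bullet> b))"
    by (intro Ck_sum Ck_mult Ck_diff Ck_inner Ck_const)
  moreover have "(norm (x - p))\<^sup>2 = (\<Sum>b\<in>Basis. (x \<bullet> b - p \<bullet> b) * (x \<bullet> b - p \<bullet> b))" for x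
    by (subst power2_norm_eq_inner, subst euclidean_inner) (simp add: inner_diff_left)
  ultimately show ?thesis by simp
qed

section \<open>Bump functions and cutoffs\<close>

definition bump :: "'a::euclidean_space \<Rightarrow> real \<Rightarrow> 'a \<Rightarrow> real" where
  "bump p r x = exp_flat 0 (1 - (norm (x - p))\<^sup>2 / r\<^sup>2)"

lemma Ck_bump: "Ck k (bump p r)"
proof -
  have "Ck k (\<lambda>x. 1 - inverse (r\<^sup>2) * (norm (x - p))\<^sup>2)" for k
    by (intro Ck_diff Ck_cmult Ck_const Ck_norm_diff_sq)
  from Ck_exp_flat_compose[OF this] show ?thesis
    unfolding bump_def[abs_def] by (simp add: field_simps)
qed

lemma exp_flat_0_nonneg: "0 \<le> exp_flat 0 z" and exp_flat_0_le_1: "exp_flat 0 z \<le> 1"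
  and exp_flat_0_pos_iff: "0 < exp_flat 0 z \<longleftrightarrow> 0 < z"
  by (auto simp: exp_flat_def)

lemma bump_nonneg: "0 \<le> bump p r x" and bump_le_1: "bump p r x \<le> 1"
  by (auto simp: bump_def exp_flat_0_nonneg exp_flat_0_le_1)

lemma bump_eq_0_iff: "r > 0 \<Longrightarrow> bump p r x = 0 \<longleftrightarrow> x \<notin> ball p r"
proof -
  assume r: "r > 0"
  have "0 < bump p r x \<longleftrightarrow> (norm (x - p))\<^sup>2 < r\<^sup>2"
    using r by (simp add: bump_def exp_flat_0_pos_iff)
  also have "\<dots> \<longleftrightarrow> norm (x - p) < r"
    using r by (metis norm_ge_zero power2_less_imp_less power_strict_mono less_eq_real_def zero_less_numeral pos2)
  finally show ?thesis
    using bump_nonneg[of p r x] by (auto simp: dist_norm norm_minus_commute)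
qed

text \<open>The quotient f / (f + g), where f is positive exactly on the ball of radius r and g
  exactly outside the closed ball of radius r / 2. The denominator never vanishes, and the quotient
  is 1 where g = 0 and 0 where f = 0.\<close>

lemma smooth_cutoff:
  fixes p :: "'a::euclidean_space"
  assumes r: "r > 0"
  obtains \<theta> where "\<And>k. Ck k \<theta>" "\<And>x. 0 \<le> \<theta> x" "\<And>x. \<theta> x \<le> 1"
    "\<And>x. x \<in> ball p (r / 2) \<Longrightarrow> \<theta> x = 1" "\<And>x. \<theta> x \<noteq> 0 \<Longrightarrow> x \<in> ball p r"
proof
  define f where "f = bump p r"
  define g where "g x = exp_flat 0 ((norm (x - p))\<^sup>2 - (r / 2)\<^sup>2)" for x
  have Ck_g: "Ck k g" for k
    unfolding g_def[abs_def] by (intro Ck_exp_flat_compose Ck_diff Ck_norm_diff_sq Ck_const)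
  have g0: "0 \<le> g x" for x by (simp add: g_def exp_flat_0_nonneg)
  have g_pos: "0 < g x" if "x \<notin> ball p r" for x
  proof -
    have "r / 2 < norm (x - p)" using that r by (auto simp: dist_norm norm_minus_commute)
    then show ?thesis using r by (auto simp: g_def exp_flat_0_pos_iff power_strict_mono)
  qed
  have pos: "0 < f x + g x" for x
    using bump_nonneg[of p r x] bump_eq_0_iff[OF r, of p x] g0[of x] g_pos[of x]
    unfolding f_def by (cases "x \<in> ball p r") (auto intro: add_pos_nonneg add_nonneg_pos simp: less_eq_real_def)
  let ?t = "\<lambda>x. f x * inverse (f x + g x)"
  show "Ck k ?t" for k
    using pos by (intro Ck_mult Ck_inverse Ck_add Ck_g) (auto simp: f_def Ck_bump less_le dest: sym)
  show "0 \<le> ?t x" "?t x \<le> 1" for x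
    using pos[of x] g0[of x] bump_nonneg[of p r x] by (auto simp: f_def field_simps)
  show "?t x = 1" if "x \<in> ball p (r / 2)" for x
  proof -
    have "(norm (x - p))\<^sup>2 \<le> (r / 2)\<^sup>2"
      using that by (intro power_mono) (auto simp: dist_norm norm_minus_commute)
    then have "g x = 0" by (simp add: g_def exp_flat_def)
    with pos[of x] show ?thesis by simp
  qed
  show "x \<in> ball p r" if "?t x \<noteq> 0" for x
    using that bump_eq_0_iff[OF r, of p x] by (auto simp: f_def)
qed

section \<open>Test functions\<close>

definition supp :: "('a::topological_space \<Rightarrow> real) \<Rightarrow> 'a set" where
  "supp f = closure {x. f x \<noteq> 0}"

lemma in_suppI: "f x \<noteq> 0 \<Longrightarrow> x \<in> supp f"
  using closure_subset[of "{x. f x \<noteq> 0}"] by (auto simp: supp_def)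

lemma open_not_supp: "open (- supp f)"
  unfolding supp_def by (rule open_Compl) simp

lemma test_functionsI:
  assumes "\<And>k. Ck k f" "compact K" "K \<subseteq> A" "\<And>x. f x \<noteq> 0 \<Longrightarrow> x \<in> K"
  shows "f \<in> test_functions A"
proof -
  have K: "supp f \<subseteq> K"
    unfolding supp_def using assms by (intro closure_minimal) (auto intro: compact_imp_closed)
  then have "compact (supp f)"
    using assms(2) unfolding supp_def
    by (metis bounded_subset closed_closure compact_eq_bounded_closed)
  with K show ?thesis using assms unfolding test_functions_def supp_def by auto
qed

lemma test_functions_Ck: "f \<in> test_functions A \<Longrightarrow> Ck k f"
  by (simp add: test_functions_def)

lemma test_functions_mono: "A \<subseteq> B \<Longrightarrow> f \<in> test_functions A \<Longrightarrow> f \<in> test_functions B"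
  by (auto simp: test_functions_def)

lemma test_functions_support:
  assumes "f \<in> test_functions A"
  shows "compact (supp f)" "supp f \<subseteq> A"
  using assms by (auto simp: test_functions_def supp_def)

lemma test_functions_eq_0: "f \<in> test_functions A \<Longrightarrow> x \<notin> A \<Longrightarrow> f x = 0"
  using test_functions_support(2)[of f A] in_suppI[of f x] by blast

lemma test_functions_zero: "(\<lambda>x. 0) \<in> test_functions A"
  by (rule test_functionsI[of _ "{}"]) auto

lemma test_functions_add:
  assumes "f \<in> test_functions A" "g \<in> test_functions A"
  shows "(\<lambda>x. f x + g x) \<in> test_functions A"
proof (rule test_functionsI[of _ "supp f \<union> supp g"])
  show "compact (supp f \<union> supp g)" "supp f \<union> supp g \<subseteq> A"
    using assms by (auto intro: compact_Un test_functions_support dest: test_functions_support(2))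
  show "x \<in> supp f \<union> supp g" if "f x + g x \<noteq> 0" for x
    using that in_suppI[of f x] in_suppI[of g x] by (cases "f x = 0") auto
qed (auto intro: Ck_add test_functions_Ck assms)

lemma test_functions_mult:
  assumes "f \<in> test_functions A" "\<And>k. Ck k g"
  shows "(\<lambda>x. g x * f x) \<in> test_functions A"
  by (rule test_functionsI[of _ "supp f"])
    (use assms test_functions_support[OF assms(1)] in \<open>auto intro!: Ck_mult intro: test_functions_Ck
      in_suppI\<close>)

lemma test_functions_cmult: "f \<in> test_functions A \<Longrightarrow> (\<lambda>x. c * f x) \<in> test_functions A"
  by (rule test_functions_mult) simp_all

lemma test_functions_sum:
  "(\<And>i. i \<in> I \<Longrightarrow> f i \<in> test_functions A) \<Longrightarrow> (\<lambda>x. \<Sum>i\<in>I. f i x) \<in> test_functions A"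
  by (induction I rule: infinite_finite_induct) (auto intro: test_functions_add test_functions_zero)

lemma test_functions_GDERIV: "f \<in> test_functions A \<Longrightarrow> GDERIV f x :> grad f x"
  by (rule Ck_Suc_GDERIV[of 0]) (rule test_functions_Ck)

lemma grad_eq_0_outside:
  assumes "f \<in> test_functions A" "x \<notin> supp f"
  shows "grad f x = 0"
proof (rule grad_eqI)
  have "((\<lambda>x. 0) has_derivative (\<lambda>h. h \<bullet> 0)) (at x)" by (simp add: has_derivative_const)
  then have "(f has_derivative (\<lambda>h. h \<bullet> 0)) (at x)"
    by (rule has_derivative_transform_within_open[of _ _ _ _ "- supp f", OF _ open_not_supp])
      (use assms(2) in_suppI[of f] in auto)
  then show "GDERIV f x :> 0" by (simp add: gderiv_def)
qed

lemma in_supp_grad: "f \<in> test_functions A \<Longrightarrow> grad f x \<noteq> 0 \<Longrightarrow> x \<in> supp f"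
  using grad_eq_0_outside by blast

lemma test_functions_grad:
  assumes "f \<in> test_functions A" "b \<in> Basis"
  shows "(\<lambda>x. grad f x \<bullet> b) \<in> test_functions A"
  by (rule test_functionsI[of _ "supp f"])
    (use assms test_functions_support[OF assms(1)] in
      \<open>auto intro!: in_supp_grad[OF assms(1)] intro: Ck_Suc_grad test_functions_Ck simp del: Ck.simps(2)\<close>)

lemma test_functions_continuous: "f \<in> test_functions A \<Longrightarrow> continuous_on S f"
  using Ck_continuous_on[OF test_functions_Ck] continuous_on_subset by blast

lemma grad_continuous:
  assumes "f \<in> test_functions A"
  shows "continuous_on S (grad f)"
proof -
  have "continuous_on S (\<lambda>x. \<Sum>b\<in>Basis. (grad f x \<bullet> b) *\<^sub>R b)"
    by (intro continuous_on_sum continuous_on_scaleR continuous_on_const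
        test_functions_continuous[OF test_functions_grad[OF assms]])
  then show ?thesis by (simp add: euclidean_representation)
qed

lemma test_functions_measurable: "f \<in> test_functions A \<Longrightarrow> f \<in> borel_measurable borel"
  by (intro borel_measurable_continuous_onI test_functions_continuous)

lemma grad_measurable: "f \<in> test_functions A \<Longrightarrow> grad f \<in> borel_measurable borel"
  by (intro borel_measurable_continuous_onI grad_continuous)

lemma integrable_compact_support:
  fixes f :: "'a::euclidean_space \<Rightarrow> 'b::euclidean_space"
  assumes "continuous_on UNIV f" "compact K" "\<And>x. f x \<noteq> 0 \<Longrightarrow> x \<in> K"
  shows "integrable lborel f"
proof -
  have "(\<lambda>x. indicator K x *\<^sub>R f x) = f"
    using assms(3) by (auto simp: indicator_def fun_eq_iff)
  with borel_integrable_compact[OF assms(2), of f] show ?thesis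
    using continuous_on_subset[OF assms(1)] by auto
qed

lemma integrable_test_function_times:
  fixes G :: "'a::euclidean_space \<Rightarrow> 'b::euclidean_space"
  assumes f: "f \<in> test_functions A" and "continuous_on UNIV G"
  shows "integrable lborel (\<lambda>x. f x *\<^sub>R G x)"
  by (rule integrable_compact_support[of _ "supp f"])
    (use assms test_functions_support[OF f] test_functions_continuous[OF f]
      in_suppI[of f] in
      \<open>auto intro!: continuous_intros\<close>)

lemma integrable_test_function: "f \<in> test_functions A \<Longrightarrow> integrable lborel f"
  using integrable_test_function_times[of f A "\<lambda>x. 1::real"] by simp

lemma integrable_test_function_sq: "f \<in> test_functions A \<Longrightarrow> integrable lborel (\<lambda>x. (f x)\<^sup>2)"
  using integrable_test_function_times[of f A f] test_functions_continuous[of f A UNIV]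
  by (simp add: power2_eq_square)

lemma integrable_grad:
  assumes "f \<in> test_functions A" shows "integrable lborel (grad f)"
  by (rule integrable_compact_support[of _ "supp f"])
    (use grad_continuous[OF assms] test_functions_support[OF assms] in_supp_grad[OF assms] in auto)

lemma integrable_grad_sq:
  assumes "f \<in> test_functions A" shows "integrable lborel (\<lambda>x. (norm (grad f x))\<^sup>2)"
  by (rule integrable_compact_support[of _ "supp f"])
    (use assms grad_continuous[OF assms] test_functions_support[OF assms] in_supp_grad[OF assms]
      in \<open>auto intro!: continuous_intros\<close>)

section \<open>Global bounds, Lipschitz constants and Taylor remainders of test functions\<close>

lemma test_functions_bounded:
  assumes f: "f \<in> test_functions A"
  obtains B where "B > 0" "\<And>x. \<bar>f x\<bar> \<le> B"
proof -
  have "bounded (f ` supp f)"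
    using test_functions_support(1)[OF f] test_functions_continuous[OF f]
    by (intro compact_imp_bounded compact_continuous_image)
  then obtain B where B: "B > 0" "\<And>x. x \<in> supp f \<Longrightarrow> \<bar>f x\<bar> \<le> B"
    unfolding bounded_pos by auto
  have "\<bar>f x\<bar> \<le> B" for x
    using B in_suppI[of f x] by (cases "f x = 0") auto
  with B show ?thesis using that by blast
qed

lemma grad_bounded:
  assumes f: "f \<in> test_functions A"
  obtains B where "B > 0" "\<And>x. norm (grad f x) \<le> B"
proof -
  have "bounded (grad f ` supp f)"
    using test_functions_support(1)[OF f] grad_continuous[OF f]
    by (intro compact_imp_bounded compact_continuous_image)
  then obtain B where B: "B > 0" "\<And>x. x \<in> supp f \<Longrightarrow> norm (grad f x) \<le> B"
    unfolding bounded_pos by auto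
  have "norm (grad f x) \<le> B" for x
    using B grad_eq_0_outside[OF f, of x] by (cases "x \<in> supp f") auto
  with B show ?thesis using that by blast
qed

lemma onorm_inner_le: "onorm (\<lambda>h. h \<bullet> c) \<le> norm c"
  by (rule onorm_bound) (auto simp: Cauchy_Schwarz_ineq2 mult.commute[of "norm c"])

lemma test_functions_lipschitz:
  assumes f: "f \<in> test_functions A"
  obtains L where "L > 0" "\<And>x y. \<bar>f x - f y\<bar> \<le> L * norm (x - y)"
proof -
  obtain B where B: "B > 0" "\<And>x. norm (grad f x) \<le> B" using grad_bounded[OF f] by blast
  have "norm (f x - f y) \<le> B * norm (x - y)" for x y
    by (rule differentiable_bound[of UNIV f "\<lambda>x h. h \<bullet> grad f x"])
      (use B test_functions_GDERIV[OF f] in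
        \<open>auto simp: gderiv_def intro: order_trans[OF onorm_inner_le]\<close>)
  with B show ?thesis using that by auto
qed

lemma grad_lipschitz:
  fixes f :: "'a::euclidean_space \<Rightarrow> real"
  assumes f: "f \<in> test_functions A"
  obtains L where "L > 0" "\<And>x y. norm (grad f x - grad f y) \<le> L * norm (x - y)"
proof -
  have "\<forall>b\<in>Basis. \<exists>L>0. \<forall>x y. \<bar>grad f x \<bullet> b - grad f y \<bullet> b\<bar> \<le> L * norm (x - y)"
    using test_functions_lipschitz[OF test_functions_grad[OF f]] by metis
  then obtain L where L: "\<And>b. b \<in> Basis \<Longrightarrow> L b > 0"
    "\<And>b x y. b \<in> Basis \<Longrightarrow> \<bar>grad f x \<bullet> b - grad f y \<bullet> b\<bar> \<le> L b * norm (x - y)"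
    by metis
  have "norm (grad f x - grad f y) \<le> (\<Sum>b\<in>Basis. L b) * norm (x - y)" for x y
  proof -
    have "norm (grad f x - grad f y) \<le> (\<Sum>b\<in>Basis. \<bar>(grad f x - grad f y) \<bullet> b\<bar>)"
      by (rule norm_le_l1)
    also have "\<dots> \<le> (\<Sum>b\<in>Basis. L b * norm (x - y))"
      by (intro sum_mono) (simp add: L inner_diff_left)
    finally show ?thesis by (simp add: sum_distrib_right)
  qed
  moreover have "(\<Sum>b\<in>Basis. L b) > 0" by (intro sum_pos) (auto simp: L)
  ultimately show ?thesis using that by blast
qed

text \<open>The linearisation error is controlled by the oscillation of the gradient over a ball of
  radius |h|, and the gradient is globally Lipschitz. Uniformity in x matters: the remainder is
  integrated over x in \<open>integral_grad_eq_0\<close> and against u in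
  \<open>GDERIV_conv\<close>.\<close>

lemma taylor_test_function:
  assumes f: "f \<in> test_functions A"
  obtains L where "L > 0" "\<And>x h. \<bar>f (x + h) - f x - h \<bullet> grad f x\<bar> \<le> L * (norm h)\<^sup>2"
proof -
  obtain L where L: "L > 0" "\<And>x y. norm (grad f x - grad f y) \<le> L * norm (x - y)"
    using grad_lipschitz[OF f] by blast
  have "\<bar>f (x + h) - f x - h \<bullet> grad f x\<bar> \<le> L * (norm h)\<^sup>2" for x h
  proof -
    have "norm (f (x + h) - f x - (x + h - x) \<bullet> grad f x) \<le> norm (x + h - x) * (L * norm h)"
    proof (rule differentiable_bound_linearization[of x "x + h" "cball x (norm h)" f "\<lambda>y h. h \<bullet> grad f y"])
      show "x + t *\<^sub>R (x + h - x) \<in> cball x (norm h)" if "t \<in> {0..1}" for t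
        using that by (auto simp: dist_norm mult_left_le_one_le)
      show "(f has_derivative (\<lambda>h. h \<bullet> grad f y)) (at y within cball x (norm h))" for y
        using test_functions_GDERIV[OF f, of y] by (auto simp: gderiv_def intro: has_derivative_at_withinI)
      show "onorm ((\<lambda>h. h \<bullet> grad f y) - (\<lambda>h. h \<bullet> grad f x)) \<le> L * norm h"
        if "y \<in> cball x (norm h)" for y
      proof -
        have "onorm ((\<lambda>h. h \<bullet> grad f y) - (\<lambda>h. h \<bullet> grad f x)) \<le> norm (grad f y - grad f x)"
          using onorm_inner_le[of "grad f y - grad f x"] by (simp add: fun_diff_def inner_diff_right)
        also have "\<dots> \<le> L * norm (y - x)" by (rule L)
        also have "\<dots> \<le> L * norm h"
          using that L(1) by (auto simp: dist_norm norm_minus_commute)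
        finally show ?thesis .
      qed
    qed auto
    then show ?thesis by (simp add: power2_eq_square mult.left_commute)
  qed
  with L(1) show ?thesis using that by blast
qed

section \<open>Integration over the whole space\<close>

lemma distr_lborel_translate: "distr lborel borel (\<lambda>x. x + c) = (lborel :: 'a::euclidean_space measure)"
  using lborel_distr_plus[of c] by (simp add: add.commute[of _ c])

lemma nn_integral_translate:
  fixes c :: "'a::euclidean_space"
  assumes "f \<in> borel_measurable borel"
  shows "(\<integral>\<^sup>+x. f (x + c) \<partial>lborel) = (\<integral>\<^sup>+x. f x \<partial>lborel)"
  using assms by (subst (2) distr_lborel_translate[of c, symmetric]) (simp add: nn_integral_distr)

lemma integral_translate:
  fixes c :: "'a::euclidean_space" and f :: "'a \<Rightarrow> 'b::{banach, second_countable_topology}"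
  assumes "f \<in> borel_measurable borel"
  shows "(LINT x|lborel. f (x + c)) = (LINT x|lborel. f x)"
  using assms by (subst (2) distr_lborel_translate[of c, symmetric]) (simp add: integral_distr)

lemma integrable_translate:
  fixes c :: "'a::euclidean_space" and f :: "'a \<Rightarrow> 'b::{banach, second_countable_topology}"
  assumes "integrable lborel f"
  shows "integrable lborel (\<lambda>x. f (x + c))"
proof -
  have "integrable (distr lborel borel (\<lambda>x. x + c)) f" using assms by (simp add: distr_lborel_translate)
  then show ?thesis using borel_measurable_integrable[OF assms] by (subst (asm) integrable_distr_eq) auto
qed

lemma test_functions_translate:
  assumes "f \<in> test_functions A"
  shows "(\<lambda>x. f (x + c)) \<in> test_functions UNIV"
proof (rule test_functionsI[of _ "(\<lambda>x. x - c) ` supp f"])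
  show "compact ((\<lambda>x. x - c) ` supp f)"
    by (intro compact_continuous_image test_functions_support(1)[OF assms] continuous_intros)
  show "x \<in> (\<lambda>x. x - c) ` supp f" if "f (x + c) \<noteq> 0" for x
    using that in_suppI[of f "x + c"] by (intro image_eqI[of _ _ "x + c"]) auto
qed (auto intro: Ck_translate test_functions_Ck[OF assms])

text \<open>Translation invariance makes f(x + h b) - f(x) integrate to zero, so h times the
  integral of the partial derivative equals, up to sign, the integral of the Taylor remainder. For
  |h| <= 1 that remainder lives in a fixed ball and is O(h^2); dividing by h and letting h tend to 0
  gives the claim. This is the source of all integration by parts below.\<close>

lemma integral_grad_eq_0:
  fixes f :: "'a::euclidean_space \<Rightarrow> real"
  assumes f: "f \<in> test_functions A"
  shows "(LINT x|lborel. grad f x) = 0"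
proof -
  have "(LINT x|lborel. grad f x \<bullet> b) = 0" if b: "b \<in> Basis" for b
  proof -
    obtain L where L: "L > 0" "\<And>x h. \<bar>f (x + h) - f x - h \<bullet> grad f x\<bar> \<le> L * (norm h)\<^sup>2"
      using taylor_test_function[OF f] by blast
    let ?K = "supp f"
    obtain R where R: "\<And>x. x \<in> ?K \<Longrightarrow> norm x \<le> R"
      using compact_imp_bounded[OF test_functions_support(1)[OF f]] unfolding bounded_iff by blast
    define V where "V = measure lborel (cball (0::'a) (R + 1))"
    let ?D = "\<lambda>h x. f (x + h *\<^sub>R b) - f x - h *\<^sub>R b \<bullet> grad f x"
    have int: "integrable lborel (\<lambda>x. f (x + c))" for c
      by (rule integrable_translate[OF integrable_test_function[OF f]])
    have intg: "integrable lborel (\<lambda>x. grad f x \<bullet> b)"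
      using integrable_test_function[OF test_functions_grad[OF f b]] .
    have est: "\<bar>h\<bar> * \<bar>LINT x|lborel. grad f x \<bullet> b\<bar> \<le> L * h\<^sup>2 * V" if h: "\<bar>h\<bar> \<le> 1" for h
    proof -
      have supp: "x \<in> cball (0::'a) (R + 1)" if "?D h x \<noteq> 0" for x
      proof (rule ccontr)
        assume x: "x \<notin> cball 0 (R + 1)"
        have "x + h *\<^sub>R b \<notin> ?K"
        proof
          assume "x + h *\<^sub>R b \<in> ?K"
          then have "norm (x + h *\<^sub>R b) \<le> R" by (rule R)
          moreover have "norm x \<le> norm (x + h *\<^sub>R b) + norm (h *\<^sub>R b)"
            using norm_triangle_ineq4[of "x + h *\<^sub>R b" "h *\<^sub>R b"] by simp
          moreover have "norm (h *\<^sub>R b) \<le> 1" using h b by simp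
          ultimately show False using x by simp
        qed
        moreover have "x \<notin> ?K" using R[of x] x by auto
        ultimately have "f (x + h *\<^sub>R b) = 0" "f x = 0" "grad f x = 0"
          using grad_eq_0_outside[OF f, of x] in_suppI[of f x] in_suppI[of f "x + h *\<^sub>R b"] by argo+
        with that show False by simp
      qed
      have "\<bar>h\<bar> * \<bar>LINT x|lborel. grad f x \<bullet> b\<bar> = \<bar>LINT x|lborel. ?D h x\<bar>"
        using int intg int[of 0] integral_translate[OF test_functions_measurable[OF f], of "h *\<^sub>R b"]
        by (simp add: abs_mult inner_commute[of b])
      also have "\<dots> \<le> (LINT x|lborel. \<bar>?D h x\<bar>)"
        by (rule integral_abs_bound)
      also have "\<dots> \<le> (LINT x|lborel. indicator (cball (0::'a) (R + 1)) x * (L * h\<^sup>2))"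
      proof (rule Bochner_Integration.integral_mono)
        show "integrable lborel (\<lambda>x. \<bar>?D h x\<bar>)"
          using int intg int[of 0] by (simp add: inner_commute[of b])
        show "integrable lborel (\<lambda>x. indicator (cball (0::'a) (R + 1)) x * (L * h\<^sup>2) :: real)"
          by (intro integrable_mult_left integrable_real_indicator emeasure_bounded_finite bounded_cball) simp
        show "\<bar>?D h x\<bar> \<le> indicator (cball (0::'a) (R + 1)) x * (L * h\<^sup>2)" for x
        proof (cases "?D h x = 0")
          case True
          then show ?thesis using L(1) by (simp add: less_imp_le)
        next
          case False
          have "\<bar>?D h x\<bar> \<le> L * h\<^sup>2" using L(2)[of x "h *\<^sub>R b"] b by simp
          then show ?thesis using supp[OF False] by simp
        qed
      qed
      also have "\<dots> = L * h\<^sup>2 * V" by (simp add: V_def)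
      finally show ?thesis .
    qed
    have "\<bar>LINT x|lborel. grad f x \<bullet> b\<bar> \<le> L * V * h" if h: "0 < h" "h \<le> 1" for h
    proof -
      have "h * \<bar>LINT x|lborel. grad f x \<bullet> b\<bar> \<le> h * (L * V * h)"
        using est[of h] h by (simp add: power2_eq_square mult.commute mult.left_commute)
      then show ?thesis using h by (simp only: mult_le_cancel_left_pos)
    qed
    then have "\<forall>\<^sub>F h in at_right 0. \<bar>LINT x|lborel. grad f x \<bullet> b\<bar> \<le> L * V * h"
      unfolding eventually_at_right_field by (intro exI[of _ 1] conjI zero_less_one allI impI) (blast intro: less_imp_le)
    moreover have "((\<lambda>h. L * V * h) \<longlongrightarrow> 0) (at_right 0)"
      by (rule tendsto_mult_right_zero) (rule tendsto_ident_at)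
    ultimately have "\<bar>LINT x|lborel. grad f x \<bullet> b\<bar> \<le> 0"
      by - (rule tendsto_lowerbound, assumption+, rule trivial_limit_at_right_real)
    then show ?thesis by simp
  qed
  note zero = this
  show ?thesis
  proof (rule euclidean_eqI)
    fix b :: 'a assume b: "b \<in> Basis"
    have "(LINT x|lborel. grad f x) \<bullet> b = (LINT x|lborel. grad f x \<bullet> b)"
      by (rule integral_inner_left[symmetric]) (rule integrable_grad[OF f])
    then show "(LINT x|lborel. grad f x) \<bullet> b = 0 \<bullet> b" by (simp only: zero[OF b] inner_zero_left)
  qed
qed

text \<open>Write the increment as the integral of h . grad f(x + \<tau> h) over \<tau> in [0,1],
  apply Jensen pointwise, exchange the integrals and translate back in x.\<close>

lemma translation_estimate:
  fixes f :: "'a::euclidean_space \<Rightarrow> real"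
  assumes f: "f \<in> test_functions A"
  shows "(LINT x|lborel. (f (x + h) - f x)\<^sup>2) \<le> (norm h)\<^sup>2 * (LINT x|lborel. (norm (grad f x))\<^sup>2)"
proof -
  note [measurable] = test_functions_measurable[OF f] grad_measurable[OF f]
  let ?I = "indicator {0..1} :: real \<Rightarrow> real"
  have pt: "ennreal ((f (x + h) - f x)\<^sup>2)
      \<le> (\<integral>\<^sup>+\<tau>. ennreal (?I \<tau> * (h \<bullet> grad f (x + \<tau> *\<^sub>R h))\<^sup>2) \<partial>lborel)" for x
  proof -
    define g where "g \<tau> = h \<bullet> grad f (x + \<tau> *\<^sub>R h)" for \<tau>
    define m where "m = f (x + h) - f x"
    have g: "continuous_on S g" for S
      unfolding g_def by (intro continuous_intros continuous_on_compose2[OF grad_continuous[OF f, of UNIV]]) auto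
    have "((\<lambda>\<tau>. f (x + \<tau> *\<^sub>R h)) has_vector_derivative g \<tau>) (at \<tau> within {0..1})" for \<tau>
    proof -
      have "((\<lambda>\<tau>. x + \<tau> *\<^sub>R h) has_derivative (\<lambda>t. t *\<^sub>R h)) (at \<tau> within {0..1})"
        by (auto intro!: derivative_eq_intros)
      from has_derivative_compose[OF this
        test_functions_GDERIV[OF f, of "x + \<tau> *\<^sub>R h", unfolded gderiv_def]]
      show ?thesis by (simp add: has_vector_derivative_def g_def)
    qed
    from integral_FTC_atLeastAtMost[OF zero_le_one this g]
    have m: "(LINT \<tau>|lborel. ?I \<tau> * g \<tau>) = m" by (simp add: m_def)
    have i1: "integrable lborel (\<lambda>\<tau>. ?I \<tau> * g \<tau>)"
      using borel_integrable_compact[OF compact_Icc g] by simp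
    have i2: "integrable lborel (\<lambda>\<tau>. ?I \<tau> * (g \<tau>)\<^sup>2)"
      using borel_integrable_compact[OF compact_Icc, of 0 1 "\<lambda>\<tau>. (g \<tau>)\<^sup>2"] g
      by (simp add: continuous_intros)
    have i3: "integrable lborel (\<lambda>\<tau>. ?I \<tau> * m\<^sup>2)"
      by (intro integrable_mult_left integrable_real_indicator) auto
    \<comment> \<open>Jensen on the unit interval, obtained as nonnegativity of the variance of g
      about its mean m.\<close>
    have "0 \<le> (LINT \<tau>|lborel. ?I \<tau> * (g \<tau> - m)\<^sup>2)" by (intro integral_nonneg_AE) auto
    also have "(\<lambda>\<tau>. ?I \<tau> * (g \<tau> - m)\<^sup>2) =
        (\<lambda>\<tau>. ?I \<tau> * (g \<tau>)\<^sup>2 - 2 * m * (?I \<tau> * g \<tau>) + ?I \<tau> * m\<^sup>2)"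
      by (auto simp: power2_eq_square algebra_simps)
    also have "(LINT \<tau>|lborel. \<dots> \<tau>) = (LINT \<tau>|lborel. ?I \<tau> * (g \<tau>)\<^sup>2) - m\<^sup>2"
      using i1 i2 i3 m by (simp add: power2_eq_square)
    finally have "m\<^sup>2 \<le> (LINT \<tau>|lborel. ?I \<tau> * (g \<tau>)\<^sup>2)" by simp
    then show ?thesis
      unfolding m_def g_def using i2 unfolding g_def
      by (subst nn_integral_eq_integral) (auto simp: ennreal_leI)
  qed
  have "(\<integral>\<^sup>+x. ennreal ((f (x + h) - f x)\<^sup>2) \<partial>lborel)
      \<le> (\<integral>\<^sup>+x. (\<integral>\<^sup>+\<tau>. ennreal (?I \<tau> * (h \<bullet> grad f (x + \<tau> *\<^sub>R h))\<^sup>2) \<partial>lborel) \<partial>lborel)"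
    by (intro nn_integral_mono pt)
  also have "\<dots> = (\<integral>\<^sup>+\<tau>. (\<integral>\<^sup>+x. ennreal (?I \<tau> * (h \<bullet> grad f (x + \<tau> *\<^sub>R h))\<^sup>2) \<partial>lborel) \<partial>lborel)"
    by (rule lborel_pair.Fubini'[symmetric]) measurable
  also have "\<dots> = (\<integral>\<^sup>+\<tau>. (\<integral>\<^sup>+x. ennreal (?I \<tau> * (h \<bullet> grad f x)\<^sup>2) \<partial>lborel) \<partial>lborel)"
    by (intro nn_integral_cong nn_integral_translate) measurable
  also have "\<dots> \<le> (\<integral>\<^sup>+\<tau>. (\<integral>\<^sup>+x. ennreal (?I \<tau>) * ennreal ((norm h)\<^sup>2 * (norm (grad f x))\<^sup>2) \<partial>lborel) \<partial>lborel)"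
  proof (intro nn_integral_mono)
    fix \<tau> x
    have "(h \<bullet> grad f x)\<^sup>2 \<le> (norm h)\<^sup>2 * (norm (grad f x))\<^sup>2"
      using Cauchy_Schwarz_ineq[of h "grad f x"] by (simp add: power2_norm_eq_inner)
    then show "ennreal (?I \<tau> * (h \<bullet> grad f x)\<^sup>2)
        \<le> ennreal (?I \<tau>) * ennreal ((norm h)\<^sup>2 * (norm (grad f x))\<^sup>2)"
      by (auto simp: indicator_def ennreal_leI)
  qed
  also have "\<dots> = (\<integral>\<^sup>+x. ennreal ((norm h)\<^sup>2 * (norm (grad f x))\<^sup>2) \<partial>lborel)"
    by (simp add: nn_integral_cmult nn_integral_multc ennreal_indicator)
  also have "\<dots> = ennreal ((norm h)\<^sup>2 * (LINT x|lborel. (norm (grad f x))\<^sup>2))"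
    using integrable_grad_sq[OF f] by (subst nn_integral_eq_integral) auto
  finally have *: "(\<integral>\<^sup>+x. ennreal ((f (x + h) - f x)\<^sup>2) \<partial>lborel)
      \<le> ennreal ((norm h)\<^sup>2 * (LINT x|lborel. (norm (grad f x))\<^sup>2))" .
  have "(LINT x|lborel. (f (x + h) - f x)\<^sup>2) = enn2real (\<integral>\<^sup>+x. ennreal ((f (x + h) - f x)\<^sup>2) \<partial>lborel)"
    by (subst integral_eq_nn_integral) auto
  also have "\<dots> \<le> (norm h)\<^sup>2 * (LINT x|lborel. (norm (grad f x))\<^sup>2)"
    by (rule enn2real_leI[OF _ *]) (auto intro!: mult_nonneg_nonneg integral_nonneg_AE)
  finally show ?thesis .
qed

section \<open>The fundamental lemma and weak gradients\<close>

lemma set_borel_measurable_lborel_iff: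
  "set_borel_measurable lborel A f \<longleftrightarrow> (\<lambda>x. indicator A x *\<^sub>R f x) \<in> borel_measurable borel"
  by (simp add: set_borel_measurable_def)

text \<open>Cover U by countably many balls and take 1 - P, where P is the product over i < N of (1
  - bump)^N. Finitely many factors keep the support compact. The exponent N drives P to zero inside
  U, where some factor has base q < 1 and so P <= q^N eventually; off U every bump vanishes and P =
  1.\<close>

lemma open_exhaustion_by_test_functions:
  fixes U :: "'a::euclidean_space set"
  assumes "open U"
  obtains f where "\<And>N::nat. f N \<in> test_functions U" "\<And>N x. 0 \<le> f N x" "\<And>N x. f N x \<le> 1"
    "\<And>x. (\<lambda>N. f N x) \<longlonglongrightarrow> indicator U x"
proof (cases "U = {}")
  case True
  show ?thesis by (rule that[of "\<lambda>N x. 0"]) (simp_all add: True test_functions_zero)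
next
  case False
  define F where "F = {ball p r |p r. r > 0 \<and> cball p r \<subseteq> U}"
  have UF: "\<Union>F = U"
  proof
    show "U \<subseteq> \<Union>F"
    proof
      fix x assume "x \<in> U"
      with assms obtain r where "r > 0" "cball x r \<subseteq> U" using open_contains_cball by blast
      then have "ball x r \<in> F" "x \<in> ball x r" by (auto simp: F_def)
      then show "x \<in> \<Union>F" by blast
    qed
  qed (auto simp: F_def)
  have F: "\<exists>p r. B = ball p r \<and> r > 0 \<and> cball p r \<subseteq> U" if "B \<in> F" for B
    using that unfolding F_def by blast
  have "\<And>S. S \<in> F \<Longrightarrow> open S" using F open_ball by metis
  then obtain F' where F': "F' \<subseteq> F" "countable F'" "\<Union>F' = U"
    using Lindelof[of F] UF by metis
  have ne: "F' \<noteq> {}" using F'(3) False by blast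
  define B where "B = from_nat_into F'"
  have UB: "\<Union>(range B) = U"
    unfolding B_def range_from_nat_into[OF ne F'(2)] by (rule F'(3))
  have "B i \<in> F" for i unfolding B_def using from_nat_into[OF ne, of i] F'(1) by blast
  then have "\<forall>i. \<exists>p r. B i = ball p r \<and> r > 0 \<and> cball p r \<subseteq> U" using F by blast
  then obtain p r where pr: "\<And>i. B i = ball (p i) (r i)" "\<And>i. r i > 0" "\<And>i. cball (p i) (r i) \<subseteq> U"
    by metis
  have bump0: "bump (p i) (r i) x = 0" if "x \<notin> cball (p i) (r i)" for i x
    using that bump_eq_0_iff[OF pr(2)[of i], of "p i" x] by auto
  define P where "P N x = (\<Prod>i<N. (1 - bump (p i) (r i) x) ^ N)" for N x
  have P0: "0 \<le> P N x" and P1: "P N x \<le> 1" for N x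
    unfolding P_def
    by (auto intro!: prod_nonneg prod_le_1 power_le_one simp: bump_nonneg bump_le_1)
  show ?thesis
  proof (rule that[of "\<lambda>N x. 1 - P N x"])
    show "(\<lambda>x. 1 - P N x) \<in> test_functions U" for N
    proof (rule test_functionsI[of _ "\<Union>i<N. cball (p i) (r i)"])
      have "Ck k (\<lambda>x. (1 - bump (p i) (r i) x) ^ N)" for i k
      proof -
        have "Ck k (\<lambda>x. \<Prod>j<N. 1 - bump (p i) (r i) x)"
          by (intro Ck_prod Ck_diff Ck_const Ck_bump)
        then show ?thesis by simp
      qed
      then show "Ck k (\<lambda>x. 1 - P N x)" for k
        unfolding P_def by (intro Ck_diff Ck_const Ck_prod)
      show "x \<in> (\<Union>i<N. cball (p i) (r i))" if "1 - P N x \<noteq> 0" for x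
      proof (rule ccontr)
        assume "x \<notin> (\<Union>i<N. cball (p i) (r i))"
        then have "bump (p i) (r i) x = 0" if "i < N" for i
          using that by (intro bump0) blast
        then have "P N x = 1" by (simp add: P_def)
        with that show False by simp
      qed
      show "(\<Union>i<N. cball (p i) (r i)) \<subseteq> U" by (rule UN_least) (rule pr(3))
    qed (rule compact_UN, auto)
    show "(\<lambda>N. 1 - P N x) \<longlonglongrightarrow> indicator U x" for x
    proof (cases "x \<in> U")
      case False
      have "bump (p i) (r i) x = 0" for i
        using False pr(3)[of i] by (intro bump0) blast
      then show ?thesis using False by (simp add: P_def)
    next
      case True
      then obtain i where "x \<in> B i" unfolding UB[symmetric] by blast
      then have i: "x \<in> ball (p i) (r i)" by (simp only: pr(1))
      let ?q = "1 - bump (p i) (r i) x"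
      have q: "0 \<le> ?q" "?q < 1"
        using bump_le_1[of "p i" "r i" x] bump_nonneg[of "p i" "r i" x] bump_eq_0_iff[OF pr(2), of _ i x] i
        by (auto simp: less_le)
      have "P N x \<le> ?q ^ N" if "i < N" for N
      proof -
        have "P N x = ?q ^ N * (\<Prod>j\<in>{..<N} - {i}. (1 - bump (p j) (r j) x) ^ N)"
          unfolding P_def using that by (subst prod.remove[of _ i]) auto
        also have "\<dots> \<le> ?q ^ N * 1"
          using q by (intro mult_left_mono prod_le_1 zero_le_power)
            (auto intro!: power_le_one simp: bump_nonneg bump_le_1)
        finally show ?thesis by simp
      qed
      then have "\<forall>\<^sub>F N in sequentially. P N x \<le> ?q ^ N"
        by (auto simp: eventually_sequentially intro!: exI[of _ "Suc i"])
      then have "(\<lambda>N. P N x) \<longlonglongrightarrow> 0"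
        by (intro tendsto_sandwich[OF _ _ tendsto_const LIMSEQ_realpow_zero[OF q]]) (auto simp: P0)
      from tendsto_diff[OF tendsto_const[of 1] this] True show ?thesis by simp
    qed
  qed (auto simp: P0 P1)
qed

lemma L2_on_set_integrable:
  fixes G :: "'a::euclidean_space \<Rightarrow> 'b::euclidean_space"
  assumes G: "G \<in> L2_on A" and V: "V \<in> sets borel" "V \<subseteq> A" "bounded V"
  shows "integrable lborel (\<lambda>x. indicator V x *\<^sub>R G x)"
proof -
  have m: "(\<lambda>x. indicator A x *\<^sub>R G x) \<in> borel_measurable borel"
    and i: "integrable lborel (\<lambda>x. indicator A x * (norm (G x))\<^sup>2)"
    using G by (auto simp: L2_on_def set_borel_measurable_lborel_iff set_integrable_def)
  have eq: "(\<lambda>x. indicator V x *\<^sub>R indicator A x *\<^sub>R G x) = (\<lambda>x. indicator V x *\<^sub>R G x)"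
    using V by (auto simp: indicator_def fun_eq_iff)
  have "emeasure lborel V < \<infinity>" using V by (intro emeasure_bounded_finite)
  then have "integrable lborel (\<lambda>x. indicator V x :: real)"
    using V by (intro integrable_real_indicator) auto
  then have "integrable lborel (\<lambda>x. indicator V x + indicator A x * (norm (G x))\<^sup>2)"
    using i by (rule Bochner_Integration.integrable_add)
  then show ?thesis
  proof (rule Bochner_Integration.integrable_bound)
    have "(\<lambda>x. indicator V x *\<^sub>R indicator A x *\<^sub>R G x) \<in> borel_measurable borel"
      by (rule borel_measurable_scaleR[OF borel_measurable_indicator[OF V(1)] m])
    then show "(\<lambda>x. indicator V x *\<^sub>R G x) \<in> borel_measurable lborel" by (simp only: eq measurable_lborel2)
    have "norm (G x) \<le> 1 + (norm (G x))\<^sup>2" for x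
    proof -
      have "0 \<le> (norm (G x) - 1 / 2)\<^sup>2" by simp
      then show ?thesis by (simp add: power2_eq_square algebra_simps)
    qed
    then show "AE x in lborel. norm (indicator V x *\<^sub>R G x)
        \<le> norm (indicator V x + indicator A x * (norm (G x))\<^sup>2)"
      using V by (intro always_eventually allI) (auto simp: indicator_def)
  qed
qed

text \<open>Dominated convergence along the exhausting test functions extends the vanishing from
  test functions to bounded open subsets of A. Open sets are closed under intersection and generate
  the Borel sets, so Dynkin induction gives all Borel sets, and a density with vanishing integrals
  is zero almost everywhere. The truncation by balls is there because G is only square integrable on
  A, hence integrable only on bounded pieces.\<close>

lemma fundamental_lemma:
  fixes G :: "'a::euclidean_space \<Rightarrow> 'b::euclidean_space"
  assumes A: "open A" and G: "G \<in> L2_on A"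
    and zero: "\<And>f. f \<in> test_functions A \<Longrightarrow> (LINT x:A|lborel. f x *\<^sub>R G x) = 0"
  shows "AE x in lborel. x \<in> A \<longrightarrow> G x = 0"
proof -
  have open0: "(LINT x|lborel. indicator U x *\<^sub>R G x) = 0"
    if U: "open U" "U \<subseteq> A" "bounded U" for U
  proof -
    have iU: "integrable lborel (\<lambda>x. indicator U x *\<^sub>R G x)"
      by (rule L2_on_set_integrable[OF G]) (use U in auto)
    have idem: "indicator U x *\<^sub>R indicator U x *\<^sub>R G x = (indicator U x *\<^sub>R G x :: 'b)" for x
      by (cases "x \<in> U") simp_all
    obtain f where f: "\<And>N::nat. f N \<in> test_functions U" "\<And>N x. 0 \<le> f N x" "\<And>N x. f N x \<le> 1"
      "\<And>x. (\<lambda>N. f N x) \<longlonglongrightarrow> indicator U x"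
      using open_exhaustion_by_test_functions[OF U(1)] by blast
    have "(\<lambda>N. LINT x|lborel. f N x *\<^sub>R indicator U x *\<^sub>R G x)
        \<longlonglongrightarrow> (LINT x|lborel. indicator U x *\<^sub>R indicator U x *\<^sub>R G x)"
    proof (rule integral_dominated_convergence)
      show "integrable lborel (\<lambda>x. norm (indicator U x *\<^sub>R G x))"
        using iU by (rule integrable_norm)
      show "(\<lambda>x. f N x *\<^sub>R indicator U x *\<^sub>R G x) \<in> borel_measurable lborel" for N
        unfolding measurable_lborel2
        by (rule borel_measurable_scaleR[OF test_functions_measurable[OF f(1)]])
          (use borel_measurable_integrable[OF iU] in simp)
      show "(\<lambda>x. indicator U x *\<^sub>R indicator U x *\<^sub>R G x) \<in> borel_measurable lborel"
        unfolding idem by (rule borel_measurable_integrable[OF iU])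
      show "AE x in lborel. (\<lambda>N. f N x *\<^sub>R indicator U x *\<^sub>R G x)
          \<longlonglongrightarrow> indicator U x *\<^sub>R indicator U x *\<^sub>R G x"
        by (intro always_eventually allI tendsto_scaleR f tendsto_const)
      show "AE x in lborel. norm (f N x *\<^sub>R indicator U x *\<^sub>R G x) \<le> norm (indicator U x *\<^sub>R G x)" for N
        using f(2,3) by (intro always_eventually allI)
          (auto simp: mult.assoc intro!: mult_left_le_one_le)
    qed
    moreover have "(LINT x|lborel. f N x *\<^sub>R indicator U x *\<^sub>R G x) = 0" for N
    proof -
      have "(\<lambda>x. f N x *\<^sub>R indicator U x *\<^sub>R G x) = (\<lambda>x. indicator A x *\<^sub>R f N x *\<^sub>R G x)"
        using U(2) test_functions_eq_0[OF f(1)] by (auto simp: indicator_def fun_eq_iff)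
      then show ?thesis
        using zero[OF test_functions_mono[OF U(2) f(1)], of N] by (simp add: set_lebesgue_integral_def)
    qed
    ultimately have "(LINT x|lborel. indicator U x *\<^sub>R indicator U x *\<^sub>R G x) = 0"
      by (simp add: LIMSEQ_const_iff)
    then show ?thesis unfolding idem .
  qed
  have "AE x in lborel. indicator (A \<inter> ball 0 (real n)) x *\<^sub>R G x = 0" for n :: nat
  proof (rule sigma_finite_measure.density_zero[OF sigma_finite_lborel])
    let ?V = "A \<inter> ball 0 (real n)"
    let ?g = "\<lambda>x. indicator ?V x *\<^sub>R G x"
    show int: "integrable lborel ?g"
      by (rule L2_on_set_integrable[OF G]) (use A in \<open>auto intro: bounded_subset[OF bounded_ball]\<close>)
    have gen: "B \<in> sigma_sets UNIV {S. open S} \<longleftrightarrow> B \<in> sets borel" for B :: "'a set"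
      by (simp add: borel_def)
    have stable: "Int_stable {S :: 'a set. open S}" by (auto simp: Int_stable_def)
    fix B :: "'a set" assume "B \<in> sets lborel"
    then have "B \<in> sigma_sets UNIV {S. open S}" by (simp add: gen)
    then show "(LINT x:B|lborel. ?g x) = 0"
    proof (induction rule: sigma_sets_induct_disjoint[OF stable Pow_UNIV[THEN equalityD2, THEN subset_trans[OF subset_UNIV]], consumes 1,
        case_names basic empty compl union])
      case (basic S)
      have "(LINT x|lborel. indicator (S \<inter> ?V) x *\<^sub>R G x) = 0"
        by (rule open0) (use A basic in \<open>auto intro: bounded_subset[OF bounded_ball]\<close>)
      then show ?case by (simp add: set_lebesgue_integral_def indicator_inter_arith)
    next
      case (compl S)
      have S: "S \<in> sets lborel" using compl by (simp add: gen)
      have 1: "(LINT x|lborel. ?g x) = 0"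
        by (rule open0) (use A in \<open>auto intro: bounded_subset[OF bounded_ball]\<close>)
      have "(LINT x:UNIV - S|lborel. ?g x) = (LINT x|lborel. ?g x - indicator S x *\<^sub>R ?g x)"
        unfolding set_lebesgue_integral_def
        by (intro Bochner_Integration.integral_cong) (auto simp: indicator_def)
      also have "\<dots> = 0"
        using int integrable_mult_indicator[OF S int] 1 compl by (simp add: set_lebesgue_integral_def)
      finally show ?case .
    next
      case (union S)
      have S: "S i \<in> sets lborel" for i using union by (auto simp: gen[symmetric])
      have "(LINT x:(\<Union>i. S i)|lborel. ?g x) = (\<Sum>i. LINT x:S i|lborel. ?g x)"
      proof (rule lebesgue_integral_countable_add)
        show "i \<noteq> j \<Longrightarrow> S i \<inter> S j = {}" for i j
          using union by (auto simp: disjoint_family_on_def)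
        show "set_integrable lborel (\<Union>i. S i) ?g"
          unfolding set_integrable_def using S by (intro integrable_mult_indicator int) auto
      qed (use S in auto)
      then show ?case using union by simp
    qed (auto simp: set_lebesgue_integral_def)
  qed
  then have "AE x in lborel. \<forall>n::nat. indicator (A \<inter> ball 0 (real n)) x *\<^sub>R G x = 0"
    by (subst AE_all_countable) auto
  then show ?thesis
  proof (rule AE_mp, intro always_eventually allI impI)
    fix x assume *: "\<forall>n::nat. indicator (A \<inter> ball 0 (real n)) x *\<^sub>R G x = 0" and "x \<in> A"
    obtain n :: nat where "norm x < real n" using reals_Archimedean2 by blast
    with * \<open>x \<in> A\<close> show "G x = 0" by (auto dest: spec[of _ n])
  qed
qed

lemma test_functions_L2_on:
  assumes "f \<in> test_functions B" "A \<in> sets borel"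
  shows "f \<in> L2_on A" "grad f \<in> L2_on A"
proof -
  note [measurable] = test_functions_measurable[OF assms(1)] grad_measurable[OF assms(1)] assms(2)
  show "f \<in> L2_on A" "grad f \<in> L2_on A"
    using integrable_mult_indicator[of A lborel, OF _ integrable_test_function_sq[OF assms(1)]]
      integrable_mult_indicator[of A lborel, OF _ integrable_grad_sq[OF assms(1)]] assms(2)
    by (auto simp: L2_on_def set_borel_measurable_lborel_iff set_integrable_def)
qed

lemma indicator_test_function_scaleR:
  fixes G :: "'b::real_vector"
  shows "f \<in> test_functions A \<Longrightarrow> indicator A x *\<^sub>R f x *\<^sub>R G = f x *\<^sub>R G"
  using test_functions_eq_0[of f A x] by (cases "x \<in> A") auto

text \<open>Integration by parts: the gradient of the product u f has integral zero by
  \<open>integral_grad_eq_0\<close>.\<close>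

lemma has_weak_grad_test_function:
  assumes A: "open A" and u: "u \<in> test_functions A"
  shows "has_weak_grad A u (grad u)"
  unfolding has_weak_grad_def
proof (intro conjI ballI)
  show "u \<in> L2_on A" "grad u \<in> L2_on A" using test_functions_L2_on[OF u] A by auto
  fix f assume f: "f \<in> test_functions A"
  have prod: "(\<lambda>x. u x * f x) \<in> test_functions A"
    by (rule test_functions_mult[OF f]) (rule test_functions_Ck[OF u])
  have int: "integrable lborel (\<lambda>x. u x *\<^sub>R grad f x)" "integrable lborel (\<lambda>x. f x *\<^sub>R grad u x)"
    using integrable_test_function_times[OF u grad_continuous[OF f]]
      integrable_test_function_times[OF f grad_continuous[OF u]] by auto
  have "grad (\<lambda>x. u x * f x) x = u x *\<^sub>R grad f x + f x *\<^sub>R grad u x" for x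
    by (intro grad_eqI GDERIV_mult test_functions_GDERIV[OF u] test_functions_GDERIV[OF f])
  then have "(LINT x|lborel. u x *\<^sub>R grad f x + f x *\<^sub>R grad u x) = 0"
    using integral_grad_eq_0[OF prod] by simp
  then have "(LINT x|lborel. u x *\<^sub>R grad f x) = - (LINT x|lborel. f x *\<^sub>R grad u x)"
    using int by (simp add: add_eq_0_iff)
  moreover have "(LINT x:A|lborel. u x *\<^sub>R grad f x) = (LINT x|lborel. u x *\<^sub>R grad f x)"
    and "(LINT x:A|lborel. f x *\<^sub>R grad u x) = (LINT x|lborel. f x *\<^sub>R grad u x)"
    unfolding set_lebesgue_integral_def indicator_test_function_scaleR[OF u]
      indicator_test_function_scaleR[OF f] by (rule refl)+
  ultimately show "(LINT x:A|lborel. u x *\<^sub>R grad f x) = - (LINT x:A|lborel. f x *\<^sub>R grad u x)"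
    by simp
qed

section \<open>Square integrable functions\<close>

text \<open>Stated for an arbitrary measure and for vector values, so that one inner product
  calculus serves functions and gradient fields, both on a domain and on the whole space.\<close>

definition sq_int :: "'a measure \<Rightarrow> ('a \<Rightarrow> 'b::euclidean_space) \<Rightarrow> bool" where
  "sq_int M f \<longleftrightarrow> f \<in> borel_measurable M \<and> integrable M (\<lambda>x. (norm (f x))\<^sup>2)"

definition ip :: "'a measure \<Rightarrow> ('a \<Rightarrow> 'b::euclidean_space) \<Rightarrow> ('a \<Rightarrow> 'b) \<Rightarrow> real" where
  "ip M f g = (LINT x|M. f x \<bullet> g x)"

lemma mult_le_sum_squares: "\<bar>a * b\<bar> \<le> a\<^sup>2 + (b::real)\<^sup>2"
proof -
  have "2 * (\<bar>a\<bar> * \<bar>b\<bar>) \<le> a\<^sup>2 + b\<^sup>2"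
    using zero_le_power2[of "\<bar>a\<bar> - \<bar>b\<bar>"] by (simp add: power2_diff)
  moreover have "0 \<le> a\<^sup>2 + b\<^sup>2" by simp
  ultimately show ?thesis unfolding abs_mult by linarith
qed

lemma sq_int_inner:
  assumes "sq_int M f" "sq_int M g" shows "integrable M (\<lambda>x. f x \<bullet> g x)"
proof (rule Bochner_Integration.integrable_bound)
  show "integrable M (\<lambda>x. (norm (f x))\<^sup>2 + (norm (g x))\<^sup>2)" using assms by (simp add: sq_int_def)
  show "(\<lambda>x. f x \<bullet> g x) \<in> borel_measurable M" using assms by (auto simp: sq_int_def)
  show "AE x in M. norm (f x \<bullet> g x) \<le> norm ((norm (f x))\<^sup>2 + (norm (g x))\<^sup>2)"
  proof (intro always_eventually allI)
    fix x
    show "norm (f x \<bullet> g x) \<le> norm ((norm (f x))\<^sup>2 + (norm (g x))\<^sup>2)"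
      using Cauchy_Schwarz_ineq2[of "f x" "g x"] mult_le_sum_squares[of "norm (f x)" "norm (g x)"] by simp
  qed
qed

lemma sq_int_scaleR_integrable:
  fixes G :: "'a \<Rightarrow> 'b::euclidean_space"
  assumes "sq_int M f" "sq_int M G" shows "integrable M (\<lambda>x. f x *\<^sub>R G x)"
proof (rule Bochner_Integration.integrable_bound)
  show "integrable M (\<lambda>x. (norm (f x))\<^sup>2 + (norm (G x))\<^sup>2)" using assms by (simp add: sq_int_def)
  show "(\<lambda>x. f x *\<^sub>R G x) \<in> borel_measurable M" using assms by (auto simp: sq_int_def)
  show "AE x in M. norm (f x *\<^sub>R G x) \<le> norm ((norm (f x))\<^sup>2 + (norm (G x))\<^sup>2)"
  proof (intro always_eventually allI)
    fix x
    show "norm (f x *\<^sub>R G x) \<le> norm ((norm (f x))\<^sup>2 + (norm (G x))\<^sup>2)"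
      using mult_le_sum_squares[of "norm (f x)" "norm (G x)"] by simp
  qed
qed

lemma sq_int_add:
  assumes "sq_int M f" "sq_int M g" shows "sq_int M (\<lambda>x. f x + g x)"
proof -
  have "(norm (f x + g x))\<^sup>2 = (norm (f x))\<^sup>2 + 2 * (f x \<bullet> g x) + (norm (g x))\<^sup>2" for x
    by (simp add: power2_norm_eq_inner inner_add inner_commute)
  then show ?thesis
    using assms sq_int_inner[OF assms] by (auto simp: sq_int_def)
qed

lemma sq_int_scaleR: "sq_int M f \<Longrightarrow> sq_int M (\<lambda>x. c *\<^sub>R f x)"
  by (auto simp: sq_int_def power_mult_distrib)

lemma sq_int_cmult: "sq_int M f \<Longrightarrow> sq_int M (\<lambda>x. c * f x)" for f :: "'a \<Rightarrow> real"
  using sq_int_scaleR[of M f c] by simp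

lemma sq_int_diff:
  assumes "sq_int M f" "sq_int M g" shows "sq_int M (\<lambda>x. f x - g x)"
  using sq_int_add[OF assms(1) sq_int_scaleR[OF assms(2), of "-1"]] by simp

lemma sq_int_zero: "sq_int M (\<lambda>x. 0)"
  by (simp add: sq_int_def)

lemma sq_int_sum: "(\<And>i. i \<in> I \<Longrightarrow> sq_int M (f i)) \<Longrightarrow> sq_int M (\<lambda>x. \<Sum>i\<in>I. f i x)"
  by (induction I rule: infinite_finite_induct) (auto intro: sq_int_add sq_int_zero)

lemma ip_commute: "ip M f g = ip M g f"
  by (simp add: ip_def inner_commute)

lemma ip_nonneg: "0 \<le> ip M f f"
  unfolding ip_def by (intro integral_nonneg_AE) simp

lemma ip_self: "ip M f f = (LINT x|M. (norm (f x))\<^sup>2)"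
  by (simp add: ip_def power2_norm_eq_inner)

lemma ip_add_left:
  "sq_int M f \<Longrightarrow> sq_int M g \<Longrightarrow> sq_int M h \<Longrightarrow> ip M (\<lambda>x. f x + g x) h = ip M f h + ip M g h"
  by (simp add: ip_def inner_add_left sq_int_inner)

lemma ip_diff_left:
  "sq_int M f \<Longrightarrow> sq_int M g \<Longrightarrow> sq_int M h \<Longrightarrow> ip M (\<lambda>x. f x - g x) h = ip M f h - ip M g h"
  by (simp add: ip_def inner_diff_left sq_int_inner)

lemma ip_scaleR_left: "ip M (\<lambda>x. c *\<^sub>R f x) h = c * ip M f h"
  by (simp add: ip_def)

lemma ip_sum_left:
  "(\<And>i. i \<in> I \<Longrightarrow> sq_int M (f i)) \<Longrightarrow> sq_int M h \<Longrightarrow>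
    ip M (\<lambda>x. \<Sum>i\<in>I. f i x) h = (\<Sum>i\<in>I. ip M (f i) h)"
proof (induction I rule: infinite_finite_induct)
  case (insert i I)
  then show ?case by (simp add: ip_add_left sq_int_sum)
qed (auto simp: ip_def)

lemma ip_diff_scaleR_self:
  assumes "sq_int M f" "sq_int M g"
  shows "ip M (\<lambda>x. f x - c *\<^sub>R g x) (\<lambda>x. f x - c *\<^sub>R g x) = ip M f f - 2 * c * ip M f g + c\<^sup>2 * ip M g g"
proof -
  let ?r = "\<lambda>x. f x - c *\<^sub>R g x"
  have cg: "sq_int M (\<lambda>x. c *\<^sub>R g x)" by (rule sq_int_scaleR[OF assms(2)])
  have left: "ip M ?r h = ip M f h - c * ip M g h" if "sq_int M h" for h
    unfolding ip_diff_left[OF assms(1) cg that] ip_scaleR_left ..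
  have "ip M ?r ?r = ip M ?r f - c * ip M ?r g"
    unfolding left[OF sq_int_diff[OF assms(1) cg]] ip_commute[of M f ?r] ip_commute[of M g ?r] ..
  also have "\<dots> = ip M f f - 2 * c * ip M f g + c\<^sup>2 * ip M g g"
    unfolding left[OF assms(1)] left[OF assms(2)] ip_commute[of M g f]
    by (simp add: power2_eq_square algebra_simps)
  finally show ?thesis .
qed

lemma ip_Cauchy_Schwarz:
  assumes "sq_int M f" "sq_int M g"
  shows "(ip M f g)\<^sup>2 \<le> ip M f f * ip M g g"
proof -
  have *: "0 \<le> ip M f f - 2 * c * ip M f g + c\<^sup>2 * ip M g g" for c
    using ip_nonneg[of M "\<lambda>x. f x - c *\<^sub>R g x"] unfolding ip_diff_scaleR_self[OF assms] .
  show ?thesis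
  proof (cases "ip M g g = 0")
    case True
    have "ip M f g = 0"
    proof (rule ccontr)
      assume "ip M f g \<noteq> 0"
      with *[of "(ip M f f + 1) / (2 * ip M f g)"] True show False by (simp add: field_simps)
    qed
    then show ?thesis using True by simp
  next
    case False
    then have "ip M g g > 0" using ip_nonneg[of M g] by simp
    with *[of "ip M f g / ip M g g"] show ?thesis
      by (simp add: field_simps power2_eq_square)
  qed
qed

text \<open>The squared norms m j are left general because the lemma is applied to two families: the
  eigenfunctions, with norm 1, and their gradients, with squared norm \<open>\<mu> j\<close>. It
  yields Bessel's inequality for both.\<close>

lemma ip_diff_sum_orthogonal:
  assumes f: "sq_int M f" and g: "\<And>j::nat. sq_int M (g j)"
    and orth: "\<And>i j. ip M (g i) (g j) = (if i = j then m i else 0)"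
  shows "ip M (\<lambda>x. f x - (\<Sum>j<N. c j *\<^sub>R g j x)) (\<lambda>x. f x - (\<Sum>j<N. c j *\<^sub>R g j x))
    = ip M f f - 2 * (\<Sum>j<N. c j * ip M f (g j)) + (\<Sum>j<N. (c j)\<^sup>2 * m j)"
proof (induction N)
  case 0
  then show ?case by simp
next
  case (Suc N)
  let ?r = "\<lambda>x. f x - (\<Sum>j<N. c j *\<^sub>R g j x)"
  have s: "sq_int M (\<lambda>x. \<Sum>j<N. c j *\<^sub>R g j x)" by (intro sq_int_sum sq_int_scaleR g)
  have r: "sq_int M ?r" by (intro sq_int_diff f s)
  have "ip M (\<lambda>x. \<Sum>j<N. c j *\<^sub>R g j x) (g N) = (\<Sum>j<N. c j * ip M (g j) (g N))"
    by (subst ip_sum_left) (auto intro: sq_int_scaleR g simp: ip_scaleR_left)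
  also have "\<dots> = 0" by (intro sum.neutral) (auto simp: orth)
  finally have rg: "ip M ?r (g N) = ip M f (g N)" by (simp add: ip_diff_left f s g)
  have "(\<lambda>x. f x - (\<Sum>j<Suc N. c j *\<^sub>R g j x)) = (\<lambda>x. ?r x - c N *\<^sub>R g N x)" by (simp add: fun_eq_iff)
  then show ?case
    using ip_diff_scaleR_self[OF r g, of "c N" N] Suc rg by (simp add: orth)
qed

section \<open>Mean-square convergence\<close>

definition L2_lim :: "'a measure \<Rightarrow> (nat \<Rightarrow> 'a \<Rightarrow> 'b::euclidean_space) \<Rightarrow> ('a \<Rightarrow> 'b) \<Rightarrow> bool" where
  "L2_lim M F f \<longleftrightarrow> (\<forall>k. sq_int M (F k)) \<and> sq_int M f \<and>
     (\<lambda>k. ip M (\<lambda>x. F k x - f x) (\<lambda>x. F k x - f x)) \<longlonglongrightarrow> 0"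

lemma L2_lim_const: "sq_int M f \<Longrightarrow> L2_lim M (\<lambda>k. f) f"
  by (simp add: L2_lim_def ip_def)

lemma inner_add_self_le: "(x + y) \<bullet> (x + y) \<le> 2 * (x \<bullet> x) + 2 * (y \<bullet> y)"
  using inner_ge_zero[of "x - y"]
  by (simp add: inner_add_left inner_add_right inner_diff_left inner_diff_right inner_commute[of y x])

lemma L2_lim_add:
  assumes "L2_lim M F f" "L2_lim M G g"
  shows "L2_lim M (\<lambda>k x. F k x + G k x) (\<lambda>x. f x + g x)"
proof -
  let ?a = "\<lambda>k x. F k x - f x" and ?b = "\<lambda>k x. G k x - g x"
  have sq: "sq_int M (F k)" "sq_int M (G k)" "sq_int M f" "sq_int M g" for k
    using assms by (auto simp: L2_lim_def)
  have sq2: "sq_int M (?a k)" "sq_int M (?b k)" for k by (intro sq_int_diff sq)+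
  have eq: "(\<lambda>x. F k x + G k x - (f x + g x)) = (\<lambda>x. ?a k x + ?b k x)" for k by (simp add: fun_eq_iff)
  define I where "I k = ip M (?a k) (?a k)" for k
  define J where "J k = ip M (?b k) (?b k)" for k
  define K where "K k = ip M (\<lambda>x. ?a k x + ?b k x) (\<lambda>x. ?a k x + ?b k x)" for k
  have K0: "0 \<le> K k" for k unfolding K_def by (rule ip_nonneg)
  have le: "K k \<le> 2 * I k + 2 * J k" for k
  proof -
    have i: "integrable M (\<lambda>x. 2 * (?a k x \<bullet> ?a k x))" "integrable M (\<lambda>x. 2 * (?b k x \<bullet> ?b k x))"
      by (rule integrable_mult_right, rule sq_int_inner, rule sq2, rule sq2)+
    have "K k \<le> (LINT x|M. 2 * (?a k x \<bullet> ?a k x) + 2 * (?b k x \<bullet> ?b k x))"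
      unfolding K_def ip_def
      by (rule Bochner_Integration.integral_mono, rule sq_int_inner; (rule sq_int_add[OF sq2])?)
        (rule Bochner_Integration.integrable_add[OF i], rule inner_add_self_le)
    also have "\<dots> = 2 * I k + 2 * J k"
      unfolding Bochner_Integration.integral_add[OF i] I_def J_def ip_def by simp
    finally show ?thesis .
  qed
  have "I \<longlonglongrightarrow> 0" "J \<longlonglongrightarrow> 0"
    using assms unfolding L2_lim_def I_def J_def by blast+
  then have "(\<lambda>k. 2 * I k + 2 * J k) \<longlonglongrightarrow> 2 * 0 + 2 * 0" by (intro tendsto_intros)
  then have lim: "(\<lambda>k. 2 * I k + 2 * J k) \<longlonglongrightarrow> 0" by simp
  have "K \<longlonglongrightarrow> 0"
    by (rule tendsto_sandwich[OF _ _ tendsto_const lim]) (simp_all add: le K0)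
  then have "(\<lambda>k. ip M (\<lambda>x. ?a k x + ?b k x) (\<lambda>x. ?a k x + ?b k x)) \<longlonglongrightarrow> 0"
    unfolding K_def .
  then show ?thesis unfolding L2_lim_def eq by (intro conjI allI sq_int_add sq)
qed

lemma L2_lim_scaleR:
  assumes "L2_lim M F f" shows "L2_lim M (\<lambda>k x. c *\<^sub>R F k x) (\<lambda>x. c *\<^sub>R f x)"
proof -
  have "ip M (\<lambda>x. c *\<^sub>R F k x - c *\<^sub>R f x) (\<lambda>x. c *\<^sub>R F k x - c *\<^sub>R f x)
      = c\<^sup>2 * ip M (\<lambda>x. F k x - f x) (\<lambda>x. F k x - f x)" for k
    by (simp add: ip_def scaleR_diff_right[symmetric] power2_eq_square mult.assoc)
  then show ?thesis
    using assms unfolding L2_lim_def by (auto intro: sq_int_scaleR tendsto_mult_right_zero)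
qed

lemma L2_lim_sum:
  "(\<And>i. i \<in> I \<Longrightarrow> L2_lim M (F i) (f i)) \<Longrightarrow> L2_lim M (\<lambda>k x. \<Sum>i\<in>I. F i k x) (\<lambda>x. \<Sum>i\<in>I. f i x)"
  by (induction I rule: infinite_finite_induct) (auto intro: L2_lim_add L2_lim_const sq_int_zero)

lemma L2_lim_ip_self:
  assumes "L2_lim M F f" shows "(\<lambda>k. ip M (F k) (F k)) \<longlonglongrightarrow> ip M f f"
proof -
  let ?d = "\<lambda>k x. F k x - f x"
  have sq: "sq_int M (F k)" "sq_int M f" for k using assms by (auto simp: L2_lim_def)
  have d: "sq_int M (?d k)" for k by (intro sq_int_diff sq)
  have eq: "ip M (F k) (F k) = ip M (?d k) (?d k) + 2 * ip M (?d k) f + ip M f f" for k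
    using ip_diff_scaleR_self[OF d sq(2), of k "-1"] by simp
  have lim: "(\<lambda>k. ip M (?d k) (?d k)) \<longlonglongrightarrow> 0" using assms by (simp add: L2_lim_def)
  have "(\<lambda>k. (ip M (?d k) f)\<^sup>2) \<longlonglongrightarrow> 0"
  proof (rule tendsto_sandwich[OF _ _ tendsto_const])
    show "\<forall>\<^sub>F k in sequentially. (ip M (?d k) f)\<^sup>2 \<le> ip M (?d k) (?d k) * ip M f f"
      by (intro always_eventually allI ip_Cauchy_Schwarz d sq)
    show "(\<lambda>k. ip M (?d k) (?d k) * ip M f f) \<longlonglongrightarrow> 0" using lim by (rule tendsto_mult_left_zero)
  qed simp
  then have "(\<lambda>k. ip M (?d k) f) \<longlonglongrightarrow> 0" by simp
  from tendsto_add[OF tendsto_add[OF lim tendsto_mult_right_zero[OF this]] tendsto_const, of 2 "ip M f f"]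
  show ?thesis unfolding eq by simp
qed

text \<open>The K-functional of a single mode: the right-hand side is smallest at b = a / (1 + m),
  which is where the square (a - (1 + m) b)^2 vanishes.\<close>

lemma penalised_square_ge: "m / (1 + m) * a\<^sup>2 \<le> (a - b)\<^sup>2 + m * b\<^sup>2" if "m \<ge> 0" for m a b :: real
proof -
  have "0 \<le> (a - (1 + m) * b)\<^sup>2" by simp
  then have "m * a\<^sup>2 \<le> (1 + m) * ((a - b)\<^sup>2 + m * b\<^sup>2)"
    by (simp add: power2_eq_square algebra_simps)
  with that show ?thesis by (simp add: pos_divide_le_eq mult.commute)
qed

text \<open>\<open>D j\<close> stands for the gradient of \<open>\<phi> j\<close>. The relation
  \<open>orth_D\<close> is what remains of the weak eigenvalue equation when it is tested with
  eigenfunctions; no differential structure enters the spectral computations.\<close>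

locale eigensystem =
  fixes M :: "'a measure" and \<mu> :: "nat \<Rightarrow> real" and \<phi> :: "nat \<Rightarrow> 'a \<Rightarrow> real"
    and D :: "nat \<Rightarrow> 'a \<Rightarrow> 'b::euclidean_space"
  assumes sq_phi: "\<And>j. sq_int M (\<phi> j)" and sq_D: "\<And>j. sq_int M (D j)"
    and orth_phi: "\<And>i j. ip M (\<phi> i) (\<phi> j) = (if i = j then 1 else 0)"
    and orth_D: "\<And>i j. ip M (D i) (D j) = (if i = j then \<mu> i else 0)"
begin

lemma eigenvalue_nonneg: "0 \<le> \<mu> j"
  using ip_nonneg[of M "D j"] by (simp add: orth_D)

text \<open>Bessel's inequality bounds the two terms of the energy from below by sums over modes,
  and \<open>penalised_square_ge\<close> minimises each mode separately. The hypothesis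
  \<open>Ww\<close> is the eigenvalue equation tested with w; it identifies the coefficients of W,
  the gradient of w, along the \<open>D j\<close>.\<close>

lemma energy_lower_bound:
  assumes u: "sq_int M u" and w: "sq_int M w" and W: "sq_int M W" and t: "t > 0"
    and Ww: "\<And>j. ip M W (D j) = \<mu> j * ip M w (\<phi> j)"
  shows "(\<Sum>j<N. t * \<mu> j / (1 + t * \<mu> j) * (ip M u (\<phi> j))\<^sup>2)
    \<le> ip M (\<lambda>x. u x - w x) (\<lambda>x. u x - w x) + t * ip M W W"
proof -
  define a where "a j = ip M u (\<phi> j)" for j
  define b where "b j = ip M w (\<phi> j)" for j
  have ab: "ip M (\<lambda>x. u x - w x) (\<phi> j) = a j - b j" for j
    by (simp add: a_def b_def ip_diff_left u w sq_phi)
  let ?r = "\<lambda>x. (u x - w x) - (\<Sum>j<N. (a j - b j) *\<^sub>R \<phi> j x)"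
  have "0 \<le> ip M ?r ?r" by (rule ip_nonneg)
  then have 1: "(\<Sum>j<N. (a j - b j)\<^sup>2) \<le> ip M (\<lambda>x. u x - w x) (\<lambda>x. u x - w x)"
    by (subst (asm) ip_diff_sum_orthogonal[OF sq_int_diff[OF u w] sq_phi orth_phi])
      (simp add: ab power2_eq_square)
  let ?R = "\<lambda>x. W x - (\<Sum>j<N. b j *\<^sub>R D j x)"
  have "0 \<le> ip M ?R ?R" by (rule ip_nonneg)
  then have "(\<Sum>j<N. \<mu> j * (b j)\<^sup>2) \<le> ip M W W"
    by (subst (asm) ip_diff_sum_orthogonal[OF W sq_D orth_D])
      (simp add: Ww b_def[symmetric] power2_eq_square algebra_simps)
  then have 2: "t * (\<Sum>j<N. \<mu> j * (b j)\<^sup>2) \<le> t * ip M W W" using t by simp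
  have "(\<Sum>j<N. t * \<mu> j / (1 + t * \<mu> j) * (a j)\<^sup>2) \<le> (\<Sum>j<N. (a j - b j)\<^sup>2 + t * \<mu> j * (b j)\<^sup>2)"
    using t eigenvalue_nonneg by (intro sum_mono penalised_square_ge) simp
  also have "\<dots> = (\<Sum>j<N. (a j - b j)\<^sup>2) + t * (\<Sum>j<N. \<mu> j * (b j)\<^sup>2)"
    by (simp add: sum.distrib sum_distrib_left mult.assoc)
  finally show ?thesis using 1 2 by (simp add: a_def)
qed

text \<open>The coefficients \<open>u\<^sub>j / (1 + t \<mu>\<^sub>j)\<close> are those of the minimiser of
  \<open>w \<mapsto> \<parallel>u - w\<parallel>\<^sup>2 + t \<parallel>\<nabla>w\<parallel>\<^sup>2\<close>.\<close>

lemma energy_upper_bound: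
  assumes u: "sq_int M u" and t: "t > 0" and e: "e > 0"
    and complete: "(\<lambda>N. ip M (\<lambda>x. u x - (\<Sum>j<N. ip M u (\<phi> j) *\<^sub>R \<phi> j x))
      (\<lambda>x. u x - (\<Sum>j<N. ip M u (\<phi> j) *\<^sub>R \<phi> j x))) \<longlonglongrightarrow> 0"
    and F: "\<And>j. L2_lim M (F j) (\<phi> j)" and G: "\<And>j. L2_lim M (G j) (D j)"
  obtains N k c where
    "ip M (\<lambda>x. u x - (\<Sum>j<N. c j *\<^sub>R F j k x)) (\<lambda>x. u x - (\<Sum>j<N. c j *\<^sub>R F j k x))
      + t * ip M (\<lambda>x. \<Sum>j<N. c j *\<^sub>R G j k x) (\<lambda>x. \<Sum>j<N. c j *\<^sub>R G j k x)
    \<le> (\<Sum>j<N. t * \<mu> j / (1 + t * \<mu> j) * (ip M u (\<phi> j))\<^sup>2) + e"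
proof -
  define a where "a j = ip M u (\<phi> j)" for j
  define c where "c j = a j / (1 + t * \<mu> j)" for j
  have pos: "1 + t * \<mu> j > 0" for j using t eigenvalue_nonneg[of j] by (simp add: add_pos_nonneg)
  let ?r = "\<lambda>N x. u x - (\<Sum>j<N. a j *\<^sub>R \<phi> j x)"
  \<comment> \<open>The truncation N is fixed first, spending e / 2. Only finitely many
    eigenfunctions are then left to approximate, and one index k serves them all within the
    remaining e / 2.\<close>
  obtain N where N: "ip M (?r N) (?r N) < e / 2"
    using order_tendstoD(2)[OF complete, of "e / 2"] e unfolding a_def eventually_sequentially by auto
  let ?w = "\<lambda>x. \<Sum>j<N. c j *\<^sub>R \<phi> j x" and ?W = "\<lambda>x. \<Sum>j<N. c j *\<^sub>R D j x"
  let ?S = "\<Sum>j<N. t * \<mu> j / (1 + t * \<mu> j) * (a j)\<^sup>2"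
  have 1: "ip M (\<lambda>x. u x - ?w x) (\<lambda>x. u x - ?w x) = ip M (?r N) (?r N) + (\<Sum>j<N. (a j - c j)\<^sup>2)"
    unfolding ip_diff_sum_orthogonal[OF u sq_phi orth_phi] a_def[symmetric]
    by (simp add: power2_diff sum.distrib sum_subtractf power2_eq_square[of "a _"] sum_distrib_left
        algebra_simps)
  have 2: "ip M ?W ?W = (\<Sum>j<N. (c j)\<^sup>2 * \<mu> j)"
    using ip_diff_sum_orthogonal[OF sq_int_zero sq_D orth_D, of c N] by (simp add: ip_def)
  have "(a j - c j)\<^sup>2 + t * ((c j)\<^sup>2 * \<mu> j) = t * \<mu> j / (1 + t * \<mu> j) * (a j)\<^sup>2" for j
  proof -
    define m where "m = t * \<mu> j"
    have m: "1 + m > 0" using pos[of j] by (simp add: m_def)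
    have "a j = (1 + m) * c j" using m by (simp add: c_def m_def)
    then have "(a j - c j)\<^sup>2 + m * (c j)\<^sup>2 = m * (1 + m) * (c j)\<^sup>2"
      by (simp add: power2_eq_square algebra_simps)
    also have "\<dots> = m / (1 + m) * ((1 + m) * c j)\<^sup>2"
      using m by (simp add: power2_eq_square)
    finally show ?thesis using \<open>a j = (1 + m) * c j\<close> by (simp add: m_def mult_ac)
  qed
  then have 3: "(\<Sum>j<N. (a j - c j)\<^sup>2) + t * (\<Sum>j<N. (c j)\<^sup>2 * \<mu> j) = ?S"
    by (simp add: sum_distrib_left sum.distrib[symmetric])
  let ?wk = "\<lambda>k x. \<Sum>j<N. c j *\<^sub>R F j k x" and ?Wk = "\<lambda>k x. \<Sum>j<N. c j *\<^sub>R G j k x"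
  have "L2_lim M ?wk ?w" "L2_lim M ?Wk ?W" by (intro L2_lim_sum L2_lim_scaleR F G)+
  from L2_lim_add[OF L2_lim_const[OF u] L2_lim_scaleR[OF this(1), of "-1"]] this(2)
  have "L2_lim M (\<lambda>k x. u x - ?wk k x) (\<lambda>x. u x - ?w x)" "L2_lim M ?Wk ?W" by simp_all
  from tendsto_add[OF this(1)[THEN L2_lim_ip_self] tendsto_mult_left[OF this(2)[THEN L2_lim_ip_self], of t]]
  have "\<forall>\<^sub>F k in sequentially. ip M (\<lambda>x. u x - ?wk k x) (\<lambda>x. u x - ?wk k x) + t * ip M (?Wk k) (?Wk k) < ?S + e"
  proof (rule order_tendstoD(2))
    show "ip M (\<lambda>x. u x - ?w x) (\<lambda>x. u x - ?w x) + t * ip M ?W ?W < ?S + e"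
      unfolding 1 2 using 3 N e by linarith
  qed
  then obtain k where "ip M (\<lambda>x. u x - ?wk k x) (\<lambda>x. u x - ?wk k x) + t * ip M (?Wk k) (?Wk k) < ?S + e"
    unfolding eventually_sequentially by blast
  then show ?thesis by (intro that[of c k N]) (simp add: a_def)
qed

end

section \<open>The K-functional of the Dirichlet form\<close>

lemma L2_on_iff_sq_int:
  assumes "A \<in> sets borel"
  shows "f \<in> L2_on A \<longleftrightarrow> sq_int (restrict_space lborel A) f"
proof -
  have A: "A \<inter> space lborel \<in> sets lborel" using assms by simp
  show ?thesis
    unfolding L2_on_def sq_int_def set_integrable_def set_borel_measurable_def
      borel_measurable_restrict_space_iff[OF A] integrable_restrict_space[OF A] by simp
qed

lemma set_lebesgue_integral_restrict_space:
  fixes f :: "'a::euclidean_space \<Rightarrow> 'b::{banach, second_countable_topology}"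
  assumes "A \<in> sets borel"
  shows "(LINT x:A|lborel. f x) = (LINT x|restrict_space lborel A. f x)"
  unfolding set_lebesgue_integral_def
  by (rule integral_restrict_space[symmetric]) (use assms in simp)

lemma L2_inner_eq_ip: "A \<in> sets borel \<Longrightarrow> L2_inner A u v = ip (restrict_space lborel A) u v"
  by (simp add: L2_inner_def ip_def set_lebesgue_integral_restrict_space)

lemma dirichlet_form_eq_ip:
  "A \<in> sets borel \<Longrightarrow> dirichlet_form A u v = ip (restrict_space lborel A) (weak_grad A u) (weak_grad A v)"
  by (simp add: dirichlet_form_def ip_def set_lebesgue_integral_restrict_space)

lemma AE_restrict_lborel:
  "A \<in> sets borel \<Longrightarrow> (AE x in restrict_space lborel A. P x) \<longleftrightarrow> (AE x in lborel. x \<in> A \<longrightarrow> P x)"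
  by (subst AE_restrict_space_iff) auto

lemma weak_grad_unique:
  assumes A: "open A" and G: "has_weak_grad A u G" and H: "has_weak_grad A u H"
  shows "AE x in restrict_space lborel A. G x = H x"
proof -
  let ?M = "restrict_space lborel A"
  have A': "A \<in> sets borel" using A by simp
  have sq: "sq_int ?M G" "sq_int ?M H"
    using G H by (auto simp: has_weak_grad_def L2_on_iff_sq_int[OF A'])
  have "AE x in lborel. x \<in> A \<longrightarrow> G x - H x = 0"
  proof (rule fundamental_lemma[OF A])
    show "(\<lambda>x. G x - H x) \<in> L2_on A"
      unfolding L2_on_iff_sq_int[OF A'] by (rule sq_int_diff[OF sq])
    fix f assume f: "f \<in> test_functions A"
    have sqf: "sq_int ?M f"
      using test_functions_L2_on(1)[OF f A'] by (simp add: L2_on_iff_sq_int[OF A'])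
    have "(LINT x:A|lborel. f x *\<^sub>R G x) = (LINT x:A|lborel. f x *\<^sub>R H x)"
      using G H f unfolding has_weak_grad_def by (metis neg_equal_iff_equal)
    then show "(LINT x:A|lborel. f x *\<^sub>R (G x - H x)) = 0"
      unfolding set_lebesgue_integral_restrict_space[OF A'] scaleR_diff_right
      by (subst Bochner_Integration.integral_diff) (auto intro: sq_int_scaleR_integrable sqf sq)
  qed
  then show ?thesis by (simp add: AE_restrict_lborel[OF A'])
qed

lemma has_weak_grad_weak_grad: "u \<in> H1_0 A \<Longrightarrow> has_weak_grad A u (weak_grad A u)"
  unfolding weak_grad_def by (rule someI_ex[of "has_weak_grad A u"]) (unfold H1_0_def, blast)

text \<open>\<open>weak_grad\<close> is a choice among weak gradients; uniqueness almost everywhere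
  ties the chosen one to the classical gradient.\<close>

lemma weak_grad_test_function:
  assumes A: "open A" and w: "w \<in> test_functions A"
  shows "AE x in restrict_space lborel A. weak_grad A w x = grad w x"
proof (rule weak_grad_unique[OF A _ has_weak_grad_test_function[OF A w]])
  show "has_weak_grad A w (weak_grad A w)"
    unfolding weak_grad_def by (rule someI[of "has_weak_grad A w", OF has_weak_grad_test_function[OF A w]])
qed

lemma test_function_in_H1_0:
  assumes A: "open A" and w: "w \<in> test_functions A"
  shows "w \<in> H1_0 A"
proof -
  have A': "A \<in> sets borel" using A by simp
  have "(LINT x:A|lborel. (w x - w x)\<^sup>2 + (norm (grad w x - weak_grad A w x))\<^sup>2) = 0"
    unfolding set_lebesgue_integral_restrict_space[OF A']
    by (rule integral_eq_zero_AE) (use weak_grad_test_function[OF A w] in eventually_elim, simp)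
  then show ?thesis
    unfolding H1_0_def using has_weak_grad_test_function[OF A w] w
    by (auto intro!: exI[of _ "\<lambda>k. w"])
qed

lemma integral_grad_sq_restrict:
  assumes A: "open A" and w: "w \<in> test_functions A"
  shows "(LINT x|restrict_space lborel A. (norm (grad w x))\<^sup>2) = (LINT x|lborel. (norm (grad w x))\<^sup>2)"
proof -
  have A': "A \<in> sets borel" using A by simp
  have "indicator A x *\<^sub>R (norm (grad w x))\<^sup>2 = (norm (grad w x))\<^sup>2" for x
    using in_supp_grad[OF w, of x] test_functions_support(2)[OF w] by (cases "x \<in> A") auto
  then show ?thesis
    unfolding set_lebesgue_integral_restrict_space[OF A', symmetric] set_lebesgue_integral_def by (simp only:)
qed

lemma GDERIV_cmult: "GDERIV f x :> D \<Longrightarrow> GDERIV (\<lambda>x. c * f x) x :> c *\<^sub>R D"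
  using GDERIV_mult[OF GDERIV_const, of f x D c] by simp

lemma GDERIV_sum:
  "(\<And>i. i \<in> I \<Longrightarrow> GDERIV (f i) x :> D i) \<Longrightarrow> GDERIV (\<lambda>x. \<Sum>i\<in>I. f i x) x :> (\<Sum>i\<in>I. D i)"
proof (induction I rule: infinite_finite_induct)
  case (insert i I)
  then show ?case using GDERIV_add[of "f i" x "D i" "\<lambda>x. \<Sum>i\<in>I. f i x"] by simp
qed (simp_all add: GDERIV_const)

lemma H1_0_L2_lim:
  assumes A: "open A" and u: "u \<in> H1_0 A"
  obtains f where "\<And>k::nat. f k \<in> test_functions A" "L2_lim (restrict_space lborel A) f u"
    "L2_lim (restrict_space lborel A) (\<lambda>k. grad (f k)) (weak_grad A u)"
proof -
  let ?M = "restrict_space lborel A"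
  have A': "A \<in> sets borel" using A by simp
  obtain f where f: "\<And>k::nat. f k \<in> test_functions A"
    and lim: "(\<lambda>k. LINT x:A|lborel. (f k x - u x)\<^sup>2 + (norm (grad (f k) x - weak_grad A u x))\<^sup>2) \<longlonglongrightarrow> 0"
    using u unfolding H1_0_def by auto
  have squ: "sq_int ?M u" "sq_int ?M (weak_grad A u)"
    using has_weak_grad_weak_grad[OF u] by (auto simp: has_weak_grad_def L2_on_iff_sq_int[OF A'])
  have sqf: "sq_int ?M (f k)" "sq_int ?M (grad (f k))" for k
    using test_functions_L2_on[OF f A'] by (auto simp: L2_on_iff_sq_int[OF A'])
  let ?a = "\<lambda>k x. f k x - u x" and ?b = "\<lambda>k x. grad (f k) x - weak_grad A u x"
  have sq: "sq_int ?M (?a k)" "sq_int ?M (?b k)" for k by (intro sq_int_diff sqf squ)+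
  have eq: "(LINT x:A|lborel. (?a k x)\<^sup>2 + (norm (?b k x))\<^sup>2) = ip ?M (?a k) (?a k) + ip ?M (?b k) (?b k)" for k
    unfolding set_lebesgue_integral_restrict_space[OF A'] ip_self
    using sq by (subst Bochner_Integration.integral_add) (auto simp: sq_int_def)
  have "(\<lambda>k. ip ?M (?a k) (?a k)) \<longlonglongrightarrow> 0" "(\<lambda>k. ip ?M (?b k) (?b k)) \<longlonglongrightarrow> 0"
    by (rule tendsto_sandwich[OF _ _ tendsto_const lim[unfolded eq]]; simp add: ip_nonneg)+
  then have "L2_lim ?M f u" "L2_lim ?M (\<lambda>k. grad (f k)) (weak_grad A u)"
    unfolding L2_lim_def by (auto intro: sqf squ)
  then show ?thesis by (rule that[OF f])
qed

text \<open>Testing the equation for \<open>\<phi> i\<close> with \<open>\<phi> j\<close>, itself an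
  element of \<open>H1_0 A\<close>, transfers orthonormality to the gradients with weight
  \<open>\<mu> i\<close>.\<close>

lemma eigenbasis_eigensystem:
  assumes A: "open A" and eb: "dirichlet_eigenbasis A \<mu> \<phi>"
  shows "eigensystem (restrict_space lborel A) \<mu> \<phi> (\<lambda>j. weak_grad A (\<phi> j))"
proof -
  let ?M = "restrict_space lborel A"
  have A': "A \<in> sets borel" using A by simp
  have lap: "dirichlet_laplacian A (\<phi> j) (\<lambda>x. \<mu> j * \<phi> j x)" for j
    using eb by (simp add: dirichlet_eigenbasis_def)
  then have H: "\<phi> j \<in> H1_0 A" for j by (simp add: dirichlet_laplacian_def)
  have orth: "ip ?M (\<phi> i) (\<phi> j) = (if i = j then 1 else 0)" for i j
    using eb by (simp add: dirichlet_eigenbasis_def L2_inner_eq_ip[OF A'])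
  show ?thesis
  proof
    show "sq_int ?M (\<phi> j)" "sq_int ?M (weak_grad A (\<phi> j))" for j
      using has_weak_grad_weak_grad[OF H[of j]]
      by (auto simp: has_weak_grad_def L2_on_iff_sq_int[OF A'])
    show "ip ?M (weak_grad A (\<phi> i)) (weak_grad A (\<phi> j)) = (if i = j then \<mu> i else 0)" for i j
      using lap[of i] H[of j] orth[of i j] ip_scaleR_left[of ?M "\<mu> i" "\<phi> i" "\<phi> j"]
      by (simp add: dirichlet_laplacian_def dirichlet_form_eq_ip[OF A'] L2_inner_eq_ip[OF A'])
  qed (rule orth)
qed

text \<open>Only the L2 term refers to A. The Dirichlet term runs over the whole space, which
  changes nothing for w supported in A and lets the same w be used in several domains.\<close>

definition energy :: "'a::euclidean_space set \<Rightarrow> real \<Rightarrow> ('a \<Rightarrow> real) \<Rightarrow> ('a \<Rightarrow> real) \<Rightarrow> real" where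
  "energy A t u w = (LINT x:A|lborel. (u x - w x)\<^sup>2) + t * (LINT x|lborel. (norm (grad w x))\<^sup>2)"

text \<open>The spectral expression of the infimum of \<open>energy A t u w\<close> over \<open>w \<in> H\<^sup>1\<^sub>0(A)\<close>.\<close>

definition K_fun :: "'a::euclidean_space set \<Rightarrow> (nat \<Rightarrow> real) \<Rightarrow> (nat \<Rightarrow> 'a \<Rightarrow> real) \<Rightarrow> real
    \<Rightarrow> ('a \<Rightarrow> real) \<Rightarrow> ennreal" where
  "K_fun A \<mu> \<phi> t u = (\<Sum>j. ennreal (t * \<mu> j / (1 + t * \<mu> j) * (L2_inner A u (\<phi> j))\<^sup>2))"

lemma energy_eq_ip:
  assumes A: "open A" and w: "w \<in> test_functions A"
  shows "energy A t u w = ip (restrict_space lborel A) (\<lambda>x. u x - w x) (\<lambda>x. u x - w x)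
    + t * ip (restrict_space lborel A) (grad w) (grad w)"
proof -
  have A': "A \<in> sets borel" using A by simp
  show ?thesis
    unfolding energy_def ip_self integral_grad_sq_restrict[OF A w] set_lebesgue_integral_restrict_space[OF A'] by simp
qed

lemma energy_nonneg: "t \<ge> 0 \<Longrightarrow> 0 \<le> energy A t u w"
  unfolding energy_def set_lebesgue_integral_def
  by (intro add_nonneg_nonneg mult_nonneg_nonneg integral_nonneg_AE) auto

lemma eigenvalue_nonneg:
  assumes "open A" "dirichlet_eigenbasis A \<mu> \<phi>" shows "0 \<le> \<mu> j"
  using eigensystem.eigenvalue_nonneg[OF eigenbasis_eigensystem[OF assms]] .

text \<open>Half of the variational characterisation. A test function lies in \<open>H1_0 A\<close>,
  so the eigenvalue equation may be tested with it; this gives the coefficients \<mu>_j (w,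
  \<phi>_j) of its gradient and \<open>energy_lower_bound\<close> applies to every partial
  sum.\<close>

lemma K_fun_le_energy:
  assumes A: "open A" and eb: "dirichlet_eigenbasis A \<mu> \<phi>" and u: "u \<in> L2_on A"
    and w: "w \<in> test_functions A" and t: "t > 0"
  shows "K_fun A \<mu> \<phi> t u \<le> ennreal (energy A t u w)"
proof -
  let ?M = "restrict_space lborel A"
  have A': "A \<in> sets borel" using A by simp
  interpret eigensystem ?M \<mu> \<phi> "\<lambda>j. weak_grad A (\<phi> j)" by (rule eigenbasis_eigensystem[OF A eb])
  let ?s = "\<lambda>j. t * \<mu> j / (1 + t * \<mu> j) * (L2_inner A u (\<phi> j))\<^sup>2"
  have sqw: "sq_int ?M w" "sq_int ?M (grad w)"
    using test_functions_L2_on[OF w A'] by (auto simp: L2_on_iff_sq_int[OF A'])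
  have "ip ?M (grad w) (weak_grad A (\<phi> j)) = \<mu> j * ip ?M w (\<phi> j)" for j
  proof -
    have "ip ?M (grad w) (weak_grad A (\<phi> j)) = ip ?M (weak_grad A (\<phi> j)) (weak_grad A w)"
      unfolding ip_commute[of _ "weak_grad A (\<phi> j)"] unfolding ip_def
    proof (rule integral_cong_AE)
      have "has_weak_grad A w (weak_grad A w)"
        by (rule has_weak_grad_weak_grad[OF test_function_in_H1_0[OF A w]])
      then have "sq_int ?M (weak_grad A w)"
        by (simp add: has_weak_grad_def L2_on_iff_sq_int[OF A'])
      then show "(\<lambda>x. weak_grad A w x \<bullet> weak_grad A (\<phi> j) x) \<in> borel_measurable ?M"
        using sq_D[of j] by (auto simp: sq_int_def)
      show "(\<lambda>x. grad w x \<bullet> weak_grad A (\<phi> j) x) \<in> borel_measurable ?M"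
        using sqw sq_D[of j] by (auto simp: sq_int_def)
      show "AE x in ?M. grad w x \<bullet> weak_grad A (\<phi> j) x = weak_grad A w x \<bullet> weak_grad A (\<phi> j) x"
        using weak_grad_test_function[OF A w] by eventually_elim simp
    qed
    also have "\<dots> = \<mu> j * ip ?M (\<phi> j) w"
    proof -
      have "dirichlet_laplacian A (\<phi> j) (\<lambda>x. \<mu> j * \<phi> j x)"
        using eb by (simp add: dirichlet_eigenbasis_def)
      then show ?thesis
        using test_function_in_H1_0[OF A w] ip_scaleR_left[of ?M "\<mu> j" "\<phi> j" w]
        by (simp add: dirichlet_laplacian_def dirichlet_form_eq_ip[OF A'] L2_inner_eq_ip[OF A'])
    qed
    finally show ?thesis by (simp add: ip_commute)
  qed
  then have "(\<Sum>j<N. ?s j) \<le> energy A t u w" for N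
    unfolding energy_eq_ip[OF A w] L2_inner_eq_ip[OF A']
    by (intro energy_lower_bound sqw t) (use u in \<open>auto simp: L2_on_iff_sq_int[OF A']\<close>)
  moreover have "0 \<le> ?s j" for j using eigenvalue_nonneg[of j] t by simp
  ultimately have "(\<Sum>j<N. ennreal (?s j)) \<le> ennreal (energy A t u w)" for N
    by (simp add: sum_ennreal ennreal_leI)
  then show ?thesis unfolding K_fun_def by (intro suminf_le_const) auto
qed

text \<open>The other half, up to an arbitrary e > 0: the minimiser is in general no test function,
  but a truncated eigenfunction expansion with each \<open>\<phi> j\<close> replaced by an H1-close
  test function comes near it.\<close>

lemma energy_le_K_fun:
  assumes A: "open A" and eb: "dirichlet_eigenbasis A \<mu> \<phi>" and u: "u \<in> L2_on A"
    and t: "t > 0" and e: "e > 0"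
  obtains w where "w \<in> test_functions A" "ennreal (energy A t u w) \<le> K_fun A \<mu> \<phi> t u + ennreal e"
proof -
  let ?M = "restrict_space lborel A"
  have A': "A \<in> sets borel" using A by simp
  interpret eigensystem ?M \<mu> \<phi> "\<lambda>j. weak_grad A (\<phi> j)" by (rule eigenbasis_eigensystem[OF A eb])
  let ?s = "\<lambda>j. t * \<mu> j / (1 + t * \<mu> j) * (L2_inner A u (\<phi> j))\<^sup>2"
  have squ: "sq_int ?M u" using u by (simp add: L2_on_iff_sq_int[OF A'])
  have "\<phi> j \<in> H1_0 A" for j
    using eb by (simp add: dirichlet_eigenbasis_def dirichlet_laplacian_def)
  then have "\<exists>f. (\<forall>k::nat. f k \<in> test_functions A) \<and> L2_lim ?M f (\<phi> j)
      \<and> L2_lim ?M (\<lambda>k. grad (f k)) (weak_grad A (\<phi> j))" for j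
    using H1_0_L2_lim[OF A] by metis
  then obtain F where F: "\<And>j k::nat. F j k \<in> test_functions A" "\<And>j. L2_lim ?M (F j) (\<phi> j)"
    "\<And>j. L2_lim ?M (\<lambda>k. grad (F j k)) (weak_grad A (\<phi> j))"
    by metis
  have "(\<lambda>N. LINT x:A|lborel. (u x - (\<Sum>j<N. L2_inner A u (\<phi> j) * \<phi> j x))\<^sup>2) \<longlonglongrightarrow> 0"
    using eb u by (simp add: dirichlet_eigenbasis_def)
  then have complete: "(\<lambda>N. ip ?M (\<lambda>x. u x - (\<Sum>j<N. ip ?M u (\<phi> j) *\<^sub>R \<phi> j x))
      (\<lambda>x. u x - (\<Sum>j<N. ip ?M u (\<phi> j) *\<^sub>R \<phi> j x))) \<longlonglongrightarrow> 0"
    unfolding ip_self set_lebesgue_integral_restrict_space[OF A'] L2_inner_eq_ip[OF A'] by simp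
  obtain c k and N :: nat where le:
    "ip ?M (\<lambda>x. u x - (\<Sum>j<N. c j *\<^sub>R F j k x)) (\<lambda>x. u x - (\<Sum>j<N. c j *\<^sub>R F j k x))
      + t * ip ?M (\<lambda>x. \<Sum>j<N. c j *\<^sub>R grad (F j k) x) (\<lambda>x. \<Sum>j<N. c j *\<^sub>R grad (F j k) x)
    \<le> (\<Sum>j<N. t * \<mu> j / (1 + t * \<mu> j) * (ip ?M u (\<phi> j))\<^sup>2) + e"
    using energy_upper_bound[OF squ t e complete F(2) F(3)] by blast
  define w where "w x = (\<Sum>j<N. c j * F j k x)" for x
  have w: "w \<in> test_functions A"
    unfolding w_def by (intro test_functions_sum test_functions_cmult F)
  have "grad w = (\<lambda>x. \<Sum>j<N. c j *\<^sub>R grad (F j k) x)"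
    unfolding w_def by (intro ext grad_eqI GDERIV_sum GDERIV_cmult test_functions_GDERIV[OF F(1)])
  then have "energy A t u w \<le> (\<Sum>j<N. ?s j) + e"
    using le unfolding energy_eq_ip[OF A w] L2_inner_eq_ip[OF A'] by (simp add: w_def)
  moreover have s0: "0 \<le> ?s j" for j using eigenvalue_nonneg[of j] t by simp
  ultimately have "ennreal (energy A t u w) \<le> (\<Sum>j<N. ennreal (?s j)) + ennreal e"
    using e by (simp add: sum_ennreal ennreal_leI sum_nonneg flip: ennreal_plus)
  also have "(\<Sum>j<N. ennreal (?s j)) \<le> K_fun A \<mu> \<phi> t u"
    unfolding K_fun_def by (rule sum_le_suminf) auto
  finally show ?thesis using that w by (meson add_right_mono order_trans)
qed

section \<open>Pushing test functions into a Lipschitz domain\<close>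

text \<open>Since A lies below the graph, e points outwards. If even a point close to x + \<delta> e
  is below the graph, then x, which is lower by \<delta>, is below it too. The radii keep y inside
  the chart: |y - p| is at most R / 2 + R / 8 + |y - x - \<delta> e|, the last term being less than
  R / 8.\<close>

lemma lipschitz_chart_shift:
  assumes chart: "lipschitz_chart A p R L" and R: "R > 0"
  obtains e M where "norm e = 1" "M \<ge> 1"
    "\<And>\<delta> x y. 0 < \<delta> \<Longrightarrow> \<delta> \<le> R / 8 \<Longrightarrow> x \<in> cball p (R / 2) \<Longrightarrow> y \<in> A \<Longrightarrow>
      norm (y - (x + \<delta> *\<^sub>R e)) < \<delta> / M \<Longrightarrow> x \<in> A"
proof -
  obtain e g where e: "norm e = 1" and g: "L-lipschitz_on {y. y \<bullet> e = 0} g"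
    and A: "\<And>x. x \<in> ball p R \<Longrightarrow> x \<in> A \<longleftrightarrow> x \<bullet> e < g (x - (x \<bullet> e) *\<^sub>R e)"
    using chart unfolding lipschitz_chart_def by auto
  have ee: "e \<bullet> e = 1" using e by (simp add: norm_eq_1)
  have L: "L \<ge> 0" using g by (rule lipschitz_on_nonneg)
  let ?pr = "\<lambda>x. x - (x \<bullet> e) *\<^sub>R e"
  show ?thesis
  \<comment> \<open>A displacement z changes the height by at most |z| and the graph by at most 2 L
    |z|, the 2 being the crude bound for the projection of z to the hyperplane. Both together must
    stay below \<delta>.\<close>
  proof (rule that[of e "1 + 2 * L"])
    fix \<delta> x y assume \<delta>: "0 < \<delta>" "\<delta> \<le> R / 8" and x: "x \<in> cball p (R / 2)" and y: "y \<in> A"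
      and z: "norm (y - (x + \<delta> *\<^sub>R e)) < \<delta> / (1 + 2 * L)"
    define z where "z = y - (x + \<delta> *\<^sub>R e)"
    have z1: "norm z * (1 + 2 * L) < \<delta>"
      using z L unfolding z_def[symmetric] by (simp add: pos_less_divide_eq)
    moreover have "norm z * 1 \<le> norm z * (1 + 2 * L)" using L by (intro mult_left_mono) auto
    ultimately have z2: "norm z < \<delta>" by linarith
    have y_eq: "y = x + \<delta> *\<^sub>R e + z" by (simp add: z_def)
    have "norm (y - p) \<le> norm (x - p) + norm (\<delta> *\<^sub>R e) + norm z"
      using norm_triangle_le[OF add_mono[OF norm_triangle_ineq[of "x - p" "\<delta> *\<^sub>R e"] order_refl], of z]
      by (simp add: y_eq algebra_simps)
    also have "\<dots> < R" using x \<delta> z2 e R by (auto simp: dist_norm norm_minus_commute)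
    finally have "y \<in> ball p R" by (simp add: dist_norm norm_minus_commute)
    with y A have y1: "y \<bullet> e < g (?pr y)" by blast
    have "\<bar>g (?pr y) - g (?pr x)\<bar> \<le> L * norm (?pr y - ?pr x)"
      using lipschitz_onD[OF g, of "?pr y" "?pr x"] by (simp add: dist_norm inner_diff_left ee)
    also have "?pr y - ?pr x = z - (z \<bullet> e) *\<^sub>R e"
      by (simp add: y_eq inner_add_left ee algebra_simps)
    also have "L * norm (z - (z \<bullet> e) *\<^sub>R e) \<le> L * (2 * norm z)"
    proof (rule mult_left_mono[OF _ L])
      have "\<bar>z \<bullet> e\<bar> \<le> norm z" using Cauchy_Schwarz_ineq2[of z e] e by simp
      then show "norm (z - (z \<bullet> e) *\<^sub>R e) \<le> 2 * norm z"
        using norm_triangle_ineq4[of z "(z \<bullet> e) *\<^sub>R e"] e by simp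
    qed
    finally have g1: "g (?pr y) \<le> g (?pr x) + L * (2 * norm z)" by linarith
    have "x \<bullet> e = y \<bullet> e - \<delta> - z \<bullet> e" by (simp add: y_eq inner_add_left ee)
    moreover have "- (z \<bullet> e) \<le> norm z" using Cauchy_Schwarz_ineq2[of z e] e by simp
    ultimately have "x \<bullet> e < g (?pr x) + (norm z * (1 + 2 * L) - \<delta>)"
      using y1 g1 by (simp add: algebra_simps)
    then have "x \<bullet> e < g (?pr x)" using z1 by linarith
    moreover have "x \<in> ball p R" using x R by auto
    ultimately show "x \<in> A" using A by blast
  qed (use e L in auto)
qed

text \<open>Interior points are treated on the same footing as boundary points by taking the zero
  direction on a ball contained in the domain; this is why the norm of e is only required to be at
  most 1.\<close>

lemma lipschitz_domain_local_shift:
  assumes "lipschitz_domain \<Omega>" "p \<in> closure \<Omega>"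
  shows "\<exists>r e M \<delta>0. r > 0 \<and> norm e \<le> 1 \<and> M \<ge> 1 \<and> \<delta>0 > 0 \<and>
    (\<forall>\<delta> x y. 0 < \<delta> \<longrightarrow> \<delta> \<le> \<delta>0 \<longrightarrow> x \<in> cball p r \<longrightarrow> y \<in> \<Omega> \<longrightarrow>
      norm (y - (x + \<delta> *\<^sub>R e)) < \<delta> / M \<longrightarrow> x \<in> \<Omega>)"
proof (cases "p \<in> \<Omega>")
  case True
  have "open \<Omega>" using assms by (simp add: lipschitz_domain_def open_domain_def)
  with True obtain r where "r > 0" "cball p r \<subseteq> \<Omega>" using open_contains_cball by blast
  then show ?thesis
    by (intro exI[of _ r] exI[of _ 0] exI[of _ 1] conjI allI impI) (auto simp: subset_iff)
next
  case False
  then have "p \<in> frontier \<Omega>"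
    using assms by (simp add: frontier_def lipschitz_domain_def open_domain_def interior_open)
  with assms obtain R L where R: "R > 0" and chart: "lipschitz_chart \<Omega> p R L"
    unfolding lipschitz_domain_def by blast
  show ?thesis
  proof (rule lipschitz_chart_shift[OF chart R])
    fix e M assume eM: "norm e = 1" "M \<ge> 1"
      and shift: "\<And>\<delta> x y. 0 < \<delta> \<Longrightarrow> \<delta> \<le> R / 8 \<Longrightarrow> x \<in> cball p (R / 2) \<Longrightarrow> y \<in> \<Omega> \<Longrightarrow>
        norm (y - (x + \<delta> *\<^sub>R e)) < \<delta> / M \<Longrightarrow> x \<in> \<Omega>"
    show ?thesis
    proof (intro exI conjI allI impI)
      show "0 < R / 2" "0 < R / 8" using R by auto
      show "norm e \<le> 1" "1 \<le> M" using eM by auto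
    qed (rule shift)
  qed
qed

lemma telescoping_partition:
  fixes \<theta> :: "nat \<Rightarrow> real"
  shows "(\<Sum>i<n. \<theta> i * (\<Prod>j<i. 1 - \<theta> j)) = 1 - (\<Prod>i<n. 1 - \<theta> i)"
  by (induction n) (simp_all add: algebra_simps)

text \<open>Finitely many local balls cover the compact closure, and \<eta>_i = \<theta>_i times the
  product of 1 - \<theta>_j over j < i telescopes to 1 minus the product of all 1 - \<theta>_i. This
  is 1 wherever some cutoff is 1, hence on the union of the half balls, which by compactness
  contains a full \<rho>-neighbourhood of the closure.\<close>

lemma lipschitz_domain_partition:
  fixes \<Omega> :: "'a::euclidean_space set"
  assumes "bounded \<Omega>" and lip: "lipschitz_domain \<Omega>"
  obtains n :: nat and \<eta> e \<rho> M \<delta>0 where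
    "\<And>i. \<eta> i \<in> test_functions (UNIV :: 'a set)" "\<And>i x. 0 \<le> \<eta> i x"
    "\<And>x. (\<Sum>i<n. \<eta> i x) \<le> 1" "\<And>x y. y \<in> \<Omega> \<Longrightarrow> dist y x < \<rho> \<Longrightarrow> (\<Sum>i<n. \<eta> i x) = 1"
    "\<And>i. norm (e i) \<le> 1" "\<rho> > 0" "M \<ge> 1" "\<delta>0 > 0"
    "\<And>i \<delta> x y. i < n \<Longrightarrow> 0 < \<delta> \<Longrightarrow> \<delta> \<le> \<delta>0 \<Longrightarrow> x \<in> supp (\<eta> i) \<Longrightarrow> y \<in> \<Omega> \<Longrightarrow>
      norm (y - (x + \<delta> *\<^sub>R e i)) < \<delta> / M \<Longrightarrow> x \<in> \<Omega>"
proof -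
  have comp: "compact (closure \<Omega>)" using assms by simp
  have "\<forall>p\<in>closure \<Omega>. \<exists>r e M \<delta>0. r > 0 \<and> norm e \<le> 1 \<and> M \<ge> 1 \<and> \<delta>0 > 0 \<and>
    (\<forall>\<delta> x y. 0 < \<delta> \<longrightarrow> \<delta> \<le> \<delta>0 \<longrightarrow> x \<in> cball p r \<longrightarrow> y \<in> \<Omega> \<longrightarrow>
      norm (y - (x + \<delta> *\<^sub>R e)) < \<delta> / M \<longrightarrow> x \<in> \<Omega>)"
    using lipschitz_domain_local_shift[OF lip] by blast
  then obtain r E N d where good: "\<And>p. p \<in> closure \<Omega> \<Longrightarrow> r p > 0 \<and> norm (E p) \<le> 1 \<and> N p \<ge> 1 \<and> d p > 0 \<and>
    (\<forall>\<delta> x y. 0 < \<delta> \<longrightarrow> \<delta> \<le> d p \<longrightarrow> x \<in> cball p (r p) \<longrightarrow> y \<in> \<Omega> \<longrightarrow>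
      norm (y - (x + \<delta> *\<^sub>R E p)) < \<delta> / N p \<longrightarrow> x \<in> \<Omega>)"
    unfolding bchoice_iff by blast
  have "closure \<Omega> \<subseteq> (\<Union>p\<in>closure \<Omega>. ball p (r p / 2))"
    using good by force
  then obtain P where P: "P \<subseteq> closure \<Omega>" "finite P" "closure \<Omega> \<subseteq> (\<Union>p\<in>P. ball p (r p / 2))"
    using compactE_image[OF comp, of "closure \<Omega>" "\<lambda>p. ball p (r p / 2)"] by blast
  have "\<Omega> \<noteq> {}" using lip by (simp add: lipschitz_domain_def open_domain_def)
  then have "P \<noteq> {}" using P(3) closure_subset by blast
  then obtain p0 where p0: "p0 \<in> P" by blast
  obtain q where q: "bij_betw q {0..<card P} P" using ex_bij_betw_nat_finite[OF P(2)] by blast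
  define n where "n = card P"
  \<comment> \<open>The default p0 gives every index a genuine centre, so the properties of \<eta>_i
    hold for all i and not only for i < n.\<close>
  define p where "p i = (if i < n then q i else p0)" for i
  have pP: "p i \<in> P" for i
    using q p0 by (auto simp: p_def n_def bij_betw_def)
  have Pp: "\<exists>i<n. a = p i" if "a \<in> P" for a
    using q that by (force simp: p_def n_def bij_betw_def)
  have pcl: "p i \<in> closure \<Omega>" for i using pP P(1) by blast
  have rpos: "r (p i) > 0" for i using good[OF pcl] by blast
  have "\<exists>\<theta>. (\<forall>k. Ck k \<theta>) \<and> (\<forall>x. 0 \<le> \<theta> x \<and> \<theta> x \<le> 1) \<and> (\<forall>x\<in>ball (p i) (r (p i) / 2). \<theta> x = 1)
      \<and> (\<forall>x. \<theta> x \<noteq> 0 \<longrightarrow> x \<in> ball (p i) (r (p i)))" for i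
    using smooth_cutoff[OF rpos[of i], of "p i"] by metis
  then obtain \<theta> where \<theta>: "\<And>i k. Ck k (\<theta> i)" "\<And>i x. 0 \<le> \<theta> i x" "\<And>i x. \<theta> i x \<le> 1"
    "\<And>i x. x \<in> ball (p i) (r (p i) / 2) \<Longrightarrow> \<theta> i x = 1" "\<And>i x. \<theta> i x \<noteq> 0 \<Longrightarrow> x \<in> ball (p i) (r (p i))"
    by metis
  define \<eta> where "\<eta> i x = \<theta> i x * (\<Prod>j<i. 1 - \<theta> j x)" for i x
  have sum_chi: "(\<Sum>i<n. \<eta> i x) = 1 - (\<Prod>i<n. 1 - \<theta> i x)" for x
    unfolding \<eta>_def by (rule telescoping_partition)
  let ?U = "\<Union>p\<in>P. ball p (r p / 2)"
  obtain \<rho> where \<rho>: "\<rho> > 0" "(\<Union>x\<in>closure \<Omega>. ball x \<rho>) \<subseteq> ?U"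
  proof (rule compact_subset_open_imp_ball_epsilon_subset[OF comp _ P(3)])
    show "open ?U" by (intro open_UN ballI open_ball)
  qed blast
  \<comment> \<open>The sum dominates each local constant, as all of them are at least 1; the
    leading 1 gives M >= 1.\<close>
  define M where "M = 1 + (\<Sum>i<n. N (p i))"
  define \<delta>0 where "\<delta>0 = Min (insert 1 ((\<lambda>i. d (p i)) ` {..<n}))"
  have N1: "N (p i) \<ge> 1" for i using good[OF pcl] by blast
  have NM: "N (p i) \<le> M" if "i < n" for i
  proof -
    have "N (p i) \<le> (\<Sum>i<n. N (p i))"
      using that N1 by (intro member_le_sum) (auto intro: order_trans[OF zero_le_one])
    then show ?thesis by (simp add: M_def)
  qed
  have sum0: "0 \<le> (\<Sum>i<n. N (p i))" by (intro sum_nonneg) (rule order_trans[OF zero_le_one N1])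
  have supp_chi: "supp (\<eta> i) \<subseteq> cball (p i) (r (p i))" for i
    unfolding supp_def
  proof (rule closure_minimal)
    show "{x. \<eta> i x \<noteq> 0} \<subseteq> cball (p i) (r (p i))"
    proof
      fix x assume "x \<in> {x. \<eta> i x \<noteq> 0}"
      then have "\<theta> i x \<noteq> 0" by (auto simp: \<eta>_def)
      then have "x \<in> ball (p i) (r (p i))" by (rule \<theta>)
      then show "x \<in> cball (p i) (r (p i))" by simp
    qed
  qed simp
  show ?thesis
  proof (rule that[of \<eta> n \<rho> "\<lambda>i. E (p i)" M \<delta>0])
    show "\<eta> i \<in> test_functions (UNIV :: 'a set)" for i
    proof (rule test_functionsI[of _ "cball (p i) (r (p i))"])
      show "Ck k (\<eta> i)" for k
        unfolding \<eta>_def by (intro Ck_mult Ck_prod Ck_diff Ck_const \<theta>)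
      show "x \<in> cball (p i) (r (p i))" if "\<eta> i x \<noteq> 0" for x
        using in_suppI[of "\<eta> i" x] that supp_chi by blast
    qed auto
    show "0 \<le> \<eta> i x" for i x
      unfolding \<eta>_def using \<theta>(2,3) by (intro mult_nonneg_nonneg prod_nonneg) auto
    show "(\<Sum>i<n. \<eta> i x) \<le> 1" for x
      unfolding sum_chi using \<theta>(3) prod_nonneg[of "{..<n}" "\<lambda>i. 1 - \<theta> i x"] by simp
    show "(\<Sum>i<n. \<eta> i x) = 1" if "y \<in> \<Omega>" "dist y x < \<rho>" for x y
    proof -
      have "y \<in> closure \<Omega>" using that(1) closure_subset by blast
      moreover have "x \<in> ball y \<rho>" using that(2) by simp
      ultimately have "x \<in> ?U" using \<rho>(2) by blast
      then obtain a where a: "a \<in> P" "x \<in> ball a (r a / 2)" by blast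
      with Pp obtain i where i: "i < n" "a = p i" by blast
      then have "\<theta> i x = 1" using a(2) by (intro \<theta>(4)) simp
      then have "(\<Prod>i<n. 1 - \<theta> i x) = 0" using i(1) by (intro prod_zero) auto
      then show ?thesis by (simp add: sum_chi)
    qed
    show "norm (E (p i)) \<le> 1" for i using good[OF pcl] by blast
    show "M \<ge> 1" using sum0 by (simp add: M_def)
    show "\<delta>0 > 0" using good[OF pcl] by (simp add: \<delta>0_def)
    show "x \<in> \<Omega>" if i: "i < n" and \<delta>: "0 < \<delta>" "\<delta> \<le> \<delta>0" and x: "x \<in> supp (\<eta> i)" and y: "y \<in> \<Omega>"
      and z: "norm (y - (x + \<delta> *\<^sub>R E (p i))) < \<delta> / M" for i \<delta> x y
    proof -
      have "\<delta>0 \<le> d (p i)" unfolding \<delta>0_def using i by (intro Min_le) auto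
      with \<delta> have "\<delta> \<le> d (p i)" by linarith
      moreover have "\<delta> / M \<le> \<delta> / N (p i)"
        using NM[OF i] N1[of i] \<delta> by (intro divide_left_mono mult_pos_pos) linarith+
      with z have "norm (y - (x + \<delta> *\<^sub>R E (p i))) < \<delta> / N (p i)" by linarith
      ultimately show ?thesis using good[OF pcl[of i]] \<delta>(1) y x supp_chi[of i] by blast
    qed
  qed (rule \<rho>)
qed

text \<open>Convexity of the squared norm; weights of total less than 1 are covered because the
  missing mass may be put on the zero vector. The proof is Cauchy-Schwarz after splitting each
  weight into two square roots.\<close>

lemma norm_convex_sum_sq_le:
  fixes a :: "nat \<Rightarrow> 'a::real_normed_vector"
  assumes c: "\<And>i. 0 \<le> c i" and c1: "(\<Sum>i<n. c i) \<le> 1"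
  shows "(norm (\<Sum>i<n. c i *\<^sub>R a i))\<^sup>2 \<le> (\<Sum>i<n. c i * (norm (a i))\<^sup>2)"
proof -
  have "norm (\<Sum>i<n. c i *\<^sub>R a i) \<le> (\<Sum>i<n. norm (c i *\<^sub>R a i))" by (rule norm_sum)
  also have "\<dots> = (\<Sum>i<n. sqrt (c i) * (sqrt (c i) * norm (a i)))"
    using c by (simp add: mult.assoc[symmetric])
  finally have "(norm (\<Sum>i<n. c i *\<^sub>R a i))\<^sup>2 \<le> (\<Sum>i<n. sqrt (c i) * (sqrt (c i) * norm (a i)))\<^sup>2"
    by (intro power_mono) auto
  also have "\<dots> \<le> (\<Sum>i<n. (sqrt (c i))\<^sup>2) * (\<Sum>i<n. (sqrt (c i) * norm (a i))\<^sup>2)"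
    by (rule Cauchy_Schwarz_ineq_sum)
  also have "\<dots> = (\<Sum>i<n. c i) * (\<Sum>i<n. c i * (norm (a i))\<^sup>2)"
    using c by (simp add: power_mult_distrib)
  also have "\<dots> \<le> (\<Sum>i<n. c i * (norm (a i))\<^sup>2)"
    using c c1 by (intro mult_left_le_one_le sum_nonneg) auto
  finally show ?thesis .
qed

lemma norm_add_sq_le:
  fixes x y :: "'a::real_inner"
  assumes "\<delta> > 0"
  shows "(norm (x + y))\<^sup>2 \<le> (1 + \<delta>) * (norm x)\<^sup>2 + (1 + 1 / \<delta>) * (norm y)\<^sup>2"
proof -
  have "(norm (\<delta> *\<^sub>R x - y))\<^sup>2 = \<delta>\<^sup>2 * (norm x)\<^sup>2 - 2 * \<delta> * (x \<bullet> y) + (norm y)\<^sup>2"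
    unfolding power2_norm_eq_inner
    by (simp add: inner_diff_left inner_diff_right inner_commute[of y x] power2_eq_square algebra_simps)
  then have "2 * \<delta> * (x \<bullet> y) \<le> \<delta>\<^sup>2 * (norm x)\<^sup>2 + (norm y)\<^sup>2"
    using zero_le_power2[of "norm (\<delta> *\<^sub>R x - y)"] by linarith
  then have "2 * (x \<bullet> y) \<le> \<delta> * (norm x)\<^sup>2 + (norm y)\<^sup>2 / \<delta>"
    using assms by (simp add: field_simps power2_eq_square)
  moreover have "(norm (x + y))\<^sup>2 = (norm x)\<^sup>2 + 2 * (x \<bullet> y) + (norm y)\<^sup>2"
    by (simp add: power2_norm_eq_inner inner_add_left inner_add_right inner_commute[of y x])
  ultimately show ?thesis by (simp add: algebra_simps)
qed

lemma in_supp_translate: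
  fixes w :: "'a::euclidean_space \<Rightarrow> real"
  assumes "w (x + c) \<noteq> 0"
  shows "x \<in> (\<lambda>x. x - c) ` supp w"
  using in_suppI[of w "x + c"] assms by (intro image_eqI[of _ _ "x + c"]) auto

text \<open>Near the boundary the function is translated in the outward direction of the chart, so that its
  translate vanishes in a neighbourhood of the boundary; a partition of unity glues the pieces. The
  commutator terms are controlled by \<open>translation_estimate\<close>.\<close>

locale shift_partition =
  fixes \<Omega> :: "'a::euclidean_space set" and n :: nat and \<eta> :: "nat \<Rightarrow> 'a \<Rightarrow> real"
    and e :: "nat \<Rightarrow> 'a" and \<rho> M \<delta>0 B :: real
  assumes eta_test: "\<And>i. \<eta> i \<in> test_functions UNIV" and eta_nonneg: "\<And>i x. 0 \<le> \<eta> i x"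
    and eta_le: "\<And>x. (\<Sum>i<n. \<eta> i x) \<le> 1"
    and eta_sum: "\<And>x y. y \<in> \<Omega> \<Longrightarrow> dist y x < \<rho> \<Longrightarrow> (\<Sum>i<n. \<eta> i x) = 1"
    and e_le: "\<And>i. norm (e i) \<le> 1" and rho: "\<rho> > 0" and M: "M \<ge> 1" and delta0: "\<delta>0 > 0"
    and shift: "\<And>i \<delta> x y. i < n \<Longrightarrow> 0 < \<delta> \<Longrightarrow> \<delta> \<le> \<delta>0 \<Longrightarrow> x \<in> supp (\<eta> i) \<Longrightarrow> y \<in> \<Omega> \<Longrightarrow>
      norm (y - (x + \<delta> *\<^sub>R e i)) < \<delta> / M \<Longrightarrow> x \<in> \<Omega>"
    and B: "B > 0" "\<And>i x. i < n \<Longrightarrow> norm (grad (\<eta> i) x) \<le> B"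
      "\<And>i x y. i < n \<Longrightarrow> \<bar>\<eta> i x - \<eta> i y\<bar> \<le> B * norm (x - y)"
begin

definition pushed :: "real \<Rightarrow> ('a \<Rightarrow> real) \<Rightarrow> 'a \<Rightarrow> real" where
  "pushed \<delta> w x = (\<Sum>i<n. \<eta> i x * w (x + \<delta> *\<^sub>R e i))"

context
  fixes \<delta> :: real and w :: "'a \<Rightarrow> real"
  assumes d0: "0 < \<delta>" and d1: "\<delta> \<le> \<delta>0" "\<delta> \<le> \<rho>"
    and w: "w \<in> test_functions (\<Union>y\<in>\<Omega>. ball y (\<delta> / M))"
begin

abbreviation "E \<equiv> LINT x|lborel. (norm (grad w x))\<^sup>2"
abbreviation "d i x \<equiv> w (x + \<delta> *\<^sub>R e i) - w x"

lemma E_nonneg: "0 \<le> E"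
  by (intro integral_nonneg_AE) simp

lemma w_Ck: "Ck k (\<lambda>x. w (x + c))"
  by (rule Ck_translate[OF test_functions_Ck[OF w]])

text \<open>A point x of the support has, for some i, x in the support of \<eta>_i and x + \<delta>
  e_i in that of w, hence within \<delta> / M of \<Omega>; \<open>shift\<close> then places x inside
  \<Omega>. The supports involved are compact, so the inclusion leaves room at the boundary.\<close>

lemma pushed_test: "pushed \<delta> w \<in> test_functions \<Omega>"
proof (rule test_functionsI)
  let ?K = "\<Union>i<n. supp (\<eta> i) \<inter> (\<lambda>x. x - \<delta> *\<^sub>R e i) ` supp w"
  show "Ck k (pushed \<delta> w)" for k
    unfolding pushed_def[abs_def] by (intro Ck_sum Ck_mult w_Ck test_functions_Ck[OF eta_test])
  have c: "compact (supp (\<eta> i) \<inter> (\<lambda>x. x - \<delta> *\<^sub>R e i) ` supp w)" for i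
    by (intro compact_Int test_functions_support(1)[OF eta_test] compact_continuous_image
        test_functions_support(1)[OF w] continuous_intros)
  show "compact ?K" by (rule compact_UN) (auto intro: c)
  show "?K \<subseteq> \<Omega>"
  proof (rule UN_least, rule subsetI)
    fix i x assume i: "i \<in> {..<n}" and x: "x \<in> supp (\<eta> i) \<inter> (\<lambda>x. x - \<delta> *\<^sub>R e i) ` supp w"
    then have "x + \<delta> *\<^sub>R e i \<in> supp w" by auto
    then obtain y where y: "y \<in> \<Omega>" "x + \<delta> *\<^sub>R e i \<in> ball y (\<delta> / M)"
      using test_functions_support(2)[OF w] by blast
    then have "norm (y - (x + \<delta> *\<^sub>R e i)) < \<delta> / M" unfolding mem_ball dist_norm by blast
    with shift[of i \<delta> x y] i x d0 d1 y(1) show "x \<in> \<Omega>" by blast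
  qed
  show "x \<in> ?K" if "pushed \<delta> w x \<noteq> 0" for x
  proof -
    have "\<exists>i<n. \<eta> i x * w (x + \<delta> *\<^sub>R e i) \<noteq> 0"
    proof (rule ccontr)
      assume "\<not> ?thesis"
      then have "pushed \<delta> w x = 0" unfolding pushed_def by (intro sum.neutral) auto
      with that show False by simp
    qed
    then obtain i where i: "i < n" "\<eta> i x * w (x + \<delta> *\<^sub>R e i) \<noteq> 0" by blast
    then have "x \<in> supp (\<eta> i)" "x \<in> (\<lambda>x. x - \<delta> *\<^sub>R e i) ` supp w"
      using in_suppI[of "\<eta> i" x] in_supp_translate[of w x "\<delta> *\<^sub>R e i"] by auto
    with i(1) show ?thesis by blast
  qed
qed

lemma near_support: "w x \<noteq> 0 \<Longrightarrow> \<exists>y\<in>\<Omega>. dist y x < \<rho>"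
proof -
  assume "w x \<noteq> 0"
  then have "x \<in> (\<Union>y\<in>\<Omega>. ball y (\<delta> / M))" using test_functions_eq_0[OF w] by blast
  then obtain y where y: "y \<in> \<Omega>" "dist y x < \<delta> / M" by auto
  have "\<delta> / M \<le> \<delta>" using d0 M by (simp add: divide_le_eq_1_pos pos_divide_le_eq mult_le_cancel_left1)
  with y d1 show ?thesis by force
qed

text \<open>Where w is nonzero the partition sums to 1, and where w vanishes nothing has to be
  distributed.\<close>

lemma pushed_diff: "pushed \<delta> w x - w x = (\<Sum>i<n. \<eta> i x * d i x)"
proof -
  have "w x = (\<Sum>i<n. \<eta> i x * w x)"
    using near_support[of x] eta_sum by (cases "w x = 0") (auto simp: sum_distrib_right[symmetric])
  then show ?thesis unfolding pushed_def by (simp add: right_diff_distrib sum_subtractf)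
qed

lemma d_test: "d i \<in> test_functions UNIV"
proof -
  have "(\<lambda>x. w (x + \<delta> *\<^sub>R e i) + (-1) * w x) \<in> test_functions UNIV"
    by (intro test_functions_add test_functions_cmult test_functions_translate[OF w]
        test_functions_mono[OF subset_UNIV w])
  then show ?thesis by simp
qed

lemma d_sq_le: "(LINT x|lborel. (d i x)\<^sup>2) \<le> \<delta>\<^sup>2 * E"
proof -
  have "(LINT x|lborel. (d i x)\<^sup>2) \<le> (norm (\<delta> *\<^sub>R e i))\<^sup>2 * E" by (rule translation_estimate[OF w])
  also have "\<dots> \<le> \<delta>\<^sup>2 * E"
    using e_le[of i] d0 by (intro mult_right_mono power_mono E_nonneg) (auto simp: mult_left_le)
  finally show ?thesis .
qed

lemma d_sq_sum_le: "(LINT x|lborel. (\<Sum>i<n. (d i x)\<^sup>2)) \<le> n * (\<delta>\<^sup>2 * E)"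
proof -
  have "(LINT x|lborel. (\<Sum>i<n. (d i x)\<^sup>2)) = (\<Sum>i<n. LINT x|lborel. (d i x)\<^sup>2)"
    by (rule Bochner_Integration.integral_sum) (rule integrable_test_function_sq[OF d_test])
  also have "\<dots> \<le> (\<Sum>i<n. \<delta>\<^sup>2 * E)" by (intro sum_mono d_sq_le)
  finally show ?thesis by simp
qed

lemma d_sq_sum_integrable: "integrable lborel (\<lambda>x. \<Sum>i<n. (d i x)\<^sup>2)"
  by (intro Bochner_Integration.integrable_sum integrable_test_function_sq[OF d_test])

lemma eta_le_1: "i < n \<Longrightarrow> \<eta> i x \<le> 1"
  using member_le_sum[of i "{..<n}" "\<lambda>i. \<eta> i x"] eta_nonneg eta_le[of x] by force

lemma pushed_close: "(LINT x|lborel. (pushed \<delta> w x - w x)\<^sup>2) \<le> n * (\<delta>\<^sup>2 * E)"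
proof -
  have "(LINT x|lborel. (pushed \<delta> w x - w x)\<^sup>2) \<le> (LINT x|lborel. (\<Sum>i<n. (d i x)\<^sup>2))"
  proof (rule Bochner_Integration.integral_mono[OF _ d_sq_sum_integrable])
    have "(\<lambda>x. pushed \<delta> w x + (-1) * w x) \<in> test_functions UNIV"
      by (intro test_functions_add test_functions_cmult test_functions_mono[OF subset_UNIV w]
          test_functions_mono[OF subset_UNIV pushed_test])
    from integrable_test_function_sq[OF this]
    show "integrable lborel (\<lambda>x. (pushed \<delta> w x - w x)\<^sup>2)" by simp
    fix x
    have "(pushed \<delta> w x - w x)\<^sup>2 \<le> (\<Sum>i<n. \<eta> i x * (d i x)\<^sup>2)"
      using norm_convex_sum_sq_le[of "\<lambda>i. \<eta> i x" n "\<lambda>i. d i x"] eta_nonneg eta_le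
      unfolding pushed_diff by simp
    also have "\<dots> \<le> (\<Sum>i<n. (d i x)\<^sup>2)"
      using eta_le_1 eta_nonneg by (intro sum_mono mult_left_le_one_le) auto
    finally show "(pushed \<delta> w x - w x)\<^sup>2 \<le> (\<Sum>i<n. (d i x)\<^sup>2)" .
  qed
  also have "\<dots> \<le> n * (\<delta>\<^sup>2 * E)" by (rule d_sq_sum_le)
  finally show ?thesis .
qed

text \<open>Near a point with w nonzero the partition sums to the constant 1, so its gradient
  vanishes. This cancellation lets w(x + \<delta> e_i) be replaced by the difference
  \<open>d i x\<close> in front of grad \<eta>_i, and that difference is small in L2.\<close>

lemma sum_grad_eta: "w x *\<^sub>R (\<Sum>i<n. grad (\<eta> i) x) = 0"
proof (cases "w x = 0")
  case False
  let ?U = "\<Union>y\<in>\<Omega>. ball y \<rho>"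
  have "GDERIV (\<lambda>x. \<Sum>i<n. \<eta> i x) x :> (\<Sum>i<n. grad (\<eta> i) x)"
    by (intro GDERIV_sum test_functions_GDERIV[OF eta_test])
  then have 1: "grad (\<lambda>x. \<Sum>i<n. \<eta> i x) x = (\<Sum>i<n. grad (\<eta> i) x)" by (rule grad_eqI)
  have "((\<lambda>x. 1) has_derivative (\<lambda>h. h \<bullet> 0)) (at x)" by (simp add: has_derivative_const)
  then have "((\<lambda>x. \<Sum>i<n. \<eta> i x) has_derivative (\<lambda>h. h \<bullet> 0)) (at x)"
  proof (rule has_derivative_transform_within_open)
    show "open ?U" by (intro open_UN ballI open_ball)
    show "x \<in> ?U" using near_support[OF False] by auto
    show "1 = (\<Sum>i<n. \<eta> i y)" if "y \<in> ?U" for y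
      using that eta_sum by auto
  qed
  then have "grad (\<lambda>x. \<Sum>i<n. \<eta> i x) x = 0"
    by (intro grad_eqI) (simp add: gderiv_def)
  with 1 show ?thesis by simp
qed simp

lemma grad_pushed: "grad (pushed \<delta> w) x
  = (\<Sum>i<n. \<eta> i x *\<^sub>R grad w (x + \<delta> *\<^sub>R e i)) + (\<Sum>i<n. d i x *\<^sub>R grad (\<eta> i) x)"
proof -
  have "grad (pushed \<delta> w) x
      = (\<Sum>i<n. \<eta> i x *\<^sub>R grad w (x + \<delta> *\<^sub>R e i) + w (x + \<delta> *\<^sub>R e i) *\<^sub>R grad (\<eta> i) x)"
    unfolding pushed_def[abs_def]
    by (intro grad_eqI GDERIV_sum GDERIV_mult GDERIV_translate test_functions_GDERIV[OF eta_test]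
        test_functions_GDERIV[OF w])
  also have "\<dots> = (\<Sum>i<n. \<eta> i x *\<^sub>R grad w (x + \<delta> *\<^sub>R e i)) + (\<Sum>i<n. d i x *\<^sub>R grad (\<eta> i) x)
      + w x *\<^sub>R (\<Sum>i<n. grad (\<eta> i) x)"
    by (simp add: sum.distrib scaleR_sum_right scaleR_diff_left sum_subtractf)
  finally show ?thesis by (simp add: sum_grad_eta)
qed

text \<open>Young's inequality with the shift \<delta> itself as parameter: the main part keeps a
  factor 1 + \<delta>, while the commutator pays 1 + 1 / \<delta>. As the integral of the commutator
  square is O(\<delta>^2), the total loss remains O(\<delta>).\<close>

lemma grad_pushed_sq_le:
  "(norm (grad (pushed \<delta> w) x))\<^sup>2 \<le> (1 + \<delta>) * (\<Sum>i<n. \<eta> i x * (norm (grad w (x + \<delta> *\<^sub>R e i)))\<^sup>2)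
    + (1 + 1 / \<delta>) * (n * B\<^sup>2 * (\<Sum>i<n. (d i x)\<^sup>2))"
proof -
  let ?P = "\<Sum>i<n. \<eta> i x *\<^sub>R grad w (x + \<delta> *\<^sub>R e i)" and ?S = "\<Sum>i<n. d i x *\<^sub>R grad (\<eta> i) x"
  have P: "(norm ?P)\<^sup>2 \<le> (\<Sum>i<n. \<eta> i x * (norm (grad w (x + \<delta> *\<^sub>R e i)))\<^sup>2)"
    by (intro norm_convex_sum_sq_le eta_nonneg eta_le)
  have "norm ?S \<le> (\<Sum>i<n. norm (d i x *\<^sub>R grad (\<eta> i) x))" by (rule norm_sum)
  also have "\<dots> \<le> (\<Sum>i<n. \<bar>d i x\<bar> * B)"
    unfolding norm_scaleR real_norm_def using B(2) by (intro sum_mono mult_left_mono) auto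
  finally have "(norm ?S)\<^sup>2 \<le> (\<Sum>i<n. \<bar>d i x\<bar> * B)\<^sup>2" by (intro power_mono) auto
  also have "\<dots> \<le> n * (\<Sum>i<n. (\<bar>d i x\<bar> * B)\<^sup>2)" using sum_squared_le_sum_of_squares[of "\<lambda>i. \<bar>d i x\<bar> * B" "{..<n}"] by (simp add: mult.commute)
  also have "\<dots> = n * B\<^sup>2 * (\<Sum>i<n. (d i x)\<^sup>2)"
    by (simp add: power_mult_distrib sum_distrib_right[symmetric])
  finally have S: "(norm ?S)\<^sup>2 \<le> n * B\<^sup>2 * (\<Sum>i<n. (d i x)\<^sup>2)" .
  have "(norm (grad (pushed \<delta> w) x))\<^sup>2 \<le> (1 + \<delta>) * (norm ?P)\<^sup>2 + (1 + 1 / \<delta>) * (norm ?S)\<^sup>2"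
    unfolding grad_pushed by (rule norm_add_sq_le[OF d0])
  also have "\<dots> \<le> (1 + \<delta>) * (\<Sum>i<n. \<eta> i x * (norm (grad w (x + \<delta> *\<^sub>R e i)))\<^sup>2)
    + (1 + 1 / \<delta>) * (n * B\<^sup>2 * (\<Sum>i<n. (d i x)\<^sup>2))"
    using d0 by (intro add_mono mult_left_mono P S) auto
  finally show ?thesis .
qed

text \<open>The two shifts are independent so that the lemma covers the integrand both before and
  after the change of variables that follows.\<close>

lemma shifted_integrable: "integrable lborel (\<lambda>x. \<eta> i (x + c) * (norm (grad w (x + c')))\<^sup>2)"
proof -
  have "continuous_on UNIV (\<lambda>x. (norm (grad w (x + c')))\<^sup>2)"
    by (intro continuous_intros continuous_on_compose2[OF grad_continuous[OF w, of UNIV]]) auto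
  from integrable_test_function_times[OF test_functions_translate[OF eta_test] this]
  show ?thesis by simp
qed

text \<open>A change of variables moves the shift from the gradient to the weight \<eta>_i. The
  weights are Lipschitz with constant B, so the shifted ones still sum to at most 1 + n B \<delta>,
  the excess coming from n errors of size B \<delta>.\<close>

lemma shifted_sum_le:
  "(LINT x|lborel. (\<Sum>i<n. \<eta> i x * (norm (grad w (x + \<delta> *\<^sub>R e i)))\<^sup>2)) \<le> (1 + n * B * \<delta>) * E"
proof -
  have int: "integrable lborel (\<lambda>x. \<eta> i x * (norm (grad w (x + c)))\<^sup>2)" for i c
    using shifted_integrable[of i 0] by simp
  have int': "integrable lborel (\<lambda>x. \<eta> i (x + c) * (norm (grad w x))\<^sup>2)" for i c
    using shifted_integrable[of i c 0] by simp
  have intE: "integrable lborel (\<lambda>x. c * (norm (grad w x))\<^sup>2)" for c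
    by (intro integrable_mult_right integrable_grad_sq[OF w])
  have "(LINT x|lborel. (\<Sum>i<n. \<eta> i x * (norm (grad w (x + \<delta> *\<^sub>R e i)))\<^sup>2))
      = (\<Sum>i<n. LINT x|lborel. \<eta> i x * (norm (grad w (x + \<delta> *\<^sub>R e i)))\<^sup>2)"
    by (rule Bochner_Integration.integral_sum) (rule int)
  also have "\<dots> = (\<Sum>i<n. LINT x|lborel. \<eta> i (x - \<delta> *\<^sub>R e i) * (norm (grad w x))\<^sup>2)"
  proof (rule sum.cong[OF refl])
    fix i
    have "(\<lambda>x. \<eta> i (x - \<delta> *\<^sub>R e i) * (norm (grad w x))\<^sup>2) \<in> borel_measurable borel"
      using borel_measurable_integrable[OF int'[of i "- (\<delta> *\<^sub>R e i)"]] by simp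
    from integral_translate[OF this, of "\<delta> *\<^sub>R e i"]
    show "(LINT x|lborel. \<eta> i x * (norm (grad w (x + \<delta> *\<^sub>R e i)))\<^sup>2)
        = (LINT x|lborel. \<eta> i (x - \<delta> *\<^sub>R e i) * (norm (grad w x))\<^sup>2)" by simp
  qed
  also have "\<dots> = (LINT x|lborel. (\<Sum>i<n. \<eta> i (x - \<delta> *\<^sub>R e i) * (norm (grad w x))\<^sup>2))"
    using int'[of _ "- (\<delta> *\<^sub>R e _)"] by (intro Bochner_Integration.integral_sum[symmetric]) simp
  also have "\<dots> \<le> (LINT x|lborel. (1 + n * B * \<delta>) * (norm (grad w x))\<^sup>2)"
  proof (rule Bochner_Integration.integral_mono[OF _ intE])
    show "integrable lborel (\<lambda>x. \<Sum>i<n. \<eta> i (x - \<delta> *\<^sub>R e i) * (norm (grad w x))\<^sup>2)"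
      using int'[of _ "- (\<delta> *\<^sub>R e _)"] by (intro Bochner_Integration.integrable_sum) simp
    fix x
    have "(\<Sum>i<n. \<eta> i (x - \<delta> *\<^sub>R e i)) \<le> (\<Sum>i<n. \<eta> i x + B * \<delta>)"
    proof (rule sum_mono)
      fix i assume "i \<in> {..<n}"
      then have "\<bar>\<eta> i (x - \<delta> *\<^sub>R e i) - \<eta> i x\<bar> \<le> B * norm (\<delta> *\<^sub>R e i)"
        using B(3)[of i "x - \<delta> *\<^sub>R e i" x] by simp
      also have "\<dots> \<le> B * \<delta>"
        using e_le[of i] d0 B(1) by (intro mult_left_mono) (auto simp: mult_left_le)
      finally show "\<eta> i (x - \<delta> *\<^sub>R e i) \<le> \<eta> i x + B * \<delta>" by linarith
    qed
    also have "\<dots> \<le> 1 + n * B * \<delta>" using eta_le[of x] by (simp add: sum.distrib)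
    finally show "(\<Sum>i<n. \<eta> i (x - \<delta> *\<^sub>R e i) * (norm (grad w x))\<^sup>2) \<le> (1 + n * B * \<delta>) * (norm (grad w x))\<^sup>2"
      unfolding sum_distrib_right[symmetric] by (rule mult_right_mono) simp
  qed
  also have "\<dots> = (1 + n * B * \<delta>) * E" by simp
  finally show ?thesis .
qed

text \<open>The contributions are \<delta> from Young's inequality, n B (\<delta> + \<delta>^2) from
  the shifted weights and n^2 B^2 (\<delta> + \<delta>^2) from the commutator; for \<delta> <= 1
  each \<delta>^2 is absorbed by \<delta>.\<close>

lemma pushed_energy:
  assumes "\<delta> \<le> 1"
  shows "(LINT x|lborel. (norm (grad (pushed \<delta> w) x))\<^sup>2) \<le> (1 + (1 + 2 * n * B + 2 * n\<^sup>2 * B\<^sup>2) * \<delta>) * E"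
proof -
  let ?f = "\<lambda>x. \<Sum>i<n. \<eta> i x * (norm (grad w (x + \<delta> *\<^sub>R e i)))\<^sup>2" and ?g = "\<lambda>x. \<Sum>i<n. (d i x)\<^sup>2"
  have "integrable lborel ?f"
    using shifted_integrable[of _ 0] by (intro Bochner_Integration.integrable_sum) simp
  then have i: "integrable lborel (\<lambda>x. (1 + \<delta>) * ?f x)"
    "integrable lborel (\<lambda>x. (1 + 1 / \<delta>) * (n * B\<^sup>2 * ?g x))"
    by (rule integrable_mult_right, intro integrable_mult_right d_sq_sum_integrable)
  have "(LINT x|lborel. (norm (grad (pushed \<delta> w) x))\<^sup>2)
      \<le> (LINT x|lborel. (1 + \<delta>) * ?f x + (1 + 1 / \<delta>) * (n * B\<^sup>2 * ?g x))"
    by (rule Bochner_Integration.integral_mono[OF integrable_grad_sq[OF pushed_test]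
          Bochner_Integration.integrable_add[OF i] grad_pushed_sq_le])
  also have "\<dots> = (1 + \<delta>) * (LINT x|lborel. ?f x) + (1 + 1 / \<delta>) * (n * B\<^sup>2 * (LINT x|lborel. ?g x))"
    unfolding Bochner_Integration.integral_add[OF i] by simp
  also have "\<dots> \<le> (1 + \<delta>) * ((1 + n * B * \<delta>) * E) + (1 + 1 / \<delta>) * (n * B\<^sup>2 * (n * (\<delta>\<^sup>2 * E)))"
    using d0 by (intro add_mono mult_left_mono shifted_sum_le d_sq_sum_le) auto
  also have "\<dots> = (1 + \<delta> + n * B * \<delta> + n * B * (\<delta> * \<delta>) + n\<^sup>2 * B\<^sup>2 * (\<delta> * \<delta> + \<delta>)) * E"
    using d0 by (simp add: field_simps power2_eq_square)
  also have "\<dots> \<le> (1 + (1 + 2 * n * B + 2 * n\<^sup>2 * B\<^sup>2) * \<delta>) * E"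
  proof (rule mult_right_mono[OF _ E_nonneg])
    have dd: "\<delta> * \<delta> \<le> \<delta>" using assms d0 by (simp add: mult_left_le)
    have "n * B * (\<delta> * \<delta>) \<le> n * B * \<delta>" using dd B(1) by (intro mult_left_mono) auto
    moreover have "n\<^sup>2 * B\<^sup>2 * (\<delta> * \<delta> + \<delta>) \<le> n\<^sup>2 * B\<^sup>2 * (2 * \<delta>)" using dd by (intro mult_left_mono) auto
    ultimately show "1 + \<delta> + n * B * \<delta> + n * B * (\<delta> * \<delta>) + n\<^sup>2 * B\<^sup>2 * (\<delta> * \<delta> + \<delta>)
        \<le> 1 + (1 + 2 * n * B + 2 * n\<^sup>2 * B\<^sup>2) * \<delta>"
      by (simp add: algebra_simps)
  qed
  finally show ?thesis .
qed

end

end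

text \<open>Packages the construction with constants depending on \<Omega> alone. Shift and
  neighbourhood width stay proportional, so a function supported within distance r of \<Omega> is
  pushed in at cost O(r). One common B is formed from the bounds of the finitely many
  \<eta>_i.\<close>

lemma push_in:
  fixes \<Omega> :: "'a::euclidean_space set"
  assumes "bounded \<Omega>" and lip: "lipschitz_domain \<Omega>"
  obtains C M \<delta>1 :: real where "C > 0" "M \<ge> 1" "\<delta>1 > 0"
    "\<And>\<delta> w. 0 < \<delta> \<Longrightarrow> \<delta> \<le> \<delta>1 \<Longrightarrow> w \<in> test_functions (\<Union>y\<in>\<Omega>. ball y (\<delta> / M)) \<Longrightarrow>
      \<exists>v\<in>test_functions \<Omega>.
        (LINT x|lborel. (v x - w x)\<^sup>2) \<le> C * \<delta>\<^sup>2 * (LINT x|lborel. (norm (grad w x))\<^sup>2) \<and>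
        (LINT x|lborel. (norm (grad v x))\<^sup>2) \<le> (1 + C * \<delta>) * (LINT x|lborel. (norm (grad w x))\<^sup>2)"
proof (rule lipschitz_domain_partition[OF assms])
  fix n :: nat and \<eta> e \<rho> M \<delta>0
  assume part: "\<And>i. \<eta> i \<in> test_functions (UNIV :: 'a set)" "\<And>i x. 0 \<le> \<eta> i x"
    "\<And>x. (\<Sum>i<n. \<eta> i x) \<le> 1" "\<And>x y. y \<in> \<Omega> \<Longrightarrow> dist y x < \<rho> \<Longrightarrow> (\<Sum>i<n. \<eta> i x) = 1"
    "\<And>i. norm (e i) \<le> 1" "\<rho> > 0" "M \<ge> 1" "\<delta>0 > 0"
    "\<And>i \<delta> x y. i < n \<Longrightarrow> 0 < \<delta> \<Longrightarrow> \<delta> \<le> \<delta>0 \<Longrightarrow> x \<in> supp (\<eta> i) \<Longrightarrow> y \<in> \<Omega> \<Longrightarrow>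
      norm (y - (x + \<delta> *\<^sub>R e i)) < \<delta> / M \<Longrightarrow> x \<in> \<Omega>"
  have "\<exists>b>0. (\<forall>x. norm (grad (\<eta> i) x) \<le> b) \<and> (\<forall>x y. \<bar>\<eta> i x - \<eta> i y\<bar> \<le> b * norm (x - y))" for i
  proof -
    obtain b1 where b1: "b1 > 0" "\<And>x. norm (grad (\<eta> i) x) \<le> b1" using grad_bounded[OF part(1)] by blast
    obtain b2 where b2: "b2 > 0" "\<And>x y. \<bar>\<eta> i x - \<eta> i y\<bar> \<le> b2 * norm (x - y)"
      using test_functions_lipschitz[OF part(1)] by blast
    show ?thesis
    proof (intro exI conjI allI)
      show "b1 + b2 > 0" using b1(1) b2(1) by simp
      show "norm (grad (\<eta> i) x) \<le> b1 + b2" for x using b1(2)[of x] b2(1) by simp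
      show "\<bar>\<eta> i x - \<eta> i y\<bar> \<le> (b1 + b2) * norm (x - y)" for x y
        using b2(2)[of x y] b1(1) by (simp add: distrib_right add_increasing)
    qed
  qed
  then obtain b where b: "\<And>i. b i > 0" "\<And>i x. norm (grad (\<eta> i) x) \<le> b i"
    "\<And>i x y. \<bar>\<eta> i x - \<eta> i y\<bar> \<le> b i * norm (x - y)" by metis
  define B where "B = 1 + (\<Sum>i<n. b i)"
  have bB: "b i \<le> B" if "i < n" for i
    using member_le_sum[of i "{..<n}" b] that b(1) by (force simp: B_def less_imp_le)
  have B0: "B > 0" unfolding B_def using b(1) by (intro add_pos_nonneg sum_nonneg) (auto intro: less_imp_le)
  interpret shift_partition \<Omega> n \<eta> e \<rho> M \<delta>0 B
  proof
    show "norm (grad (\<eta> i) x) \<le> B" if "i < n" for i x using b(2)[of i x] bB[OF that] by linarith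
    show "\<bar>\<eta> i x - \<eta> i y\<bar> \<le> B * norm (x - y)" if "i < n" for i x y
      using b(3)[of i x y] mult_right_mono[OF bB[OF that], of "norm (x - y)"] by simp
  qed (fact part B0)+
  \<comment> \<open>The last summand n serves the L2 estimate \<open>pushed_close\<close>, the
    others \<open>pushed_energy\<close>.\<close>
  define C where "C = 1 + 2 * n * B + 2 * n\<^sup>2 * B\<^sup>2 + n"
  have C: "1 + 2 * n * B + 2 * n\<^sup>2 * B\<^sup>2 \<le> C" "real n \<le> C" "C > 0"
    using B0 by (simp_all add: C_def add_nonneg_nonneg add_pos_nonneg)
  show thesis
  proof (rule that[of C M "min \<delta>0 (min \<rho> 1)"])
    show "min \<delta>0 (min \<rho> 1) > 0" using part by simp
    fix \<delta> w assume \<delta>: "0 < \<delta>" "\<delta> \<le> min \<delta>0 (min \<rho> 1)"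
      and w: "w \<in> test_functions (\<Union>y\<in>\<Omega>. ball y (\<delta> / M))"
    let ?E = "LINT x|lborel. (norm (grad w x))\<^sup>2"
    have \<delta>': "\<delta> \<le> \<delta>0" "\<delta> \<le> \<rho>" "\<delta> \<le> 1" using \<delta> by auto
    have E: "0 \<le> ?E" by (intro integral_nonneg_AE) simp
    have "n * (\<delta>\<^sup>2 * ?E) \<le> C * \<delta>\<^sup>2 * ?E"
      unfolding mult.assoc[symmetric] using C E by (intro mult_right_mono) auto
    moreover have "(1 + (1 + 2 * n * B + 2 * n\<^sup>2 * B\<^sup>2) * \<delta>) * ?E \<le> (1 + C * \<delta>) * ?E"
      using C E \<delta>(1) by (intro mult_right_mono add_left_mono) auto
    ultimately show "\<exists>v\<in>test_functions \<Omega>.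
        (LINT x|lborel. (v x - w x)\<^sup>2) \<le> C * \<delta>\<^sup>2 * ?E \<and>
        (LINT x|lborel. (norm (grad v x))\<^sup>2) \<le> (1 + C * \<delta>) * ?E"
      using pushed_test[OF \<delta>(1) \<delta>'(1,2) w] pushed_close[OF \<delta>(1) \<delta>'(1,2) w]
        pushed_energy[OF \<delta>(1) \<delta>'(1,2) w \<delta>'(3)]
      by (intro bexI[of _ "pushed \<delta> w"] conjI) linarith+
  qed (fact C part)+
qed

section \<open>Mollification\<close>

definition conv :: "('a::euclidean_space \<Rightarrow> real) \<Rightarrow> ('a \<Rightarrow> real) \<Rightarrow> 'a \<Rightarrow> real" where
  "conv u \<eta> x = (LINT y|lborel. u y * \<eta> (x - y))"

lemma integrable_scaleR_bounded:
  fixes k :: "'a::euclidean_space \<Rightarrow> 'b::euclidean_space"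
  assumes u: "integrable lborel u" and k: "k \<in> borel_measurable borel" and B: "\<And>z. norm (k z) \<le> B"
  shows "integrable lborel (\<lambda>y. u y *\<^sub>R k (x - y))"
proof (rule Bochner_Integration.integrable_bound)
  show "integrable lborel (\<lambda>y. B * u y)" using u by simp
  note [measurable] = k borel_measurable_integrable[OF u]
  show "(\<lambda>y. u y *\<^sub>R k (x - y)) \<in> borel_measurable lborel" by measurable
  have B0: "B \<ge> 0" using B[of 0] norm_ge_zero[of "k 0"] by linarith
  show "AE y in lborel. norm (u y *\<^sub>R k (x - y)) \<le> norm (B * u y)"
  proof (intro always_eventually allI)
    fix y
    have "norm (u y *\<^sub>R k (x - y)) = norm (k (x - y)) * \<bar>u y\<bar>" by simp
    also have "\<dots> \<le> B * \<bar>u y\<bar>" by (rule mult_right_mono[OF B]) simp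
    also have "\<dots> = norm (B * u y)" using B0 by (simp add: abs_mult)
    finally show "norm (u y *\<^sub>R k (x - y)) \<le> norm (B * u y)" .
  qed
qed

lemma integrable_conv:
  assumes u: "integrable lborel u" and \<eta>: "\<eta> \<in> test_functions A"
  shows "integrable lborel (\<lambda>y. u y * \<eta> (x - y))" "integrable lborel (\<lambda>y. u y *\<^sub>R grad \<eta> (x - y))"
proof -
  obtain B where "\<And>z. \<bar>\<eta> z\<bar> \<le> B" using test_functions_bounded[OF \<eta>] by blast
  then show "integrable lborel (\<lambda>y. u y * \<eta> (x - y))"
    using integrable_scaleR_bounded[OF u test_functions_measurable[OF \<eta>], of B x] by simp
  obtain B where "\<And>z. norm (grad \<eta> z) \<le> B" using grad_bounded[OF \<eta>] by blast
  then show "integrable lborel (\<lambda>y. u y *\<^sub>R grad \<eta> (x - y))"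
    by (rule integrable_scaleR_bounded[OF u grad_measurable[OF \<eta>]])
qed

text \<open>The uniform Taylor estimate for the kernel, integrated against |u|, bounds the
  linearisation error by L |h|^2 times the L1 norm of u. Differentiation under the integral is thus
  quantitative and needs no limit theorem.\<close>

lemma GDERIV_conv:
  assumes u: "integrable lborel u" and \<eta>: "\<eta> \<in> test_functions A"
  shows "GDERIV (conv u \<eta>) x :> (LINT y|lborel. u y *\<^sub>R grad \<eta> (x - y))"
proof -
  define G where "G = (LINT y|lborel. u y *\<^sub>R grad \<eta> (x - y))"
  obtain L where L: "L > 0" "\<And>x h. \<bar>\<eta> (x + h) - \<eta> x - h \<bullet> grad \<eta> x\<bar> \<le> L * (norm h)\<^sup>2"
    using taylor_test_function[OF \<eta>] by blast
  define I where "I = (LINT y|lborel. \<bar>u y\<bar>)"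
  note int = integrable_conv[OF u \<eta>]
  have est: "\<bar>conv u \<eta> (x + h) - conv u \<eta> x - h \<bullet> G\<bar> \<le> L * I * (norm h)\<^sup>2" for h
  proof -
    let ?f = "\<lambda>y. u y * \<eta> (x + h - y) - u y * \<eta> (x - y) - h \<bullet> (u y *\<^sub>R grad \<eta> (x - y))"
    have i3: "integrable lborel (\<lambda>y. h \<bullet> (u y *\<^sub>R grad \<eta> (x - y)))"
      by (intro integrable_inner_right int)
    have "h \<bullet> G = (LINT y|lborel. h \<bullet> (u y *\<^sub>R grad \<eta> (x - y)))"
      unfolding G_def by (rule integral_inner_right[symmetric]) (rule int)
    then have eq: "conv u \<eta> (x + h) - conv u \<eta> x - h \<bullet> G = (LINT y|lborel. ?f y)"
      by (simp only: conv_def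
          Bochner_Integration.integral_diff[OF Bochner_Integration.integrable_diff[OF int(1) int(1)] i3]
          Bochner_Integration.integral_diff[OF int(1) int(1)])
    have "\<bar>conv u \<eta> (x + h) - conv u \<eta> x - h \<bullet> G\<bar> \<le> (LINT y|lborel. \<bar>?f y\<bar>)"
      unfolding eq by (rule integral_abs_bound)
    also have "\<dots> \<le> (LINT y|lborel. L * (norm h)\<^sup>2 * \<bar>u y\<bar>)"
    proof (rule Bochner_Integration.integral_mono)
      show "integrable lborel (\<lambda>y. \<bar>?f y\<bar>)"
        by (intro integrable_abs Bochner_Integration.integrable_diff int i3)
      show "integrable lborel (\<lambda>y. L * (norm h)\<^sup>2 * \<bar>u y\<bar>)"
        by (intro integrable_mult_right integrable_abs u)
      fix y
      have "?f y = u y * (\<eta> (x - y + h) - \<eta> (x - y) - h \<bullet> grad \<eta> (x - y))"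
      proof -
        have "x - y + h = x + h - y" by simp
        then show ?thesis by (simp only: inner_scaleR_right right_diff_distrib)
      qed
      then have "\<bar>?f y\<bar> = \<bar>u y\<bar> * \<bar>\<eta> (x - y + h) - \<eta> (x - y) - h \<bullet> grad \<eta> (x - y)\<bar>"
        by (simp only: abs_mult)
      also have "\<dots> \<le> \<bar>u y\<bar> * (L * (norm h)\<^sup>2)" by (intro mult_left_mono L) simp
      finally show "\<bar>?f y\<bar> \<le> L * (norm h)\<^sup>2 * \<bar>u y\<bar>" by (simp only: mult.commute)
    qed
    also have "\<dots> = L * I * (norm h)\<^sup>2" unfolding I_def integral_mult_right_zero by (rule mult.commute[THEN trans]) (simp only: mult_ac)
    finally show ?thesis .
  qed
  have "((\<lambda>h. norm (conv u \<eta> (x + h) - conv u \<eta> x - h \<bullet> G) / norm h) \<longlongrightarrow> 0) (at 0)"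
  proof (rule Lim_null_comparison)
    show "\<forall>\<^sub>F h in at 0. norm (norm (conv u \<eta> (x + h) - conv u \<eta> x - h \<bullet> G) / norm h) \<le> L * I * norm h"
    proof (intro always_eventually allI)
      fix h
      show "norm (norm (conv u \<eta> (x + h) - conv u \<eta> x - h \<bullet> G) / norm h) \<le> L * I * norm h"
        using est[of h] by (cases "h = 0") (simp_all add: pos_divide_le_eq power2_eq_square mult.assoc)
    qed
    have "((\<lambda>h::'a. L * I * norm h) \<longlongrightarrow> L * I * norm (0::'a)) (at 0)" by (intro tendsto_intros)
    then show "((\<lambda>h::'a. L * I * norm h) \<longlongrightarrow> 0) (at 0)" by simp
  qed
  then show ?thesis
    unfolding gderiv_def has_derivative_at G_def[symmetric]
    by (intro conjI bounded_linear_inner_left)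
qed

lemma Ck_conv:
  assumes u: "integrable lborel u"
  shows "\<eta> \<in> test_functions A \<Longrightarrow> Ck k (conv u \<eta>)"
proof (induction k arbitrary: \<eta>)
  case 0
  show ?case
    unfolding Ck.simps(1)
    by (intro continuous_at_imp_continuous_on ballI GDERIV_imp_isCont[OF GDERIV_conv[OF u 0]])
next
  case (Suc k)
  show ?case
  proof (rule Ck_SucI[OF GDERIV_conv[OF u Suc.prems]])
    fix b :: 'a assume b: "b \<in> Basis"
    have "(LINT y|lborel. u y *\<^sub>R grad \<eta> (x - y)) \<bullet> b = conv u (\<lambda>z. grad \<eta> z \<bullet> b) x" for x
    proof -
      have "(LINT y|lborel. (u y *\<^sub>R grad \<eta> (x - y)) \<bullet> b) = (LINT y|lborel. u y *\<^sub>R grad \<eta> (x - y)) \<bullet> b"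
        by (rule integral_inner_left) (rule integrable_conv[OF u Suc.prems])
      then show ?thesis by (simp add: conv_def)
    qed
    with Suc.IH[OF test_functions_grad[OF Suc.prems b]]
    show "Ck k (\<lambda>x. (LINT y|lborel. u y *\<^sub>R grad \<eta> (x - y)) \<bullet> b)" by simp
  qed
qed

text \<open>One r comes from the radius of the kernel, the other from approximating a point of the
  closure by a point of S; the latter turns the closed neighbourhood into a union of open
  balls.\<close>

lemma conv_test_function:
  fixes u :: "'a::euclidean_space \<Rightarrow> real"
  assumes u: "integrable lborel u" and \<eta>: "\<eta> \<in> test_functions A"
    and supp_u: "\<And>y. u y \<noteq> 0 \<Longrightarrow> y \<in> closure S" and S: "bounded S"
    and supp_\<eta>: "\<And>z. \<eta> z \<noteq> 0 \<Longrightarrow> norm z \<le> r" and r: "r > 0"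
  shows "conv u \<eta> \<in> test_functions (\<Union>y\<in>S. ball y (2 * r))"
proof (rule test_functionsI[OF Ck_conv[OF u \<eta>]])
  let ?K = "{x + y |x y. x \<in> closure S \<and> y \<in> cball 0 r}"
  show "compact ?K" using S by (intro compact_sums) auto
  show "?K \<subseteq> (\<Union>y\<in>S. ball y (2 * r))"
  proof
    fix z assume "z \<in> ?K"
    then obtain a b where ab: "z = a + b" "a \<in> closure S" "norm b \<le> r" by auto
    then obtain y where y: "y \<in> S" "dist y a < r" using r unfolding closure_approachable by blast
    have "dist y z \<le> dist y a + dist a z" by (rule dist_triangle)
    also have "\<dots> < 2 * r" using ab y by (simp add: dist_norm)
    finally show "z \<in> (\<Union>y\<in>S. ball y (2 * r))" using y(1) by auto
  qed
  fix x assume "conv u \<eta> x \<noteq> 0"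
  have "\<exists>y. u y * \<eta> (x - y) \<noteq> 0"
  proof (rule ccontr)
    assume "\<not> ?thesis"
    then have zero: "u y * \<eta> (x - y) = 0" for y by blast
    have "conv u \<eta> x = 0" unfolding conv_def zero by simp
    with \<open>conv u \<eta> x \<noteq> 0\<close> show False by simp
  qed
  then obtain y where "u y \<noteq> 0" "\<eta> (x - y) \<noteq> 0" by auto
  then have "y \<in> closure S" "x - y \<in> cball 0 r" "x = y + (x - y)"
    using supp_u[of y] supp_\<eta>[of "x - y"] by simp_all
  then show "x \<in> ?K" by blast
qed

lemma integral_reflect:
  fixes f :: "'a::euclidean_space \<Rightarrow> 'b::{banach, second_countable_topology}"
  assumes "f \<in> borel_measurable borel"
  shows "(LINT y|lborel. f (x - y)) = (LINT y|lborel. f y)"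
proof -
  have "distr lborel borel (\<lambda>y. x - y) = (lborel :: 'a measure)"
    using lborel_affine[of "-1" x] by (simp add: density_1)
  then have "(LINT y|lborel. f y) = (LINT y|distr lborel borel (\<lambda>y. x - y). f y)" by simp
  also have "\<dots> = (LINT y|lborel. f (x - y))" using assms by (subst integral_distr) auto
  finally show ?thesis by simp
qed

text \<open>For each r the kernel is the bump of radius r divided by its integral. What matters is
  that the bounds r^-n for the kernel and r^(-n-1) for its gradient carry one constant for all r;
  they follow from a lower bound c r^n for the integral.\<close>

lemma mollifier_exists:
  obtains C :: real where "C > 0"
    "\<And>r. r > 0 \<Longrightarrow> \<exists>\<eta>\<in>test_functions (UNIV :: 'a::euclidean_space set). (\<forall>z. \<eta> z \<noteq> 0 \<longrightarrow> norm z \<le> r) \<and>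
      (LINT z|lborel. \<eta> z) = 1 \<and> (\<forall>z. \<bar>\<eta> z\<bar> \<le> C / r ^ DIM('a)) \<and>
      (\<forall>z. norm (grad \<eta> z) \<le> C / r ^ DIM('a) / r)"
proof -
  \<comment> \<open>Within distance r / 2 of the centre the bump is at least exp (-1 / (1 - 1/4)) =
    exp (-4/3), and that half ball has volume (r / 2)^n times the unit ball volume.\<close>
  define c where "c = exp (- (4 / 3)) * unit_ball_vol (real DIM('a)) / 2 ^ DIM('a)"
  have c: "c > 0" unfolding c_def by (simp add: unit_ball_vol_pos)
  obtain C2 where C2: "C2 \<ge> 0" "\<And>x. \<bar>exp_flat 2 x\<bar> \<le> C2"
    using exp_flat_bound[of 0 2] by auto
  define C where "C = (1 + 2 * C2) / c"
  show ?thesis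
  proof (rule that[of C])
    show "C > 0" using c C2 by (simp add: C_def add_pos_nonneg)
    fix r :: real assume r: "r > 0"
    define \<beta> :: "'a \<Rightarrow> real" where "\<beta> = bump 0 r"
    have \<beta>0: "\<beta> z \<noteq> 0 \<Longrightarrow> norm z \<le> r" for z
      using bump_eq_0_iff[OF r, of 0 z] unfolding \<beta>_def by auto
    have \<beta>_test: "\<beta> \<in> test_functions UNIV"
    proof (rule test_functionsI[of _ "cball 0 r"])
      show "Ck k \<beta>" for k unfolding \<beta>_def by (rule Ck_bump)
      show "z \<in> cball 0 r" if "\<beta> z \<noteq> 0" for z using \<beta>0[OF that] by simp
    qed auto
    define I where "I = (LINT z|lborel. \<beta> z)"
    have I: "I \<ge> c * r ^ DIM('a)"
    proof -
      have "c * r ^ DIM('a) = exp (- (4 / 3)) * measure lborel (ball (0::'a) (r / 2))"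
        using r by (simp add: c_def content_ball power_divide)
      also have "\<dots> = (LINT z|lborel. indicator (ball (0::'a) (r / 2)) z * exp (- (4 / 3)))" by simp
      also have "\<dots> \<le> I"
        unfolding I_def
      proof (rule Bochner_Integration.integral_mono)
        show "integrable lborel (\<lambda>z. indicator (ball (0::'a) (r / 2)) z * exp (- (4 / 3)) :: real)"
          by (intro integrable_mult_left integrable_real_indicator emeasure_bounded_finite bounded_ball) simp
        show "integrable lborel \<beta>" by (rule integrable_test_function[OF \<beta>_test])
        fix z :: 'a
        show "indicator (ball 0 (r / 2)) z * exp (- (4 / 3)) \<le> \<beta> z"
        proof (cases "z \<in> ball 0 (r / 2)")
          case True
          then have "(norm z)\<^sup>2 \<le> (r / 2)\<^sup>2" by (intro power_mono) auto
          then have "(norm z)\<^sup>2 / r\<^sup>2 \<le> 1 / 4" using r by (simp add: field_simps power2_eq_square)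
          then have q: "3 / 4 \<le> 1 - (norm z)\<^sup>2 / r\<^sup>2" by simp
          then have "1 / (1 - (norm z)\<^sup>2 / r\<^sup>2) \<le> 1 / (3 / 4)" by (intro divide_left_mono) auto
          moreover have "\<beta> z = exp (- (1 / (1 - (norm z)\<^sup>2 / r\<^sup>2)))"
            unfolding \<beta>_def bump_def exp_flat_def using q by (simp del: diff_le_0_iff_le)
          ultimately show ?thesis using True by simp
        next
          case False
          then show ?thesis using bump_nonneg[of 0 r z] by (simp add: \<beta>_def)
        qed
      qed
      finally show ?thesis .
    qed
    have cr: "c * r ^ DIM('a) > 0" using c r by simp
    with I have I0: "I > 0" by linarith
    define \<eta> where "\<eta> z = inverse I * \<beta> z" for z
    have grad_\<beta>: "GDERIV \<beta> z :> exp_flat 2 (1 - (norm z)\<^sup>2 / r\<^sup>2) *\<^sub>R (- (2 / r\<^sup>2)) *\<^sub>R z" for z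
    proof -
      have "((\<lambda>z. 1 - (norm z)\<^sup>2 / r\<^sup>2) has_derivative (\<lambda>h. h \<bullet> ((- (2 / r\<^sup>2)) *\<^sub>R z))) (at z)"
      proof -
        have "((\<lambda>z. 1 - inverse (r\<^sup>2) * (z \<bullet> z)) has_derivative
            (\<lambda>h. 0 - inverse (r\<^sup>2) * (z \<bullet> h + h \<bullet> z))) (at z)"
          by (rule has_derivative_diff[OF has_derivative_const has_derivative_mult_right[OF
                  has_derivative_inner[OF has_derivative_ident has_derivative_ident]]])
        moreover have "(\<lambda>h. 0 - inverse (r\<^sup>2) * (z \<bullet> h + h \<bullet> z)) = (\<lambda>h. h \<bullet> ((- (2 / r\<^sup>2)) *\<^sub>R z))"
          by (rule ext) (simp add: inner_commute[of z] divide_inverse)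
        moreover have "(\<lambda>z::'a. 1 - inverse (r\<^sup>2) * (z \<bullet> z)) = (\<lambda>z. 1 - (norm z)\<^sup>2 / r\<^sup>2)"
          by (rule ext) (simp add: power2_norm_eq_inner divide_inverse)
        ultimately show ?thesis by (simp only:)
      qed
      then have "GDERIV (\<lambda>z. 1 - (norm z)\<^sup>2 / r\<^sup>2) z :> (- (2 / r\<^sup>2)) *\<^sub>R z" by (simp add: gderiv_def)
      moreover have "DERIV (exp_flat 0) q :> exp_flat 2 q" for q
        using DERIV_exp_flat[of 0 q] by (simp add: numeral_2_eq_2)
      ultimately show ?thesis
        unfolding \<beta>_def bump_def[abs_def] diff_0_right by (rule GDERIV_DERIV_compose)
    qed
    have bound: "inverse I \<le> 1 / (c * r ^ DIM('a))"
      using I cr by (simp add: inverse_eq_divide frac_le)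
    show "\<exists>\<eta>\<in>test_functions (UNIV :: 'a set). (\<forall>z. \<eta> z \<noteq> 0 \<longrightarrow> norm z \<le> r) \<and>
      (LINT z|lborel. \<eta> z) = 1 \<and> (\<forall>z. \<bar>\<eta> z\<bar> \<le> C / r ^ DIM('a)) \<and>
      (\<forall>z. norm (grad \<eta> z) \<le> C / r ^ DIM('a) / r)"
    proof (intro bexI[of _ \<eta>] conjI allI impI)
      show "\<eta> \<in> test_functions UNIV" unfolding \<eta>_def[abs_def] by (rule test_functions_cmult[OF \<beta>_test])
      show "norm z \<le> r" if "\<eta> z \<noteq> 0" for z using that by (intro \<beta>0) (auto simp: \<eta>_def)
      show "(LINT z|lborel. \<eta> z) = 1" using I0 by (simp add: \<eta>_def I_def[symmetric])
      fix z :: 'a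
      have "\<bar>\<eta> z\<bar> \<le> inverse I * 1"
        using I0 bump_nonneg[of 0 r z] bump_le_1[of 0 r z] by (simp add: \<eta>_def \<beta>_def abs_mult mult_left_le)
      also have "\<dots> \<le> 1 / (c * r ^ DIM('a))" using bound by simp
      also have "\<dots> \<le> C / r ^ DIM('a)"
        using c r C2 by (simp add: C_def field_simps)
      finally show "\<bar>\<eta> z\<bar> \<le> C / r ^ DIM('a)" .
      have "grad \<eta> z = inverse I *\<^sub>R exp_flat 2 (1 - (norm z)\<^sup>2 / r\<^sup>2) *\<^sub>R (- (2 / r\<^sup>2)) *\<^sub>R z"
        unfolding \<eta>_def[abs_def] by (intro grad_eqI GDERIV_cmult grad_\<beta>)
      then have "norm (grad \<eta> z) = inverse I * (\<bar>exp_flat 2 (1 - (norm z)\<^sup>2 / r\<^sup>2)\<bar> * (2 / r\<^sup>2 * norm z))"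
        using I0 by (simp add: abs_mult)
      also have "\<dots> \<le> inverse I * (C2 * (2 / r))"
      proof (cases "norm z \<le> r")
        case True
        then have "2 / r\<^sup>2 * norm z \<le> 2 / r\<^sup>2 * r" using r by (intro mult_left_mono) auto
        then have "2 / r\<^sup>2 * norm z \<le> 2 / r" using r by (simp add: power2_eq_square)
        then show ?thesis using I0 C2 r by (intro mult_left_mono mult_mono) auto
      next
        case False
        then have "r\<^sup>2 \<le> (norm z)\<^sup>2" using r by (intro power_mono) auto
        then have "exp_flat 2 (1 - (norm z)\<^sup>2 / r\<^sup>2) = 0" using r by (simp add: exp_flat_def field_simps)
        then show ?thesis using I0 C2 r by simp
      qed
      also have "\<dots> \<le> 1 / (c * r ^ DIM('a)) * (C2 * (2 / r))"
        using bound C2 r by (intro mult_right_mono) auto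
      also have "\<dots> \<le> C / r ^ DIM('a) / r"
        using c r C2 by (simp add: C_def field_simps)
      finally show "norm (grad \<eta> z) \<le> C / r ^ DIM('a) / r" .
    qed
  qed
qed

text \<open>Cauchy-Schwarz on the ball that carries the kernel. Vector values are allowed because
  the estimate is used once for the mollifier and once for its gradient.\<close>

lemma kernel_estimate:
  fixes u :: "'a::euclidean_space \<Rightarrow> real" and k :: "'a \<Rightarrow> 'b::euclidean_space"
  assumes u: "u \<in> borel_measurable borel" "integrable lborel (\<lambda>x. (u x)\<^sup>2)"
    and k: "k \<in> borel_measurable borel" "\<And>z. norm (k z) \<le> B" "\<And>z. k z \<noteq> 0 \<Longrightarrow> norm z \<le> r"
  shows "integrable lborel (\<lambda>y. indicator (cball x r) y * (u x - u y)\<^sup>2)"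
    "(norm (LINT y|lborel. (u y - u x) *\<^sub>R k (x - y)))\<^sup>2
      \<le> B\<^sup>2 * measure lborel (cball x r) * (LINT y|lborel. indicator (cball x r) y * (u x - u y)\<^sup>2)"
proof -
  note [measurable] = u(1) k(1)
  have [measurable]: "cball x r \<in> sets borel" by simp
  let ?I = "\<lambda>y. indicator (cball x r) y :: real"
  let ?g = "\<lambda>y. ?I y * \<bar>u y - u x\<bar>"
  have iI: "integrable lborel ?I"
    by (intro integrable_real_indicator emeasure_bounded_finite bounded_cball) simp
  have "integrable lborel (\<lambda>y. 2 * (u x)\<^sup>2 * ?I y + 2 * (u y)\<^sup>2)"
    by (intro Bochner_Integration.integrable_add integrable_mult_right iI u)
  then show int: "integrable lborel (\<lambda>y. ?I y * (u x - u y)\<^sup>2)"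
  proof (rule Bochner_Integration.integrable_bound)
    have "(u x - u y)\<^sup>2 \<le> 2 * (u x)\<^sup>2 + 2 * (u y)\<^sup>2" for y
      using zero_le_power2[of "u x + u y"] by (simp add: power2_eq_square algebra_simps)
    then show "AE y in lborel. norm (?I y * (u x - u y)\<^sup>2) \<le> norm (2 * (u x)\<^sup>2 * ?I y + 2 * (u y)\<^sup>2)"
      by (intro always_eventually allI) (auto simp: indicator_def)
    show "(\<lambda>y. ?I y * (u x - u y)\<^sup>2) \<in> borel_measurable lborel" by measurable
  qed
  have g2: "(norm (?g y))\<^sup>2 = ?I y * (u x - u y)\<^sup>2" for y
    by (simp add: indicator_def power2_commute)
  have I2: "(norm (?I y))\<^sup>2 = ?I y" for y by (simp add: indicator_def)
  have sqI: "sq_int lborel ?I"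
    unfolding sq_int_def I2 using iI borel_measurable_integrable by blast
  have "?g \<in> borel_measurable lborel" by measurable
  then have sqg: "sq_int lborel ?g" unfolding sq_int_def g2 using int by blast
  have "norm (LINT y|lborel. (u y - u x) *\<^sub>R k (x - y)) \<le> (LINT y|lborel. B * (?I y \<bullet> ?g y))"
  proof (rule order_trans[OF integral_norm_bound])
    have B0: "0 \<le> B" using k(2)[of 0] norm_ge_zero[of "k 0"] by linarith
    show "(LINT y|lborel. norm ((u y - u x) *\<^sub>R k (x - y))) \<le> (LINT y|lborel. B * (?I y \<bullet> ?g y))"
    proof (rule integral_mono')
      show "integrable lborel (\<lambda>y. B * (?I y \<bullet> ?g y))"
        by (intro integrable_mult_right sq_int_inner sqI sqg)
      show "0 \<le> B * (?I y \<bullet> ?g y)" for y using B0 by simp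
      show "norm ((u y - u x) *\<^sub>R k (x - y)) \<le> B * (?I y \<bullet> ?g y)" for y
      proof (cases "y \<in> cball x r")
        case True
        then show ?thesis using mult_left_mono[OF k(2)[of "x - y"], of "\<bar>u y - u x\<bar>"]
          by (simp add: mult.commute)
      next
        case False
        then have "k (x - y) = 0" using k(3)[of "x - y"] by (auto simp: dist_norm)
        with False show ?thesis by simp
      qed
    qed
  qed
  also have "\<dots> = B * ip lborel ?I ?g" by (simp add: ip_def)
  finally have "(norm (LINT y|lborel. (u y - u x) *\<^sub>R k (x - y)))\<^sup>2 \<le> (B * ip lborel ?I ?g)\<^sup>2"
    by (intro power_mono) auto
  also have "\<dots> = B\<^sup>2 * (ip lborel ?I ?g)\<^sup>2" by (rule power_mult_distrib)
  also have "\<dots> \<le> B\<^sup>2 * (ip lborel ?I ?I * ip lborel ?g ?g)"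
    by (intro mult_left_mono ip_Cauchy_Schwarz sqI sqg) simp
  also have "ip lborel ?I ?I = measure lborel (cball x r)"
    unfolding ip_self I2 by simp
  also have "ip lborel ?g ?g = (LINT y|lborel. ?I y * (u x - u y)\<^sup>2)"
    unfolding ip_self g2 ..
  finally show "(norm (LINT y|lborel. (u y - u x) *\<^sub>R k (x - y)))\<^sup>2
      \<le> B\<^sup>2 * measure lborel (cball x r) * (LINT y|lborel. ?I y * (u x - u y)\<^sup>2)"
    by (simp only: mult.assoc)
qed

lemma integrable_reflect:
  fixes f :: "'a::euclidean_space \<Rightarrow> 'b::{banach, second_countable_topology}"
  assumes "integrable lborel f"
  shows "integrable lborel (\<lambda>y. f (x - y))"
proof -
  have "distr lborel borel (\<lambda>y. x - y) = (lborel :: 'a measure)"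
    using lborel_affine[of "-1" x] by (simp add: density_1)
  then have "integrable (distr lborel borel (\<lambda>y. x - y)) f" using assms by simp
  then show ?thesis using borel_measurable_integrable[OF assms] by (subst (asm) integrable_distr_eq) auto
qed

text \<open>The numerator of the Gagliardo integrand restricted to pairs at distance at most r.
  Integration over r against a power restores the denominator, see
  \<open>nn_integral_near_diff\<close>.\<close>

definition near_diff :: "real \<Rightarrow> ('a::euclidean_space \<Rightarrow> real) \<Rightarrow> ennreal" where
  "near_diff r u = (\<integral>\<^sup>+x. \<integral>\<^sup>+y. ennreal (indicator (cball x r) y * (u x - u y)\<^sup>2) \<partial>lborel \<partial>lborel)"

lemma measurable_near_diff:
  assumes [measurable]: "u \<in> borel_measurable borel"
  shows "(\<lambda>(x, y). ennreal (indicator (cball x r) y * (u x - u y)\<^sup>2))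
    \<in> borel_measurable (borel \<Otimes>\<^sub>M (borel :: 'a::euclidean_space measure))"
proof -
  have "(\<lambda>(x::'a, y). ennreal (indicator (cball x r) y * (u x - u y)\<^sup>2))
      = (\<lambda>(x, y). if dist x y \<le> r then ennreal ((u x - u y)\<^sup>2) else 0)"
    by (auto simp: indicator_def fun_eq_iff)
  also have "\<dots> \<in> borel_measurable (borel \<Otimes>\<^sub>M borel)" by measurable
  finally show ?thesis .
qed

text \<open>Since \<eta> has integral 1 and grad \<eta> integral 0, both v - u and grad v are
  integrals of u(y) - u(x) against a kernel, so \<open>kernel_estimate\<close> applies to both. The
  squared kernel bound r^(-2n) times the ball volume r^n leaves r^-n; the extra r^-2 of the gradient
  is compensated by the factor r^2. Adding the two equal bounds gives the 2 in the constant.\<close>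

lemma mollification:
  obtains C :: real where "C > 0"
    "\<And>(u :: 'a::euclidean_space \<Rightarrow> real) S r. r > 0 \<Longrightarrow> bounded S \<Longrightarrow> u \<in> borel_measurable borel \<Longrightarrow>
      integrable lborel (\<lambda>x. (u x)\<^sup>2) \<Longrightarrow> (\<And>y. u y \<noteq> 0 \<Longrightarrow> y \<in> closure S) \<Longrightarrow>
      \<exists>v\<in>test_functions (\<Union>y\<in>S. ball y (2 * r)).
        ennreal ((LINT x|lborel. (v x - u x)\<^sup>2) + r\<^sup>2 * (LINT x|lborel. (norm (grad v x))\<^sup>2))
          \<le> ennreal (C / r ^ DIM('a)) * near_diff r u"
proof (rule mollifier_exists[where 'a = 'a])
  fix C0 :: real assume C0: "C0 > 0"
    and moll: "\<And>r. r > 0 \<Longrightarrow> \<exists>\<eta>\<in>test_functions (UNIV :: 'a set). (\<forall>z. \<eta> z \<noteq> 0 \<longrightarrow> norm z \<le> r) \<and>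
      (LINT z|lborel. \<eta> z) = 1 \<and> (\<forall>z. \<bar>\<eta> z\<bar> \<le> C0 / r ^ DIM('a)) \<and>
      (\<forall>z. norm (grad \<eta> z) \<le> C0 / r ^ DIM('a) / r)"
  define U where "U = unit_ball_vol (real DIM('a))"
  have U: "U > 0" unfolding U_def by simp
  show thesis
  proof (rule that[of "2 * C0\<^sup>2 * U"])
    show "2 * C0\<^sup>2 * U > 0" using C0 U by simp
    fix u :: "'a \<Rightarrow> real" and S and r :: real
    assume r: "r > 0" and S: "bounded S" and u: "u \<in> borel_measurable borel"
      "integrable lborel (\<lambda>x. (u x)\<^sup>2)" and supp_u: "\<And>y. u y \<noteq> 0 \<Longrightarrow> y \<in> closure S"
    obtain \<eta> where \<eta>: "\<eta> \<in> test_functions (UNIV :: 'a set)" "\<And>z. \<eta> z \<noteq> 0 \<Longrightarrow> norm z \<le> r"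
      "(LINT z|lborel. \<eta> z) = 1" "\<And>z. norm (\<eta> z) \<le> C0 / r ^ DIM('a)"
      "\<And>z. norm (grad \<eta> z) \<le> C0 / r ^ DIM('a) / r"
      using moll[OF r] by auto
    have ui: "integrable lborel u"
    proof (rule Bochner_Integration.integrable_bound)
      show "integrable lborel (\<lambda>x. indicator (closure S) x + (u x)\<^sup>2)"
        using S by (intro Bochner_Integration.integrable_add u integrable_real_indicator
            emeasure_bounded_finite) auto
      show "u \<in> borel_measurable lborel" using u(1) by simp
      have "\<bar>a\<bar> \<le> 1 + a\<^sup>2" for a :: real using mult_le_sum_squares[of 1 a] by simp
      then show "AE x in lborel. norm (u x) \<le> norm (indicator (closure S) x + (u x)\<^sup>2)"
      proof (intro always_eventually allI)
        fix x
        show "norm (u x) \<le> norm (indicator (closure S) x + (u x)\<^sup>2)"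
          using supp_u[of x] \<open>\<And>a. \<bar>a\<bar> \<le> 1 + a\<^sup>2\<close>[of "u x"] by (cases "u x = 0") auto
      qed
    qed
    define v where "v = conv u \<eta>"
    have v: "v \<in> test_functions (\<Union>y\<in>S. ball y (2 * r))"
      unfolding v_def by (rule conv_test_function[OF ui \<eta>(1) supp_u S \<eta>(2) r])
    define W where "W x = (LINT y|lborel. indicator (cball x r) y * (u x - u y)\<^sup>2)" for x
    have vol: "measure lborel (cball x r) = U * r ^ DIM('a)" for x :: 'a
      unfolding U_def using r by (intro content_cball) simp
    have 1: "(v x - u x)\<^sup>2 \<le> C0\<^sup>2 * U / r ^ DIM('a) * W x" for x
    proof -
      have i: "integrable lborel (\<lambda>y. u x * \<eta> (x - y))"
        by (intro integrable_mult_right integrable_reflect integrable_test_function[OF \<eta>(1)])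
      have "(LINT y|lborel. (u y - u x) *\<^sub>R \<eta> (x - y)) = (LINT y|lborel. u y * \<eta> (x - y) - u x * \<eta> (x - y))"
        by (simp add: left_diff_distrib)
      also have "\<dots> = v x - u x * (LINT y|lborel. \<eta> (x - y))"
        unfolding Bochner_Integration.integral_diff[OF integrable_conv(1)[OF ui \<eta>(1)] i] v_def conv_def by simp
      also have "(LINT y|lborel. \<eta> (x - y)) = 1"
        using integral_reflect[OF test_functions_measurable[OF \<eta>(1)]] \<eta>(3) by simp
      finally have eq: "(LINT y|lborel. (u y - u x) *\<^sub>R \<eta> (x - y)) = v x - u x" by simp
      have "(norm (LINT y|lborel. (u y - u x) *\<^sub>R \<eta> (x - y)))\<^sup>2
          \<le> (C0 / r ^ DIM('a))\<^sup>2 * measure lborel (cball x r) * W x"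
        unfolding W_def by (rule kernel_estimate(2)[OF u test_functions_measurable[OF \<eta>(1)] \<eta>(4) \<eta>(2)])
      then show ?thesis
        unfolding eq vol using r by (simp add: power_divide power2_eq_square)
    qed
    have 2: "r\<^sup>2 * (norm (grad v x))\<^sup>2 \<le> C0\<^sup>2 * U / r ^ DIM('a) * W x" for x
    proof -
      have i: "integrable lborel (\<lambda>y. u x *\<^sub>R grad \<eta> (x - y))"
        by (intro integrable_scaleR_right integrable_reflect integrable_grad[OF \<eta>(1)])
      have "(LINT y|lborel. (u y - u x) *\<^sub>R grad \<eta> (x - y))
          = (LINT y|lborel. u y *\<^sub>R grad \<eta> (x - y) - u x *\<^sub>R grad \<eta> (x - y))"
        by (simp add: scaleR_diff_left)
      also have "\<dots> = grad v x - u x *\<^sub>R (LINT y|lborel. grad \<eta> (x - y))"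
        unfolding Bochner_Integration.integral_diff[OF integrable_conv(2)[OF ui \<eta>(1)] i] v_def
          grad_eqI[OF GDERIV_conv[OF ui \<eta>(1)]] by simp
      also have "(LINT y|lborel. grad \<eta> (x - y)) = 0"
        using integral_reflect[OF grad_measurable[OF \<eta>(1)]] integral_grad_eq_0[OF \<eta>(1)] by simp
      finally have eq: "(LINT y|lborel. (u y - u x) *\<^sub>R grad \<eta> (x - y)) = grad v x" by simp
      have "norm z \<le> r" if "grad \<eta> z \<noteq> 0" for z
      proof -
        have "supp \<eta> \<subseteq> cball 0 r"
          unfolding supp_def using \<eta>(2) by (intro closure_minimal) auto
        then show ?thesis using in_supp_grad[OF \<eta>(1) that] by auto
      qed
      then have "(norm (LINT y|lborel. (u y - u x) *\<^sub>R grad \<eta> (x - y)))\<^sup>2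
          \<le> (C0 / r ^ DIM('a) / r)\<^sup>2 * measure lborel (cball x r) * W x"
        unfolding W_def by (rule kernel_estimate(2)[OF u grad_measurable[OF \<eta>(1)] \<eta>(5)])
      then have "r\<^sup>2 * (norm (grad v x))\<^sup>2 \<le> r\<^sup>2 * ((C0 / r ^ DIM('a) / r)\<^sup>2 * (U * r ^ DIM('a)) * W x)"
        unfolding eq vol by (intro mult_left_mono) auto
      then show ?thesis using r by (simp add: power_divide power2_eq_square)
    qed
    have sq: "sq_int lborel v" "sq_int lborel u"
      using integrable_test_function_sq[OF v] test_functions_measurable[OF v] u
      by (simp_all add: sq_int_def)
    have i1: "integrable lborel (\<lambda>x. (v x - u x)\<^sup>2)" using sq_int_diff[OF sq] by (simp add: sq_int_def)
    have i2: "integrable lborel (\<lambda>x. r\<^sup>2 * (norm (grad v x))\<^sup>2)"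
      by (intro integrable_mult_right integrable_grad_sq[OF v])
    have W: "ennreal (W x) = (\<integral>\<^sup>+y. ennreal (indicator (cball x r) y * (u x - u y)\<^sup>2) \<partial>lborel)" for x
      unfolding W_def
      by (rule nn_integral_eq_integral[symmetric])
        (use kernel_estimate(1)[OF u test_functions_measurable[OF \<eta>(1)] \<eta>(4) \<eta>(2)] in auto)
    have zero_le_factor: "0 \<le> 2 * C0\<^sup>2 * U / r ^ DIM('a)" using r U by simp
    have "ennreal ((LINT x|lborel. (v x - u x)\<^sup>2) + r\<^sup>2 * (LINT x|lborel. (norm (grad v x))\<^sup>2))
        = ennreal (LINT x|lborel. (v x - u x)\<^sup>2 + r\<^sup>2 * (norm (grad v x))\<^sup>2)"
      unfolding Bochner_Integration.integral_add[OF i1 i2] by simp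
    also have "\<dots> = (\<integral>\<^sup>+x. ennreal ((v x - u x)\<^sup>2 + r\<^sup>2 * (norm (grad v x))\<^sup>2) \<partial>lborel)"
      by (rule nn_integral_eq_integral[symmetric, OF Bochner_Integration.integrable_add[OF i1 i2]]) simp
    also have "(\<integral>\<^sup>+x. ennreal ((v x - u x)\<^sup>2 + r\<^sup>2 * (norm (grad v x))\<^sup>2) \<partial>lborel)
        \<le> (\<integral>\<^sup>+x. ennreal (2 * C0\<^sup>2 * U / r ^ DIM('a)) * ennreal (W x) \<partial>lborel)"
    proof (rule nn_integral_mono)
      fix x
      have "(v x - u x)\<^sup>2 + r\<^sup>2 * (norm (grad v x))\<^sup>2 \<le> 2 * C0\<^sup>2 * U / r ^ DIM('a) * W x"
      proof -
        have "C0\<^sup>2 * U / r ^ DIM('a) * W x + C0\<^sup>2 * U / r ^ DIM('a) * W x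
            = 2 * C0\<^sup>2 * U / r ^ DIM('a) * W x" by simp
        with add_mono[OF 1[of x] 2[of x]] show ?thesis by (simp only:)
      qed
      then show "ennreal ((v x - u x)\<^sup>2 + r\<^sup>2 * (norm (grad v x))\<^sup>2)
          \<le> ennreal (2 * C0\<^sup>2 * U / r ^ DIM('a)) * ennreal (W x)"
        unfolding ennreal_mult'[symmetric, OF zero_le_factor] by (rule ennreal_leI)
    qed
    also have "\<dots> = ennreal (2 * C0\<^sup>2 * U / r ^ DIM('a)) * near_diff r u"
      unfolding W near_diff_def
    proof (rule nn_integral_cmult)
      have "(\<lambda>(x, y). ennreal (indicator (cball x r) y * (u x - u y)\<^sup>2)) \<in> borel_measurable (lborel \<Otimes>\<^sub>M lborel)"
        using measurable_near_diff[OF u(1), of r] by (simp cong: measurable_cong_sets)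
      then show "(\<lambda>x. \<integral>\<^sup>+y. ennreal (indicator (cball x r) y * (u x - u y)\<^sup>2) \<partial>lborel) \<in> borel_measurable lborel"
        by (rule lborel.borel_measurable_nn_integral)
    qed
    finally show "\<exists>v\<in>test_functions (\<Union>y\<in>S. ball y (2 * r)).
        ennreal ((LINT x|lborel. (v x - u x)\<^sup>2) + r\<^sup>2 * (LINT x|lborel. (norm (grad v x))\<^sup>2))
          \<le> ennreal (2 * C0\<^sup>2 * U / r ^ DIM('a)) * near_diff r u"
      using v by blast
  qed
qed

section \<open>Comparison of the K-functionals\<close>

lemma L2_triangle_sq:
  fixes u v w :: "'a \<Rightarrow> real"
  assumes sq: "sq_int M u" "sq_int M v" "sq_int M w" and d: "\<delta> > 0"
  shows "(LINT x|M. (u x - v x)\<^sup>2) \<le> (1 + \<delta>) * (LINT x|M. (u x - w x)\<^sup>2) + (1 + 1 / \<delta>) * (LINT x|M. (v x - w x)\<^sup>2)"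
proof -
  have int: "integrable M (\<lambda>x. (f x - g x)\<^sup>2)" if "sq_int M f" "sq_int M g" for f g :: "'a \<Rightarrow> real"
    using sq_int_diff[OF that] by (simp add: sq_int_def)
  have i: "integrable M (\<lambda>x. (1 + \<delta>) * (u x - w x)\<^sup>2)" "integrable M (\<lambda>x. (1 + 1 / \<delta>) * (v x - w x)\<^sup>2)"
    by (intro integrable_mult_right int sq)+
  have "(LINT x|M. (u x - v x)\<^sup>2) \<le> (LINT x|M. (1 + \<delta>) * (u x - w x)\<^sup>2 + (1 + 1 / \<delta>) * (v x - w x)\<^sup>2)"
  proof (rule Bochner_Integration.integral_mono[OF int[OF sq(1,2)] Bochner_Integration.integrable_add[OF i]])
    show "(u x - v x)\<^sup>2 \<le> (1 + \<delta>) * (u x - w x)\<^sup>2 + (1 + 1 / \<delta>) * (v x - w x)\<^sup>2" for x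
      using norm_add_sq_le[OF d, of "u x - w x" "w x - v x"] by (simp add: power2_commute)
  qed
  also have "\<dots> = (1 + \<delta>) * (LINT x|M. (u x - w x)\<^sup>2) + (1 + 1 / \<delta>) * (LINT x|M. (v x - w x)\<^sup>2)"
    unfolding Bochner_Integration.integral_add[OF i] by simp
  finally show ?thesis .
qed

text \<open>For u vanishing off A the energy no longer depends on A; this makes energies on nested
  domains literally equal.\<close>

lemma energy_eq_whole_space:
  assumes "\<And>x. x \<notin> A \<Longrightarrow> u x = 0" and w: "w \<in> test_functions A"
  shows "energy A t u w = (LINT x|lborel. (u x - w x)\<^sup>2) + t * (LINT x|lborel. (norm (grad w x))\<^sup>2)"
proof -
  have "indicator A x *\<^sub>R (u x - w x)\<^sup>2 = (u x - w x)\<^sup>2" for x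
    using assms(1)[of x] test_functions_eq_0[OF w, of x] by (cases "x \<in> A") auto
  then show ?thesis unfolding energy_def set_lebesgue_integral_def by (simp only:)
qed

lemma sq_int_lborel_L2_on:
  assumes "sq_int lborel u" "A \<in> sets borel" shows "u \<in> L2_on A"
proof -
  have [measurable]: "u \<in> borel_measurable borel" "A \<in> sets borel" using assms by (auto simp: sq_int_def)
  show ?thesis
    using integrable_mult_indicator[of A lborel "\<lambda>x. (norm (u x))\<^sup>2"] assms
    by (auto simp: L2_on_def set_borel_measurable_lborel_iff set_integrable_def sq_int_def)
qed

lemma test_functions_sq_int: "w \<in> test_functions A \<Longrightarrow> sq_int lborel w"
  using integrable_test_function_sq[of w A] test_functions_measurable[of w A] by (simp add: sq_int_def)

lemma K_fun_antimono:
  assumes A: "open A" "dirichlet_eigenbasis A \<mu> \<phi>" and B: "open B" "dirichlet_eigenbasis B \<nu> \<psi>"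
    and AB: "A \<subseteq> B" and u: "sq_int lborel u" "\<And>x. x \<notin> A \<Longrightarrow> u x = 0" and t: "t > 0"
  shows "K_fun B \<nu> \<psi> t u \<le> K_fun A \<mu> \<phi> t u"
proof (rule ennreal_le_epsilon)
  fix e :: real assume e: "e > 0"
  have uL: "u \<in> L2_on A" "u \<in> L2_on B" using sq_int_lborel_L2_on[OF u(1)] A B by auto
  obtain w where w: "w \<in> test_functions A" "ennreal (energy A t u w) \<le> K_fun A \<mu> \<phi> t u + ennreal e"
    using energy_le_K_fun[OF A uL(1) t e] by blast
  have wB: "w \<in> test_functions B" by (rule test_functions_mono[OF AB w(1)])
  have uB: "x \<notin> B \<Longrightarrow> u x = 0" for x using u(2) AB by blast
  have "K_fun B \<nu> \<psi> t u \<le> ennreal (energy B t u w)" by (rule K_fun_le_energy[OF B uL(2) wB t])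
  also have "energy B t u w = energy A t u w"
    by (rule trans[OF energy_eq_whole_space[OF uB wB] energy_eq_whole_space[OF u(2) w(1), symmetric]])
  finally show "K_fun B \<nu> \<psi> t u \<le> K_fun A \<mu> \<phi> t u + ennreal e" using w(2) by (rule order_trans)
qed

text \<open>The competitor w = 0. The bound does not depend on t and controls the K-functional for
  large t.\<close>

lemma K_fun_finite:
  assumes A: "open A" "dirichlet_eigenbasis A \<mu> \<phi>" and u: "u \<in> L2_on A" and t: "t > 0"
  shows "K_fun A \<mu> \<phi> t u \<le> ennreal (LINT x:A|lborel. (u x)\<^sup>2)"
proof -
  have "grad (\<lambda>x::'a. 0) x = 0" for x by (rule grad_eqI) (rule GDERIV_const)
  then show ?thesis
    using K_fun_le_energy[OF A u test_functions_zero t] by (simp add: energy_def)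
qed

text \<open>A near minimiser for A is pushed into \<Omega>. The L2 error is measured by E, the
  Dirichlet integral of w, whereas the energy contains only t E, so the constant blows up like 1 /
  t. This is harmless here, because t stays fixed while r tends to 0.\<close>

lemma K_fun_le_K_fun_neighbourhood:
  fixes \<Omega> :: "'a::euclidean_space set"
  assumes "bounded \<Omega>" "lipschitz_domain \<Omega>" and eb: "dirichlet_eigenbasis \<Omega> \<mu> \<phi>"
    and u: "sq_int lborel u" "\<And>x. x \<notin> \<Omega> \<Longrightarrow> u x = 0" and t: "t > 0"
  obtains C r0 where "C > 0" "r0 > 0"
    "\<And>r A \<nu> \<psi>. 0 < r \<Longrightarrow> r \<le> r0 \<Longrightarrow> open A \<Longrightarrow> dirichlet_eigenbasis A \<nu> \<psi> \<Longrightarrow> \<Omega> \<subseteq> A \<Longrightarrow>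
      A \<subseteq> (\<Union>y\<in>\<Omega>. ball y r) \<Longrightarrow> K_fun \<Omega> \<mu> \<phi> t u \<le> ennreal (1 + C * r) * K_fun A \<nu> \<psi> t u"
proof (rule push_in[OF assms(1,2)])
  fix C M \<delta>1 :: real
  assume C: "C > 0" and M: "M \<ge> 1" and \<delta>1: "\<delta>1 > 0"
    and push: "\<And>\<delta> w. 0 < \<delta> \<Longrightarrow> \<delta> \<le> \<delta>1 \<Longrightarrow> w \<in> test_functions (\<Union>y\<in>\<Omega>. ball y (\<delta> / M)) \<Longrightarrow>
      \<exists>v\<in>test_functions \<Omega>.
        (LINT x|lborel. (v x - w x)\<^sup>2) \<le> C * \<delta>\<^sup>2 * (LINT x|lborel. (norm (grad w x))\<^sup>2) \<and>
        (LINT x|lborel. (norm (grad v x))\<^sup>2) \<le> (1 + C * \<delta>) * (LINT x|lborel. (norm (grad w x))\<^sup>2)"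
  have \<Omega>: "open \<Omega>" using assms(2) by (simp add: lipschitz_domain_def open_domain_def)
  \<comment> \<open>The factor M converts the neighbourhood width r into the shift \<delta> = r
    M.\<close>
  define C' where "C' = (1 + C + 2 * C / t) * M"
  show thesis
  proof (rule that[of C' "min \<delta>1 1 / M"])
    show "C' > 0" using C M t by (simp add: C'_def add_pos_pos)
    show "min \<delta>1 1 / M > 0" using \<delta>1 M by simp
    fix r A \<nu> \<psi>
    assume r: "0 < r" "r \<le> min \<delta>1 1 / M" and A: "open A" "dirichlet_eigenbasis A \<nu> \<psi>"
      and \<Omega>A: "\<Omega> \<subseteq> A" and near: "A \<subseteq> (\<Union>y\<in>\<Omega>. ball y r)"
    define \<delta> where "\<delta> = r * M"
    have \<delta>: "0 < \<delta>" "\<delta> \<le> \<delta>1" "\<delta> \<le> 1" "\<delta> / M = r"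
      using r M by (auto simp: \<delta>_def pos_le_divide_eq)
    have uA: "x \<notin> A \<Longrightarrow> u x = 0" for x using u(2) \<Omega>A by blast
    have uL: "u \<in> L2_on \<Omega>" "u \<in> L2_on A" using sq_int_lborel_L2_on[OF u(1)] \<Omega> A by auto
    have C'r: "0 \<le> C' * r" using C M t r by (simp add: C'_def)
    show "K_fun \<Omega> \<mu> \<phi> t u \<le> ennreal (1 + C' * r) * K_fun A \<nu> \<psi> t u"
    proof (rule ennreal_le_epsilon)
      fix e :: real assume e: "e > 0"
      \<comment> \<open>Scaled so that after multiplication by 1 + C' r exactly e remains.\<close>
      define e' where "e' = e / (1 + C' * r)"
      have e': "e' > 0" "(1 + C' * r) * e' = e" using e C'r by (auto simp: e'_def)
      obtain w where w: "w \<in> test_functions A" "ennreal (energy A t u w) \<le> K_fun A \<nu> \<psi> t u + ennreal e'"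
        using energy_le_K_fun[OF A uL(2) t e'(1)] by blast
      define N where "N = (LINT x|lborel. (u x - w x)\<^sup>2)"
      define E where "E = (LINT x|lborel. (norm (grad w x))\<^sup>2)"
      have NE: "0 \<le> N" "0 \<le> E" unfolding N_def E_def by (auto intro: integral_nonneg_AE)
      have "w \<in> test_functions (\<Union>y\<in>\<Omega>. ball y (\<delta> / M))"
        unfolding \<delta>(4) by (rule test_functions_mono[OF near w(1)])
      from push[OF \<delta>(1,2) this] obtain v where v: "v \<in> test_functions \<Omega>"
        "(LINT x|lborel. (v x - w x)\<^sup>2) \<le> C * \<delta>\<^sup>2 * E"
        "(LINT x|lborel. (norm (grad v x))\<^sup>2) \<le> (1 + C * \<delta>) * E"
        unfolding E_def by blast
      have "energy \<Omega> t u v = (LINT x|lborel. (u x - v x)\<^sup>2) + t * (LINT x|lborel. (norm (grad v x))\<^sup>2)"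
        by (rule energy_eq_whole_space[OF u(2) v(1)])
      also have "\<dots> \<le> ((1 + \<delta>) * N + (1 + 1 / \<delta>) * (C * \<delta>\<^sup>2 * E)) + t * ((1 + C * \<delta>) * E)"
      proof (intro add_mono mult_left_mono v(3))
        have "(LINT x|lborel. (u x - v x)\<^sup>2) \<le> (1 + \<delta>) * N + (1 + 1 / \<delta>) * (LINT x|lborel. (v x - w x)\<^sup>2)"
          unfolding N_def
          by (intro L2_triangle_sq u(1) \<delta>(1) test_functions_sq_int[OF v(1)] test_functions_sq_int[OF w(1)])
        also have "\<dots> \<le> (1 + \<delta>) * N + (1 + 1 / \<delta>) * (C * \<delta>\<^sup>2 * E)"
          using \<delta>(1) by (intro add_left_mono mult_left_mono v(2)) auto
        finally show "(LINT x|lborel. (u x - v x)\<^sup>2) \<le> (1 + \<delta>) * N + (1 + 1 / \<delta>) * (C * \<delta>\<^sup>2 * E)" .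
      qed (use t in auto)
      also have "\<dots> \<le> (1 + (1 + C + 2 * C / t) * \<delta>) * (N + t * E)"
      proof -
        have "(1 + 1 / \<delta>) * (C * \<delta>\<^sup>2 * E) = C * E * (\<delta> * \<delta> + \<delta>)"
          using \<delta>(1) by (simp add: field_simps power2_eq_square)
        also have "\<dots> \<le> C * E * (2 * \<delta>)"
          using \<delta> C NE mult_left_le[of \<delta> \<delta>] by (intro mult_left_mono) auto
        also have "\<dots> = 2 * C / t * \<delta> * (t * E)" using t by simp
        finally have 1: "(1 + 1 / \<delta>) * (C * \<delta>\<^sup>2 * E) \<le> 2 * C / t * \<delta> * (t * E)" .
        define X where "X = (1 + 1 / \<delta>) * (C * \<delta>\<^sup>2 * E)"
        define K where "K = 2 * C / t"
        define T where "T = t * E"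
        have 2: "0 \<le> C * \<delta> * N" "0 \<le> K * \<delta> * N" "0 \<le> \<delta> * T"
          using C \<delta> NE t by (simp_all add: K_def T_def)
        have 3: "t * ((1 + C * \<delta>) * E) = (1 + C * \<delta>) * T" by (simp add: T_def)
        show ?thesis
          using 1 2 unfolding X_def[symmetric] K_def[symmetric] 3 T_def[symmetric]
          by (simp add: algebra_simps)
      qed
      also have "(1 + C + 2 * C / t) * \<delta> = C' * r" by (simp add: C'_def \<delta>_def)
      also have "N + t * E = energy A t u w"
        unfolding N_def E_def by (rule energy_eq_whole_space[OF uA w(1), symmetric])
      finally have le: "energy \<Omega> t u v \<le> (1 + C' * r) * energy A t u w" .
      have "K_fun \<Omega> \<mu> \<phi> t u \<le> ennreal (energy \<Omega> t u v)" by (rule K_fun_le_energy[OF \<Omega> eb uL(1) v(1) t])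
      also have "\<dots> \<le> ennreal ((1 + C' * r) * energy A t u w)" by (rule ennreal_leI[OF le])
      also have "\<dots> = ennreal (1 + C' * r) * ennreal (energy A t u w)"
        using C'r energy_nonneg[of t A u w] t by (intro ennreal_mult) auto
      also have "\<dots> \<le> ennreal (1 + C' * r) * (K_fun A \<nu> \<psi> t u + ennreal e')"
        by (intro mult_left_mono w(2)) simp
      also have "\<dots> = ennreal (1 + C' * r) * K_fun A \<nu> \<psi> t u + ennreal e"
      proof -
        have "ennreal (1 + C' * r) * ennreal e' = ennreal e"
          using C'r e' by (subst ennreal_mult[symmetric]) auto
        then show ?thesis by (simp only: distrib_left)
      qed
      finally show "K_fun \<Omega> \<mu> \<phi> t u \<le> ennreal (1 + C' * r) * K_fun A \<nu> \<psi> t u + ennreal e" .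
    qed
  qed
qed

text \<open>The competitor is the mollification of u at scale r, pushed into \<Omega>. With t = r^2
  and a shift proportional to r, the L2 error C \<delta>^2 E is of the same order as the term r^2 E,
  so unlike in the preceding lemma the constant does not depend on t.\<close>

lemma K_fun_le_near_diff:
  fixes \<Omega> :: "'a::euclidean_space set"
  assumes "bounded \<Omega>" "lipschitz_domain \<Omega>" and eb: "dirichlet_eigenbasis \<Omega> \<mu> \<phi>"
    and u: "sq_int lborel u" "\<And>x. x \<notin> \<Omega> \<Longrightarrow> u x = 0"
  obtains C r0 :: real where "C > 0" "r0 > 0"
    "\<And>r. 0 < r \<Longrightarrow> r \<le> r0 \<Longrightarrow> K_fun \<Omega> \<mu> \<phi> (r\<^sup>2) u \<le> ennreal (C / r ^ DIM('a)) * near_diff r u"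
proof (rule push_in[OF assms(1,2)], rule mollification[where 'a = 'a])
  fix C M \<delta>1 C1 :: real
  assume C: "C > 0" and M: "M \<ge> 1" and \<delta>1: "\<delta>1 > 0" and C1: "C1 > 0"
    and push: "\<And>\<delta> w. 0 < \<delta> \<Longrightarrow> \<delta> \<le> \<delta>1 \<Longrightarrow> w \<in> test_functions (\<Union>y\<in>\<Omega>. ball y (\<delta> / M)) \<Longrightarrow>
      \<exists>v\<in>test_functions \<Omega>.
        (LINT x|lborel. (v x - w x)\<^sup>2) \<le> C * \<delta>\<^sup>2 * (LINT x|lborel. (norm (grad w x))\<^sup>2) \<and>
        (LINT x|lborel. (norm (grad v x))\<^sup>2) \<le> (1 + C * \<delta>) * (LINT x|lborel. (norm (grad w x))\<^sup>2)"
    and moll: "\<And>(u :: 'a \<Rightarrow> real) S r. r > 0 \<Longrightarrow> bounded S \<Longrightarrow> u \<in> borel_measurable borel \<Longrightarrow>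
      integrable lborel (\<lambda>x. (u x)\<^sup>2) \<Longrightarrow> (\<And>y. u y \<noteq> 0 \<Longrightarrow> y \<in> closure S) \<Longrightarrow>
      \<exists>v\<in>test_functions (\<Union>y\<in>S. ball y (2 * r)).
        ennreal ((LINT x|lborel. (v x - u x)\<^sup>2) + r\<^sup>2 * (LINT x|lborel. (norm (grad v x))\<^sup>2))
          \<le> ennreal (C1 / r ^ DIM('a)) * near_diff r u"
  have \<Omega>: "open \<Omega>" using assms(2) by (simp add: lipschitz_domain_def open_domain_def)
  have uL: "u \<in> L2_on \<Omega>" using sq_int_lborel_L2_on[OF u(1)] \<Omega> by auto
  \<comment> \<open>The factor 2 of the triangle inequality times C \<delta>^2 is 8 C M^2 r^2 for
    \<delta> = 2 r M; the gradient bound contributes 1 + C \<delta>, and \<delta> is at most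
    \<delta>1.\<close>
  define D where "D = 2 + 8 * C * M\<^sup>2 + C * \<delta>1"
  have D: "D \<ge> 2" "8 * C * M\<^sup>2 + 1 + C * \<delta>1 \<le> D" using C M \<delta>1 by (auto simp: D_def)
  show thesis
  proof (rule that[of "D * C1" "\<delta>1 / (2 * M)"])
    show "D * C1 > 0" using C1 D by simp
    show "\<delta>1 / (2 * M) > 0" using \<delta>1 M by simp
    fix r assume r: "0 < r" "r \<le> \<delta>1 / (2 * M)"
    \<comment> \<open>The mollification lives in the 2 r neighbourhood of \<Omega>, which must have
      width \<delta> / M.\<close>
    define \<delta> where "\<delta> = 2 * r * M"
    have \<delta>: "0 < \<delta>" "\<delta> \<le> \<delta>1" "\<delta> / M = 2 * r"
      using r M by (auto simp: \<delta>_def pos_le_divide_eq)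
    have "u y \<noteq> 0 \<Longrightarrow> y \<in> closure \<Omega>" for y using u(2) closure_subset by blast
    from moll[OF r(1) assms(1) _ _ this] obtain w where w: "w \<in> test_functions (\<Union>y\<in>\<Omega>. ball y (2 * r))"
      "ennreal ((LINT x|lborel. (w x - u x)\<^sup>2) + r\<^sup>2 * (LINT x|lborel. (norm (grad w x))\<^sup>2))
          \<le> ennreal (C1 / r ^ DIM('a)) * near_diff r u"
      using u(1) by (auto simp: sq_int_def)
    define N where "N = (LINT x|lborel. (w x - u x)\<^sup>2)"
    define E where "E = (LINT x|lborel. (norm (grad w x))\<^sup>2)"
    have NE: "0 \<le> N" "0 \<le> E" unfolding N_def E_def by (auto intro: integral_nonneg_AE)
    from push[OF \<delta>(1,2)] w(1) obtain v where v: "v \<in> test_functions \<Omega>"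
      "(LINT x|lborel. (v x - w x)\<^sup>2) \<le> C * \<delta>\<^sup>2 * E"
      "(LINT x|lborel. (norm (grad v x))\<^sup>2) \<le> (1 + C * \<delta>) * E"
      unfolding E_def \<delta>(3) by blast
    have "energy \<Omega> (r\<^sup>2) u v = (LINT x|lborel. (u x - v x)\<^sup>2) + r\<^sup>2 * (LINT x|lborel. (norm (grad v x))\<^sup>2)"
      by (rule energy_eq_whole_space[OF u(2) v(1)])
    also have "\<dots> \<le> ((1 + 1) * N + (1 + 1 / 1) * (C * \<delta>\<^sup>2 * E)) + r\<^sup>2 * ((1 + C * \<delta>) * E)"
    proof (intro add_mono mult_left_mono v(3))
      have "(LINT x|lborel. (u x - v x)\<^sup>2)
          \<le> (1 + 1) * (LINT x|lborel. (u x - w x)\<^sup>2) + (1 + 1 / 1) * (LINT x|lborel. (v x - w x)\<^sup>2)"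
        by (intro L2_triangle_sq u(1) zero_less_one test_functions_sq_int[OF v(1)] test_functions_sq_int[OF w(1)])
      also have "\<dots> \<le> (1 + 1) * N + (1 + 1 / 1) * (C * \<delta>\<^sup>2 * E)"
        unfolding N_def power2_commute[of "u _"] by (intro add_left_mono mult_left_mono v(2)) auto
      finally show "(LINT x|lborel. (u x - v x)\<^sup>2) \<le> (1 + 1) * N + (1 + 1 / 1) * (C * \<delta>\<^sup>2 * E)" .
    qed auto
    also have "\<dots> = 2 * N + (8 * C * M\<^sup>2 + 1 + C * \<delta>) * (r\<^sup>2 * E)"
      by (simp add: \<delta>_def power_mult_distrib algebra_simps)
    also have "\<dots> \<le> D * N + D * (r\<^sup>2 * E)"
    proof (intro add_mono mult_right_mono)
      have "C * \<delta> \<le> C * \<delta>1" using \<delta>(2) C by simp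
      then show "8 * C * M\<^sup>2 + 1 + C * \<delta> \<le> D" using D(2) by linarith
    qed (use D NE in auto)
    also have "\<dots> = D * (N + r\<^sup>2 * E)" by (simp add: distrib_left)
    finally have le: "energy \<Omega> (r\<^sup>2) u v \<le> D * (N + r\<^sup>2 * E)" .
    have "K_fun \<Omega> \<mu> \<phi> (r\<^sup>2) u \<le> ennreal (energy \<Omega> (r\<^sup>2) u v)"
      using r by (intro K_fun_le_energy[OF \<Omega> eb uL v(1)]) simp
    also have "\<dots> \<le> ennreal (D * (N + r\<^sup>2 * E))" by (rule ennreal_leI[OF le])
    also have "\<dots> = ennreal D * ennreal (N + r\<^sup>2 * E)" using D NE by (intro ennreal_mult) auto
    also have "\<dots> \<le> ennreal D * (ennreal (C1 / r ^ DIM('a)) * near_diff r u)"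
      unfolding N_def E_def by (intro mult_left_mono w(2)) simp
    also have "\<dots> = ennreal (D * C1 / r ^ DIM('a)) * near_diff r u"
      using D C1 r by (simp add: mult.assoc[symmetric] ennreal_mult[symmetric])
    finally show "K_fun \<Omega> \<mu> \<phi> (r\<^sup>2) u \<le> ennreal (D * C1 / r ^ DIM('a)) * near_diff r u" .
  qed
qed

section \<open>The boundary of a Lipschitz domain is negligible\<close>

text \<open>Locally the boundary is a graph, so its translates in the direction of the graph are disjoint;
  infinitely many of them fit into a bounded set.\<close>

lemma frontier_chart_null:
  fixes A :: "'a::euclidean_space set"
  assumes A: "open A" and chart: "lipschitz_chart A p R L" and R: "R > 0"
  shows "emeasure lborel (frontier A \<inter> cball p (R / 2)) = 0"
proof -
  obtain e g where e: "norm e = 1" and g: "L-lipschitz_on {y. y \<bullet> e = 0} g"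
    and gA: "\<And>x. x \<in> ball p R \<Longrightarrow> x \<in> A \<longleftrightarrow> x \<bullet> e < g (x - (x \<bullet> e) *\<^sub>R e)"
    using chart unfolding lipschitz_chart_def by auto
  have ee: "e \<bullet> e = 1" using e by (simp add: norm_eq_1)
  let ?pr = "\<lambda>x. x - (x \<bullet> e) *\<^sub>R e"
  define F where "F = frontier A \<inter> cball p (R / 2)"
  have F: "F \<in> sets borel" unfolding F_def by (intro sets.Int) auto
  have cont: "continuous_on UNIV (\<lambda>x. g (?pr x))"
  proof (rule continuous_on_compose2[OF lipschitz_on_continuous_on[OF g]])
    show "continuous_on UNIV ?pr" by (intro continuous_intros)
    show "range ?pr \<subseteq> {y. y \<bullet> e = 0}" by (auto simp: inner_diff_left ee)
  qed
  have graph: "x \<bullet> e = g (?pr x)" if "x \<in> F" for x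
  proof (rule antisym)
    have xb: "x \<in> ball p R" using that R unfolding F_def by auto
    have "x \<notin> A" using that A unfolding F_def frontier_def by (auto simp: interior_open)
    then show "g (?pr x) \<le> x \<bullet> e" using gA[OF xb] by simp
    have "x \<in> closure A" using that unfolding F_def frontier_def by auto
    then have "x \<in> closure (ball p R \<inter> A)"
      using xb open_Int_closure_subset[of "ball p R" A] by auto
    moreover have "closure (ball p R \<inter> A) \<subseteq> {x. x \<bullet> e \<le> g (?pr x)}"
    proof (rule closure_minimal)
      show "ball p R \<inter> A \<subseteq> {x. x \<bullet> e \<le> g (?pr x)}" using gA by force
      show "closed {x. x \<bullet> e \<le> g (?pr x)}"
        by (rule closed_Collect_le) (use cont in \<open>auto intro!: continuous_intros\<close>)
    qed
    ultimately show "x \<bullet> e \<le> g (?pr x)" by blast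
  qed
  \<comment> \<open>Infinitely many distinct heights in [0, 1]: the translates are disjoint and all
    stay within distance 1 of the original ball.\<close>
  define \<tau> where "\<tau> k = 1 / (1 + real k)" for k
  have \<tau>: "0 \<le> \<tau> k" "\<tau> k \<le> 1" for k unfolding \<tau>_def by auto
  define V where "V = measure lborel (cball p (R / 2 + 1))"
  have V: "emeasure lborel (cball p (R / 2 + 1)) = ennreal V"
    unfolding V_def using emeasure_bounded_finite[OF bounded_cball[of p "R / 2 + 1"]]
    by (intro emeasure_eq_ennreal_measure) auto
  have le: "of_nat N * emeasure lborel F \<le> ennreal V" for N :: nat
  proof -
    have "of_nat N * emeasure lborel F = (\<Sum>k<N. \<integral>\<^sup>+x. indicator F x \<partial>lborel)"
      using F by simp
    also have "\<dots> = (\<Sum>k<N. \<integral>\<^sup>+x. indicator F (x + (- \<tau> k) *\<^sub>R e) \<partial>lborel)"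
      using F by (intro sum.cong refl nn_integral_translate[symmetric]) auto
    also have "\<dots> = (\<integral>\<^sup>+x. (\<Sum>k<N. indicator F (x + (- \<tau> k) *\<^sub>R e)) \<partial>lborel)"
    proof (intro nn_integral_sum[symmetric])
      show "(\<lambda>x. indicator F (x + (- \<tau> k) *\<^sub>R e) :: ennreal) \<in> borel_measurable lborel" for k
        unfolding measurable_lborel2 by (rule measurable_compose[OF _ borel_measurable_indicator[OF F]]) simp
    qed
    also have "\<dots> \<le> (\<integral>\<^sup>+x. indicator (cball p (R / 2 + 1)) x \<partial>lborel)"
    proof (rule nn_integral_mono)
      fix x
      let ?J = "{k\<in>{..<N}. x + (- \<tau> k) *\<^sub>R e \<in> F}"
      have "(\<Sum>k<N. indicator F (x + (- \<tau> k) *\<^sub>R e)) = (of_nat (card ?J) :: ennreal)"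
        by (simp add: indicator_def sum.If_cases Int_def)
      moreover have "card ?J \<le> 1"
      proof -
        \<comment> \<open>Moving along e does not change the projection, and on F the projection
          determines the height; two translates containing x therefore have equal shifts.\<close>
        have "k = l" if "x + (- \<tau> k) *\<^sub>R e \<in> F" "x + (- \<tau> l) *\<^sub>R e \<in> F" for k l
        proof -
          have "?pr (x + c *\<^sub>R e) = ?pr x" for c by (simp add: inner_add_left ee algebra_simps)
          with graph[OF that(1)] graph[OF that(2)]
          have "(x + (- \<tau> k) *\<^sub>R e) \<bullet> e = (x + (- \<tau> l) *\<^sub>R e) \<bullet> e" by (simp only:)
          then have "\<tau> k = \<tau> l" by (simp add: inner_add_left inner_diff_left ee)
          then show "k = l" by (simp add: \<tau>_def)
        qed
        then show ?thesis by (auto simp: card_le_Suc0_iff_eq)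
      qed
      moreover have "?J = {}" if "x \<notin> cball p (R / 2 + 1)"
      proof -
        have "x \<in> cball p (R / 2 + 1)" if "x + (- \<tau> k) *\<^sub>R e \<in> F" for k
        proof -
          have "dist p x \<le> dist p (x + (- \<tau> k) *\<^sub>R e) + dist (x + (- \<tau> k) *\<^sub>R e) x"
            by (rule dist_triangle)
          also have "\<dots> \<le> R / 2 + 1"
            using that \<tau>[of k] e by (intro add_mono) (auto simp: F_def dist_norm)
          finally show ?thesis by simp
        qed
        with that show ?thesis by blast
      qed
      ultimately show "(\<Sum>k<N. indicator F (x + (- \<tau> k) *\<^sub>R e)) \<le> (indicator (cball p (R / 2 + 1)) x :: ennreal)"
        by (cases "x \<in> cball p (R / 2 + 1)") (auto simp: of_nat_le_iff[of _ 1, where 'a = ennreal, simplified])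
    qed
    also have "\<dots> = ennreal V" using V by simp
    finally show ?thesis .
  qed
  have "emeasure lborel F < top"
    using emeasure_bounded_finite[of F] bounded_cball[of p "R / 2"]
    by (auto simp: F_def intro: bounded_subset)
  then obtain m where m: "m \<ge> 0" "emeasure lborel F = ennreal m" by (auto simp: less_top_ennreal)
  have V0: "V \<ge> 0" unfolding V_def by simp
  have "real N * m \<le> V" for N
    using le[of N] m V0 by (simp add: ennreal_of_nat_eq_real_of_nat ennreal_mult[symmetric])
  then have "m = 0" using m(1) V0 by (metis reals_Archimedean3 less_eq_real_def not_less)
  with m show ?thesis by (simp add: F_def)
qed

lemma frontier_lipschitz_domain_null:
  fixes \<Omega> :: "'a::euclidean_space set"
  assumes "bounded \<Omega>" "lipschitz_domain \<Omega>"
  shows "frontier \<Omega> \<in> null_sets lborel"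
proof -
  have open': "open \<Omega>" using assms(2) by (simp add: lipschitz_domain_def open_domain_def)
  have "\<forall>p\<in>frontier \<Omega>. \<exists>R>0. emeasure lborel (frontier \<Omega> \<inter> cball p (R / 2)) = 0"
    using assms(2) frontier_chart_null[OF open'] unfolding lipschitz_domain_def by blast
  then obtain R where R: "\<And>p. p \<in> frontier \<Omega> \<Longrightarrow> R p > 0"
    "\<And>p. p \<in> frontier \<Omega> \<Longrightarrow> emeasure lborel (frontier \<Omega> \<inter> cball p (R p / 2)) = 0"
    by metis
  have "compact (frontier \<Omega>)" using assms(1) by (simp add: compact_frontier_bounded)
  moreover have "frontier \<Omega> \<subseteq> (\<Union>p\<in>frontier \<Omega>. ball p (R p / 2))" using R(1) by force
  ultimately obtain P where P: "P \<subseteq> frontier \<Omega>" "finite P" "frontier \<Omega> \<subseteq> (\<Union>p\<in>P. ball p (R p / 2))"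
    using compactE_image[of "frontier \<Omega>" "frontier \<Omega>" "\<lambda>p. ball p (R p / 2)"] by blast
  have "frontier \<Omega> \<inter> cball p (R p / 2) \<in> null_sets lborel" if "p \<in> P" for p
    using R(2) that P(1) by (intro null_setsI) auto
  then have "(\<Union>p\<in>P. frontier \<Omega> \<inter> cball p (R p / 2)) \<in> null_sets lborel"
    using P(2) by (intro null_sets_UN') (auto intro: countable_finite)
  moreover have "frontier \<Omega> \<subseteq> (\<Union>p\<in>P. frontier \<Omega> \<inter> cball p (R p / 2))"
  proof
    fix x assume x: "x \<in> frontier \<Omega>"
    with P(3) obtain p where "p \<in> P" "x \<in> ball p (R p / 2)" by blast
    then have "x \<in> cball p (R p / 2)" by simp
    with x \<open>p \<in> P\<close> show "x \<in> (\<Union>p\<in>P. frontier \<Omega> \<inter> cball p (R p / 2))" by blast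
  qed
  ultimately show ?thesis
    by - (erule null_sets_subset, simp, assumption)
qed

section \<open>Integral representation of the fractional form\<close>

definition frac_weight :: "real \<Rightarrow> real \<Rightarrow> real" where
  "frac_weight s t = indicator {0<..} t * t powr (- 1 - s)"

lemma frac_weight_nonneg: "0 \<le> frac_weight s t"
  by (simp add: frac_weight_def)

lemma frac_weight_measurable [measurable]: "frac_weight s \<in> borel_measurable borel"
  unfolding frac_weight_def[abs_def] by measurable

text \<open>For 0 < s < 1 this is the classical integral of t^-s / (1 + t) over t > 0, with value
  \<pi> / sin (\<pi> s). The argument rests on its being positive and finite.\<close>

definition frac_const :: "real \<Rightarrow> ennreal" where
  "frac_const s = (\<integral>\<^sup>+t. ennreal (frac_weight s t * (t / (1 + t))) \<partial>lborel)"

lemma nn_integral_powr_tail: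
  assumes a: "a > 0" and b: "b > 0"
  shows "(\<integral>\<^sup>+t. ennreal (t powr (- 1 - b)) * indicator {a..} t \<partial>lborel) = ennreal (a powr (- b) / b)"
proof -
  have "(\<integral>\<^sup>+t. ennreal (t powr (- 1 - b)) * indicator {a..} t \<partial>lborel) = ennreal (0 - (- (a powr (- b) / b)))"
  proof (rule nn_integral_FTC_atLeast)
    show "((\<lambda>t. - (t powr (- b) / b)) has_real_derivative t powr (- 1 - b)) (at t)" if "a \<le> t" for t
      using that a b by (auto intro!: derivative_eq_intros simp: powr_diff powr_minus field_simps)
    have "((\<lambda>t. - (t powr (- b) / b)) \<longlongrightarrow> - (0 / b)) at_top"
      by (intro tendsto_intros tendsto_neg_powr filterlim_ident) (use b in auto)
    then show "((\<lambda>t. - (t powr (- b) / b)) \<longlongrightarrow> 0) at_top" by simp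
  qed auto
  then show ?thesis by simp
qed

text \<open>Split at t = 1: the integrand is at most t^-s near 0, integrable as s < 1, and at most
  t^(-1-s) beyond, integrable as s > 0.\<close>

lemma frac_const_finite:
  assumes s: "0 < s" "s < 1"
  shows "frac_const s < top"
proof -
  have I: "((\<lambda>t. if t \<in> {0..1} then t powr (- s) else 0) has_integral (1 powr (- s + 1) / (- s + 1))) UNIV"
    unfolding has_integral_restrict_UNIV by (rule has_integral_powr_from_0) (use s in auto)
  have 1: "(\<integral>\<^sup>+t. ennreal (if t \<in> {0..1} then t powr (- s) else 0) \<partial>lborel) = ennreal (1 powr (- s + 1) / (- s + 1))"
    by (rule nn_integral_has_integral_lborel[OF _ _ I]) auto
  have "frac_const s \<le> (\<integral>\<^sup>+t. ennreal (if t \<in> {0..1} then t powr (- s) else 0)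
      + ennreal (t powr (- 1 - s)) * indicator {1..} t \<partial>lborel)"
    unfolding frac_const_def
  proof (rule nn_integral_mono)
    fix t :: real
    consider "t \<le> 0" | "0 < t" "t \<le> 1" | "1 < t" by linarith
    then show "ennreal (frac_weight s t * (t / (1 + t))) \<le> ennreal (if t \<in> {0..1} then t powr (- s) else 0)
      + ennreal (t powr (- 1 - s)) * indicator {1..} t"
    proof cases
      case 1
      then show ?thesis by (simp add: frac_weight_def)
    next
      case 2
      have "frac_weight s t * (t / (1 + t)) = t powr (- s) / (1 + t)"
        using 2 by (simp add: frac_weight_def powr_diff powr_minus divide_inverse)
      also have "\<dots> \<le> t powr (- s)" using 2 by (simp add: pos_divide_le_eq mult_le_cancel_left1)
      finally show ?thesis using 2 by (auto intro!: ennreal_leI add_increasing2)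
    next
      case 3
      have "frac_weight s t * (t / (1 + t)) \<le> t powr (- 1 - s)"
        using 3 mult_left_le[of "t / (1 + t)" "t powr (- 1 - s)"] by (simp add: frac_weight_def)
      then show ?thesis using 3 by (auto intro!: ennreal_leI)
    qed
  qed
  also have "\<dots> = (\<integral>\<^sup>+t. ennreal (if t \<in> {0..1} then t powr (- s) else 0) \<partial>lborel)
      + (\<integral>\<^sup>+t. ennreal (t powr (- 1 - s)) * indicator {1..} t \<partial>lborel)"
    by (rule nn_integral_add) auto
  also have "\<dots> = ennreal (1 powr (- s + 1) / (- s + 1)) + ennreal (1 powr (- s) / s)"
    unfolding 1 nn_integral_powr_tail[OF zero_less_one s(1)] ..
  also have "\<dots> < top" by simp
  finally show ?thesis .
qed

text \<open>On [1, 2] the factor t / (1 + t) is at least 1/2 and the weight at least 2 powr (-1 -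
  |s|); the absolute value makes the bound valid for either sign of s.\<close>

lemma frac_const_pos: "0 < frac_const s"
proof -
  have "0 < ennreal (2 powr (- 1 - \<bar>s\<bar>) / 2)" by simp
  also have "\<dots> = (\<integral>\<^sup>+t. ennreal (2 powr (- 1 - \<bar>s\<bar>) / 2) * indicator {1..2::real} t \<partial>lborel)"
    by (subst nn_integral_cmult_indicator) auto
  also have "\<dots> \<le> frac_const s"
    unfolding frac_const_def
  proof (rule nn_integral_mono)
    fix t :: real
    show "ennreal (2 powr (- 1 - \<bar>s\<bar>) / 2) * indicator {1..2} t \<le> ennreal (frac_weight s t * (t / (1 + t)))"
    proof (cases "t \<in> {1..2}")
      case True
      then have t: "1 \<le> t" "t \<le> 2" by auto
      have "2 powr (- 1 - \<bar>s\<bar>) \<le> t powr (- 1 - \<bar>s\<bar>)" using t by (intro powr_mono2') auto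
      also have "\<dots> \<le> t powr (- 1 - s)" using t by (intro powr_mono) auto
      finally have "2 powr (- 1 - \<bar>s\<bar>) * (1 / 2) \<le> t powr (- 1 - s) * (t / (1 + t))"
        using t by (intro mult_mono) (auto simp: field_simps)
      then show ?thesis using t True by (simp add: frac_weight_def ennreal_leI)
    qed simp
  qed
  finally show ?thesis .
qed

text \<open>The substitution t = x / m extracts m^s by homogeneity of the weight. For m = 0 both
  sides vanish, because \<open>0 powr s = 0\<close>.\<close>

lemma frac_weight_integral:
  assumes m: "m \<ge> 0"
  shows "(\<integral>\<^sup>+t. ennreal (frac_weight s t * (t * m / (1 + t * m))) \<partial>lborel) = ennreal (m powr s) * frac_const s"
proof (cases "m = 0")
  case False
  with m have m: "m > 0" by simp
  let ?f = "\<lambda>t. ennreal (frac_weight s t * (t * m / (1 + t * m)))"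
  have "(\<integral>\<^sup>+t. ?f t \<partial>lborel) = \<bar>1 / m\<bar> * (\<integral>\<^sup>+x. ?f (0 + 1 / m * x) \<partial>lborel)"
    by (rule nn_integral_real_affine) (use m in auto)
  also have "(\<integral>\<^sup>+x. ?f (0 + 1 / m * x) \<partial>lborel)
      = (\<integral>\<^sup>+x. ennreal (m powr (1 + s)) * ennreal (frac_weight s x * (x / (1 + x))) \<partial>lborel)"
  proof (rule nn_integral_cong)
    fix x :: real
    show "?f (0 + 1 / m * x) = ennreal (m powr (1 + s)) * ennreal (frac_weight s x * (x / (1 + x)))"
    proof (cases "x > 0")
      case True
      have "(x / m) powr (- 1 - s) = m powr (1 + s) * x powr (- 1 - s)"
        using True m by (simp add: powr_divide powr_diff powr_minus powr_add field_simps)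
      then have "frac_weight s (0 + 1 / m * x) = m powr (1 + s) * frac_weight s x"
        using True m by (simp add: frac_weight_def)
      moreover have "(0 + 1 / m * x) * m = x" using m by simp
      ultimately show ?thesis by (simp add: ennreal_mult'[symmetric] mult.assoc)
    next
      case False
      then have "\<not> 1 / m * x > 0" using m by (simp add: zero_less_mult_iff zero_less_divide_iff)
      with False show ?thesis by (simp add: frac_weight_def)
    qed
  qed
  also have "\<dots> = ennreal (m powr (1 + s)) * frac_const s"
    unfolding frac_const_def by (rule nn_integral_cmult) measurable
  also have "ennreal \<bar>1 / m\<bar> * (ennreal (m powr (1 + s)) * frac_const s) = ennreal (m powr s) * frac_const s"
    using m by (simp add: mult.assoc[symmetric] ennreal_mult'[symmetric] powr_add)
  finally show ?thesis .
qed simp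

text \<open>The diagonal spectral sum with values in \<open>ennreal\<close>, where it always makes
  sense and commutes with integrals of nonnegative functions; it is compared with the real series
  once it is known to be finite.\<close>

definition frac_form :: "'a::euclidean_space set \<Rightarrow> (nat \<Rightarrow> real) \<Rightarrow> (nat \<Rightarrow> 'a \<Rightarrow> real) \<Rightarrow> real
    \<Rightarrow> ('a \<Rightarrow> real) \<Rightarrow> ennreal" where
  "frac_form A \<mu> \<phi> s u = (\<Sum>j. ennreal (\<mu> j powr s * (L2_inner A u (\<phi> j))\<^sup>2))"

lemma K_fun_measurable [measurable]: "(\<lambda>t. K_fun A \<mu> \<phi> t u) \<in> borel_measurable borel"
  unfolding K_fun_def by measurable

text \<open>Sum and integral are exchanged and each mode is evaluated by
  \<open>frac_weight_integral\<close>. Since K is variational, this is the bridge between the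
  spectral form and comparison of domains.\<close>

lemma frac_form_eq_integral:
  assumes \<mu>: "\<And>j. 0 \<le> \<mu> j"
  shows "(\<integral>\<^sup>+t. ennreal (frac_weight s t) * K_fun A \<mu> \<phi> t u \<partial>lborel) = frac_const s * frac_form A \<mu> \<phi> s u"
proof -
  let ?a = "\<lambda>j. (L2_inner A u (\<phi> j))\<^sup>2"
  have "ennreal (frac_weight s t) * K_fun A \<mu> \<phi> t u
      = (\<Sum>j. ennreal (frac_weight s t * (t * \<mu> j / (1 + t * \<mu> j))) * ennreal (?a j))" for t
  proof (cases "t > 0")
    case True
    have "ennreal (frac_weight s t) * ennreal (t * \<mu> j / (1 + t * \<mu> j) * ?a j)
        = ennreal (frac_weight s t * (t * \<mu> j / (1 + t * \<mu> j))) * ennreal (?a j)" for j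
      using True \<mu>[of j] frac_weight_nonneg[of s t] by (simp add: ennreal_mult[symmetric] mult.assoc)
    then show ?thesis unfolding K_fun_def by (simp add: ennreal_suminf_cmult[symmetric])
  qed (simp add: frac_weight_def)
  then have "(\<integral>\<^sup>+t. ennreal (frac_weight s t) * K_fun A \<mu> \<phi> t u \<partial>lborel)
      = (\<Sum>j. \<integral>\<^sup>+t. ennreal (frac_weight s t * (t * \<mu> j / (1 + t * \<mu> j))) * ennreal (?a j) \<partial>lborel)"
    by (simp only:) (rule nn_integral_suminf, measurable)
  also have "\<dots> = (\<Sum>j. ennreal (\<mu> j powr s) * frac_const s * ennreal (?a j))"
    by (subst nn_integral_multc) (measurable, simp only: frac_weight_integral[OF \<mu>])
  also have "\<dots> = (\<Sum>j. frac_const s * ennreal (\<mu> j powr s * ?a j))"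
    by (simp add: ennreal_mult mult_ac)
  also have "\<dots> = frac_const s * frac_form A \<mu> \<phi> s u" unfolding frac_form_def by simp
  finally show ?thesis .
qed

section \<open>The space \<open>H\<^sup>s\<close> and the fractional form\<close>

definition gagliardo :: "real \<Rightarrow> ('a::euclidean_space \<Rightarrow> real) \<Rightarrow> ennreal" where
  "gagliardo s u = (\<integral>\<^sup>+x. \<integral>\<^sup>+y.
     ennreal ((u x - u y)\<^sup>2 / norm (x - y) powr (real DIM('a) + 2 * s)) \<partial>lborel \<partial>lborel)"

lemma nn_integral_pair:
  fixes f :: "'a::euclidean_space \<Rightarrow> 'a \<Rightarrow> ennreal"
  assumes "case_prod f \<in> borel_measurable (lborel \<Otimes>\<^sub>M lborel)"
  shows "(\<integral>\<^sup>+x. \<integral>\<^sup>+y. f x y \<partial>lborel \<partial>lborel) = (\<integral>\<^sup>+z. f (fst z) (snd z) \<partial>lborel)"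
  using lborel.nn_integral_fst[OF assms] by (simp add: lborel_prod case_prod_unfold)

lemma measurable_pair_components:
  fixes u :: "'a::euclidean_space \<Rightarrow> real"
  assumes u: "u \<in> borel_measurable borel"
  shows "(\<lambda>z::'a \<times> 'a. u (fst z)) \<in> borel_measurable lborel"
    "(\<lambda>z::'a \<times> 'a. u (snd z)) \<in> borel_measurable lborel"
    "(\<lambda>z::'a \<times> 'a. dist (fst z) (snd z)) \<in> borel_measurable lborel"
    "(\<lambda>z::'a \<times> 'a. norm (fst z - snd z)) \<in> borel_measurable lborel"
proof -
  have "(fst :: 'a \<times> 'a \<Rightarrow> 'a) \<in> borel_measurable lborel" "(snd :: 'a \<times> 'a \<Rightarrow> 'a) \<in> borel_measurable lborel"
    by (auto intro!: borel_measurable_continuous_onI continuous_intros)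
  from measurable_compose[OF this(1) u] measurable_compose[OF this(2) u]
  show "(\<lambda>z::'a \<times> 'a. u (fst z)) \<in> borel_measurable lborel"
    "(\<lambda>z::'a \<times> 'a. u (snd z)) \<in> borel_measurable lborel" .
qed (auto intro!: borel_measurable_continuous_onI continuous_intros)

lemma near_diff_eq_pair:
  fixes u :: "'a::euclidean_space \<Rightarrow> real"
  assumes [measurable]: "u \<in> borel_measurable borel"
  shows "near_diff r u = (\<integral>\<^sup>+z. (if dist (fst z) (snd z) \<le> r then 1 else 0)
    * ennreal ((u (fst z) - u (snd z))\<^sup>2) \<partial>lborel)"
proof -
  have "near_diff r u = (\<integral>\<^sup>+x. \<integral>\<^sup>+y. (if dist x y \<le> r then 1 else 0) * ennreal ((u x - u y)\<^sup>2) \<partial>lborel \<partial>lborel)"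
    unfolding near_diff_def by (intro nn_integral_cong) (auto simp: indicator_def)
  also have "\<dots> = (\<integral>\<^sup>+z. (if dist (fst z) (snd z) \<le> r then 1 else 0)
    * ennreal ((u (fst z) - u (snd z))\<^sup>2) \<partial>lborel)"
    by (rule nn_integral_pair) measurable
  finally show ?thesis .
qed

lemma gagliardo_eq_pair:
  fixes u :: "'a::euclidean_space \<Rightarrow> real"
  assumes [measurable]: "u \<in> borel_measurable borel"
  shows "gagliardo s u = (\<integral>\<^sup>+z. ennreal ((u (fst z) - u (snd z))\<^sup>2
    / norm (fst z - snd z) powr (real DIM('a) + 2 * s)) \<partial>lborel)"
  unfolding gagliardo_def by (rule nn_integral_pair) measurable

text \<open>After exchanging integrals, a pair at distance d > 0 is counted for t >= d^2 only, and
  the integral of t^(-1-s-n/2) from d^2 onwards is d^(-n-2s) / (s + n/2): the Gagliardo kernel. On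
  the diagonal the difference of values is zero.\<close>

lemma nn_integral_near_diff:
  fixes u :: "'a::euclidean_space \<Rightarrow> real"
  assumes [measurable]: "u \<in> borel_measurable borel" and s: "0 < s"
  shows "(\<integral>\<^sup>+t. ennreal (frac_weight s t / sqrt t ^ DIM('a)) * near_diff (sqrt t) u \<partial>lborel)
    \<le> ennreal (1 / (s + DIM('a) / 2)) * gagliardo s u"
proof -
  note [measurable] = measurable_pair_components[OF assms(1)]
  define n where "n = real DIM('a)"
  define \<beta> where "\<beta> = s + n / 2"
  have \<beta>: "\<beta> > 0" using s by (simp add: \<beta>_def n_def add_pos_pos)
  let ?a = "\<lambda>t. ennreal (frac_weight s t / sqrt t ^ DIM('a))"
  let ?g = "\<lambda>z::'a \<times> 'a. ennreal ((u (fst z) - u (snd z))\<^sup>2)"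
  let ?k = "\<lambda>t z::'a \<times> 'a. (if dist (fst z) (snd z) \<le> sqrt t then 1 else 0) :: ennreal"
  have a: "?a t = ennreal (indicator {0<..} t * t powr (- 1 - \<beta>))" for t
  proof (cases "t > 0")
    case True
    have "sqrt t ^ DIM('a) = t powr (n / 2)"
      using True by (simp add: n_def powr_half_sqrt[symmetric] powr_realpow[symmetric] powr_powr)
    moreover have "t powr (- 1 - s) / t powr (n / 2) = t powr (- 1 - \<beta>)"
      by (simp add: powr_diff[symmetric] \<beta>_def algebra_simps)
    ultimately show ?thesis using True by (simp add: frac_weight_def)
  qed (simp add: frac_weight_def)
  have tail: "(\<integral>\<^sup>+t. ?a t * ?k t z \<partial>lborel) * ?g z
      \<le> ennreal (1 / \<beta>) * ennreal ((u (fst z) - u (snd z))\<^sup>2 / norm (fst z - snd z) powr (n + 2 * s))" for z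
  proof (cases "fst z = snd z")
    case False
    define d where "d = dist (fst z) (snd z)"
    have d: "d > 0" using False by (simp add: d_def)
    have "(\<integral>\<^sup>+t. ?a t * ?k t z \<partial>lborel) = (\<integral>\<^sup>+t. ennreal (t powr (- 1 - \<beta>)) * indicator {d\<^sup>2..} t \<partial>lborel)"
    proof (rule nn_integral_cong)
      fix t :: real
      have "d \<le> sqrt t \<longleftrightarrow> d\<^sup>2 \<le> t"
        using d real_le_rsqrt[of d t] sqrt_ge_absD[of d t] by auto
      moreover have "0 < t" if "d\<^sup>2 \<le> t" using that zero_less_power[OF d, of 2] by linarith
      ultimately show "?a t * ?k t z = ennreal (t powr (- 1 - \<beta>)) * indicator {d\<^sup>2..} t"
        unfolding a d_def[symmetric] by (auto simp: indicator_def)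
    qed
    also have "\<dots> = ennreal (d\<^sup>2 powr (- \<beta>) / \<beta>)"
      by (rule nn_integral_powr_tail) (use d \<beta> in auto)
    also have "d\<^sup>2 powr (- \<beta>) = 1 / d powr (n + 2 * s)"
    proof -
      have "d\<^sup>2 = d powr 2" using d by (simp add: powr_numeral)
      moreover have "2 * (- \<beta>) = - (n + 2 * s)" by (simp add: \<beta>_def)
      ultimately have eq: "d\<^sup>2 powr (- \<beta>) = d powr (- (n + 2 * s))" by (simp only: powr_powr)
      show ?thesis unfolding eq by (simp only: powr_minus divide_inverse mult_1_left)
    qed
    finally have "(\<integral>\<^sup>+t. ?a t * ?k t z \<partial>lborel) = ennreal (1 / d powr (n + 2 * s) / \<beta>)" .
    then show ?thesis
      using d \<beta> by (simp add: d_def dist_norm ennreal_mult'[symmetric] mult.commute)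
  qed simp
  have "(\<integral>\<^sup>+t. ?a t * near_diff (sqrt t) u \<partial>lborel) = (\<integral>\<^sup>+t. \<integral>\<^sup>+z. ?a t * (?k t z * ?g z) \<partial>lborel \<partial>lborel)"
    unfolding near_diff_eq_pair[OF assms(1)]
    by (intro nn_integral_cong nn_integral_cmult[symmetric]) measurable
  also have "\<dots> = (\<integral>\<^sup>+z. \<integral>\<^sup>+t. ?a t * (?k t z * ?g z) \<partial>lborel \<partial>lborel)"
    by (rule lborel_pair.Fubini'[symmetric]) measurable
  also have "\<dots> = (\<integral>\<^sup>+z. (\<integral>\<^sup>+t. ?a t * ?k t z \<partial>lborel) * ?g z \<partial>lborel)"
    unfolding mult.assoc[symmetric] by (intro nn_integral_cong nn_integral_multc) measurable
  also have "\<dots> \<le> (\<integral>\<^sup>+z. ennreal (1 / \<beta>) * ennreal ((u (fst z) - u (snd z))\<^sup>2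
      / norm (fst z - snd z) powr (n + 2 * s)) \<partial>lborel)"
    by (intro nn_integral_mono tail)
  also have "\<dots> = ennreal (1 / \<beta>) * gagliardo s u"
    unfolding gagliardo_eq_pair[OF assms(1)] n_def by (rule nn_integral_cmult) measurable
  finally show ?thesis by (simp add: \<beta>_def n_def)
qed

text \<open>Representatives that vanish at every point off \<Omega>, as
  \<open>energy_eq_whole_space\<close> demands. They form a linear space, which polarization needs,
  and \<open>Hs_tilde_cut_off\<close> reduces the general case to them.\<close>

definition Hs_zero :: "real \<Rightarrow> 'a::euclidean_space set \<Rightarrow> ('a \<Rightarrow> real) set" where
  "Hs_zero s \<Omega> = {u. sq_int lborel u \<and> (\<forall>x. x \<notin> \<Omega> \<longrightarrow> u x = 0) \<and> gagliardo s u < top}"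

text \<open>Split at t = r0^2. Below it K is bounded through \<open>near_diff\<close> at scale sqrt
  t, whose weighted integral is controlled by the Gagliardo seminorm; above it K is at most the
  squared L2 norm of u and the weight t^(-1-s) is integrable at infinity.\<close>

lemma K_integral_finite:
  fixes \<Omega> :: "'a::euclidean_space set"
  assumes \<Omega>: "bounded \<Omega>" "lipschitz_domain \<Omega>" and eb: "dirichlet_eigenbasis \<Omega> \<mu> \<phi>"
    and s: "0 < s" and u: "u \<in> Hs_zero s \<Omega>"
  shows "(\<integral>\<^sup>+t. ennreal (frac_weight s t) * K_fun \<Omega> \<mu> \<phi> t u \<partial>lborel) < top"
proof -
  have u': "sq_int lborel u" "\<And>x. x \<notin> \<Omega> \<Longrightarrow> u x = 0" "gagliardo s u < top"
    using u by (auto simp: Hs_zero_def)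
  have um: "u \<in> borel_measurable borel" using u'(1) by (simp add: sq_int_def)
  have op: "open \<Omega>" using \<Omega>(2) by (simp add: lipschitz_domain_def open_domain_def)
  obtain C r0 :: real where C: "C > 0" "r0 > 0"
    and near: "\<And>r. 0 < r \<Longrightarrow> r \<le> r0 \<Longrightarrow> K_fun \<Omega> \<mu> \<phi> (r\<^sup>2) u \<le> ennreal (C / r ^ DIM('a)) * near_diff r u"
    using K_fun_le_near_diff[OF \<Omega> eb u'(1,2)] by blast
  define B where "B = (LINT x:\<Omega>|lborel. (u x)\<^sup>2)"
  have far: "K_fun \<Omega> \<mu> \<phi> t u \<le> ennreal B" if "t > 0" for t
    unfolding B_def by (rule K_fun_finite[OF op eb sq_int_lborel_L2_on[OF u'(1)] that]) (use op in simp)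
  let ?near = "\<lambda>t. ennreal (frac_weight s t / sqrt t ^ DIM('a)) * near_diff (sqrt t) u"
  let ?far = "\<lambda>t. ennreal (t powr (- 1 - s)) * indicator {r0\<^sup>2..} t"
  have near_m: "?near \<in> borel_measurable borel"
  proof -
    note [measurable] = um
    note [measurable] = measurable_pair_components[OF um]
    have "(\<lambda>t. near_diff (sqrt t) u) \<in> borel_measurable borel"
      unfolding near_diff_eq_pair[OF um]
      by (rule lborel.borel_measurable_nn_integral) measurable
    then show ?thesis by measurable
  qed
  have "(\<integral>\<^sup>+t. ennreal (frac_weight s t) * K_fun \<Omega> \<mu> \<phi> t u \<partial>lborel)
      \<le> (\<integral>\<^sup>+t. ennreal C * ?near t + ennreal B * ?far t \<partial>lborel)"
  proof (rule nn_integral_mono)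
    fix t :: real
    consider "t \<le> 0" | "0 < t" "t \<le> r0\<^sup>2" | "0 < t" "r0\<^sup>2 \<le> t" by linarith
    then show "ennreal (frac_weight s t) * K_fun \<Omega> \<mu> \<phi> t u \<le> ennreal C * ?near t + ennreal B * ?far t"
    proof cases
      case 1
      then show ?thesis by (simp add: frac_weight_def)
    next
      case 2
      have "sqrt t \<le> r0" using 2 C(2) by (intro real_le_lsqrt) auto
      then have "K_fun \<Omega> \<mu> \<phi> t u \<le> ennreal (C / sqrt t ^ DIM('a)) * near_diff (sqrt t) u"
        using near[of "sqrt t"] 2 by simp
      then have "ennreal (frac_weight s t) * K_fun \<Omega> \<mu> \<phi> t u
          \<le> ennreal (frac_weight s t) * (ennreal (C / sqrt t ^ DIM('a)) * near_diff (sqrt t) u)"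
        by (rule mult_left_mono) simp
      also have "\<dots> = ennreal C * ?near t"
      proof -
        define q where "q = sqrt t ^ DIM('a)"
        have "q > 0" using 2 by (simp add: q_def)
        then have "ennreal (frac_weight s t) * ennreal (C / q) = ennreal C * ennreal (frac_weight s t / q)"
          using C frac_weight_nonneg[of s t] by (simp add: ennreal_mult[symmetric] mult.commute)
        then show ?thesis unfolding q_def[symmetric] by (simp only: mult.assoc[symmetric])
      qed
      finally show ?thesis by (rule order_trans) simp
    next
      case 3
      have "ennreal (frac_weight s t) * K_fun \<Omega> \<mu> \<phi> t u \<le> ennreal (frac_weight s t) * ennreal B"
        using far[OF 3(1)] by (rule mult_left_mono) simp
      also have "\<dots> = ennreal B * ?far t" using 3 by (simp add: frac_weight_def mult.commute)
      finally show ?thesis by (rule order_trans) simp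
    qed
  qed
  also have "\<dots> = ennreal C * (\<integral>\<^sup>+t. ?near t \<partial>lborel) + ennreal B * (\<integral>\<^sup>+t. ?far t \<partial>lborel)"
    using near_m by (subst nn_integral_add) (auto simp: nn_integral_cmult)
  also have "\<dots> \<le> ennreal C * (ennreal (1 / (s + DIM('a) / 2)) * gagliardo s u)
      + ennreal B * ennreal (r0\<^sup>2 powr (- s) / s)"
    using C s nn_integral_near_diff[OF um s]
    by (intro add_mono mult_left_mono) (auto simp: nn_integral_powr_tail)
  also have "\<dots> < top"
    using u'(3) by (simp add: ennreal_mult_less_top)
  finally show ?thesis .
qed

lemma frac_form_finite:
  assumes "bounded \<Omega>" "lipschitz_domain \<Omega>" "dirichlet_eigenbasis \<Omega> \<mu> \<phi>"
    and s: "0 < s" "s < 1" and u: "u \<in> Hs_zero s \<Omega>"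
  shows "frac_form \<Omega> \<mu> \<phi> s u < top"
proof -
  have "open \<Omega>" using assms(2) by (simp add: lipschitz_domain_def open_domain_def)
  then have "\<And>j. 0 \<le> \<mu> j" using eigenvalue_nonneg assms(3) by blast
  then have "frac_const s * frac_form \<Omega> \<mu> \<phi> s u < top"
    using K_integral_finite[OF assms(1-3) s(1) u] by (simp add: frac_form_eq_integral)
  then show ?thesis using frac_const_pos[of s] by (auto simp: ennreal_mult_less_top)
qed

text \<open>At fixed t the values of K on the larger domains are squeezed between k / (1 + C / (h +
  1)) and k, where k is the value on \<Omega>. The integrand for \<Omega> itself serves as majorant,
  which also makes each form on a larger domain finite. The family is indexed from 0, whence the
  radii 1 / (h + 1).\<close>

lemma frac_form_convergence:
  fixes \<Omega> :: "'a::euclidean_space set"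
  assumes \<Omega>: "bounded \<Omega>" "lipschitz_domain \<Omega>" and eb: "dirichlet_eigenbasis \<Omega> \<mu> \<phi>"
    and s: "0 < s" "s < 1" and u: "u \<in> Hs_zero s \<Omega>"
    and A: "\<And>h::nat. open (A h)" "\<And>h. dirichlet_eigenbasis (A h) (\<nu> h) (\<psi> h)"
    and sub: "\<And>h. \<Omega> \<subseteq> A h" and near: "\<And>h. A h \<subseteq> (\<Union>y\<in>\<Omega>. ball y (1 / real (Suc h)))"
  shows "(\<lambda>h. frac_form (A h) (\<nu> h) (\<psi> h) s u) \<longlonglongrightarrow> frac_form \<Omega> \<mu> \<phi> s u"
    "\<And>h. frac_form (A h) (\<nu> h) (\<psi> h) s u < top"
proof -
  have u': "sq_int lborel u" "\<And>x. x \<notin> \<Omega> \<Longrightarrow> u x = 0" using u by (auto simp: Hs_zero_def)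
  have op: "open \<Omega>" using \<Omega>(2) by (simp add: lipschitz_domain_def open_domain_def)
  have nonneg: "0 \<le> \<mu> j" "0 \<le> \<nu> h j" for h j
    using eigenvalue_nonneg[OF op eb] eigenvalue_nonneg[OF A] by auto
  let ?K = "K_fun \<Omega> \<mu> \<phi>" and ?Kh = "\<lambda>h. K_fun (A h) (\<nu> h) (\<psi> h)"
  have le: "?Kh h t u \<le> ?K t u" if "t > 0" for h t
    by (rule K_fun_antimono[OF op eb A sub u' that])
  have wle: "ennreal (frac_weight s t) * ?Kh h t u \<le> ennreal (frac_weight s t) * ?K t u" for h t
    using le[of t h] by (cases "t > 0") (auto simp: frac_weight_def intro: mult_left_mono)
  have lim: "(\<lambda>h. ?Kh h t u) \<longlonglongrightarrow> ?K t u" if t: "t > 0" for t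
  proof -
    have "?K t u \<le> ennreal (LINT x:\<Omega>|lborel. (u x)\<^sup>2)"
      by (rule K_fun_finite[OF op eb sq_int_lborel_L2_on[OF u'(1)] t]) (use op in simp)
    then have "?K t u < top" by (rule order.strict_trans1) simp
    then obtain k where k: "k \<ge> 0" "?K t u = ennreal k" by (auto simp: less_top_ennreal)
    have "?Kh h t u < top" for h using le[OF t, of h] k(2) by (auto intro: order.strict_trans1)
    then have "\<exists>k. k \<ge> 0 \<and> ?Kh h t u = ennreal k" for h by (auto simp: less_top_ennreal)
    then obtain kh where kh: "\<And>h. kh h \<ge> 0" "\<And>h. ?Kh h t u = ennreal (kh h)" by metis
    obtain C r0 where C: "C > 0" "r0 > 0"
      and up: "\<And>r B \<nu> \<psi>. 0 < r \<Longrightarrow> r \<le> r0 \<Longrightarrow> open B \<Longrightarrow> dirichlet_eigenbasis B \<nu> \<psi> \<Longrightarrow> \<Omega> \<subseteq> B \<Longrightarrow>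
        B \<subseteq> (\<Union>y\<in>\<Omega>. ball y r) \<Longrightarrow> ?K t u \<le> ennreal (1 + C * r) * K_fun B \<nu> \<psi> t u"
      using K_fun_le_K_fun_neighbourhood[OF \<Omega> eb u' t] by blast
    have "\<forall>\<^sub>F h in sequentially. 1 / real (Suc h) \<le> r0"
      using LIMSEQ_inverse_real_of_nat order_tendstoD(2)[OF LIMSEQ_inverse_real_of_nat C(2)]
      by (auto simp: inverse_eq_divide elim: eventually_mono)
    then have low: "\<forall>\<^sub>F h in sequentially. k / (1 + C * (1 / real (Suc h))) \<le> kh h"
    proof eventually_elim
      case (elim h)
      define r where "r = 1 / real (Suc h)"
      have r: "r > 0" by (simp add: r_def)
      have Cr: "0 < 1 + C * r" using C r by (simp add: add_pos_pos)
      have "ennreal k \<le> ennreal (1 + C * r) * ennreal (kh h)"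
        using up[OF r _ A sub] near elim k kh unfolding r_def by metis
      also have "\<dots> = ennreal ((1 + C * r) * kh h)" using Cr kh by (intro ennreal_mult[symmetric]) auto
      finally have "k \<le> (1 + C * r) * kh h" using Cr kh(1)[of h] by (subst (asm) ennreal_le_iff) auto
      then show ?case using Cr unfolding r_def[symmetric] by (simp add: pos_divide_le_eq mult.commute)
    qed
    have high: "kh h \<le> k" for h using le[OF t, of h] k kh by simp
    have "(\<lambda>h. 1 / real (Suc h)) \<longlonglongrightarrow> 0"
      using LIMSEQ_inverse_real_of_nat by (simp add: inverse_eq_divide)
    then have "(\<lambda>h. k / (1 + C * (1 / real (Suc h)))) \<longlonglongrightarrow> k / (1 + C * 0)"
      by (intro tendsto_intros) auto
    then have "kh \<longlonglongrightarrow> k"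
      by (intro tendsto_sandwich[OF low _ _ tendsto_const]) (auto simp: high)
    then show ?thesis unfolding k kh by (rule tendsto_ennrealI)
  qed
  have "(\<lambda>h. \<integral>\<^sup>+t. ennreal (frac_weight s t) * ?Kh h t u \<partial>lborel)
      \<longlonglongrightarrow> (\<integral>\<^sup>+t. ennreal (frac_weight s t) * ?K t u \<partial>lborel)"
  proof (rule nn_integral_dominated_convergence[where w = "\<lambda>t. ennreal (frac_weight s t) * ?K t u"])
    show "(\<integral>\<^sup>+t. ennreal (frac_weight s t) * ?K t u \<partial>lborel) < \<infinity>"
      using K_integral_finite[OF \<Omega> eb s(1) u] by simp
    show "AE t in lborel. (\<lambda>h. ennreal (frac_weight s t) * ?Kh h t u) \<longlonglongrightarrow> ennreal (frac_weight s t) * ?K t u"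
    proof (intro always_eventually allI)
      fix t
      show "(\<lambda>h. ennreal (frac_weight s t) * ?Kh h t u) \<longlonglongrightarrow> ennreal (frac_weight s t) * ?K t u"
        by (cases "t > 0") (auto intro: ennreal_tendsto_cmult lim simp: frac_weight_def)
    qed
  qed (auto simp: wle)
  then have *: "(\<lambda>h. frac_const s * frac_form (A h) (\<nu> h) (\<psi> h) s u) \<longlonglongrightarrow> frac_const s * frac_form \<Omega> \<mu> \<phi> s u"
    by (simp add: frac_form_eq_integral nonneg)
  \<comment> \<open>A constant that is neither 0 nor infinite can be divided out of the limit in
    \<open>ennreal\<close>.\<close>
  obtain c where c: "c > 0" "frac_const s = ennreal c"
    using frac_const_finite[OF s] frac_const_pos[of s] by (auto simp: less_top_ennreal)
  have "ennreal (1 / c) * (frac_const s * x) = x" for x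
    using c by (simp add: mult.assoc[symmetric] ennreal_mult'[symmetric])
  with ennreal_tendsto_cmult[OF _ *, of "ennreal (1 / c)"]
  show "(\<lambda>h. frac_form (A h) (\<nu> h) (\<psi> h) s u) \<longlonglongrightarrow> frac_form \<Omega> \<mu> \<phi> s u" by simp
  fix h
  have "(\<integral>\<^sup>+t. ennreal (frac_weight s t) * ?Kh h t u \<partial>lborel) \<le> (\<integral>\<^sup>+t. ennreal (frac_weight s t) * ?K t u \<partial>lborel)"
    by (intro nn_integral_mono wle)
  also have "\<dots> < top" by (rule K_integral_finite[OF \<Omega> eb s(1) u])
  finally show "frac_form (A h) (\<nu> h) (\<psi> h) s u < top"
    using c by (auto simp: frac_form_eq_integral nonneg ennreal_mult_less_top)
qed

text \<open>The real \<open>suminf\<close> in \<open>spectral_frac_laplacian\<close> is meaningful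
  only for a summable series; finiteness of the extended sum provides summability.\<close>

lemma spectral_frac_laplacian_eq_frac_form:
  assumes "frac_form A \<mu> \<phi> s u < top"
  shows "summable (\<lambda>j. \<mu> j powr s * (L2_inner A u (\<phi> j))\<^sup>2)"
    "ennreal (spectral_frac_laplacian A \<mu> \<phi> s u u) = frac_form A \<mu> \<phi> s u"
    "0 \<le> spectral_frac_laplacian A \<mu> \<phi> s u u"
proof -
  let ?f = "\<lambda>j. \<mu> j powr s * (L2_inner A u (\<phi> j))\<^sup>2"
  have eq: "spectral_frac_laplacian A \<mu> \<phi> s u u = (\<Sum>j. ?f j)"
    by (simp add: spectral_frac_laplacian_def power2_eq_square mult.assoc)
  show sm: "summable ?f"
    using assms unfolding frac_form_def by (intro summable_suminf_not_top) auto
  show "ennreal (spectral_frac_laplacian A \<mu> \<phi> s u u) = frac_form A \<mu> \<phi> s u"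
    unfolding eq frac_form_def by (rule suminf_ennreal2[symmetric, OF _ sm]) simp
  show "0 \<le> spectral_frac_laplacian A \<mu> \<phi> s u u" unfolding eq by (rule suminf_nonneg[OF sm]) simp
qed

text \<open>Modewise, (a + b)^2 - (a - b)^2 = 4 a b. Summability of the mixed series is inherited
  from the difference of the two diagonal series, so no separate Cauchy-Schwarz argument for series
  is used.\<close>

lemma spectral_frac_laplacian_polarization:
  assumes "frac_form A \<mu> \<phi> s (\<lambda>x. u x + v x) < top" "frac_form A \<mu> \<phi> s (\<lambda>x. u x - v x) < top"
    and L2: "u \<in> L2_on A" "v \<in> L2_on A" "\<And>j. \<phi> j \<in> L2_on A" and A: "open A"
  shows "spectral_frac_laplacian A \<mu> \<phi> s u v
    = (spectral_frac_laplacian A \<mu> \<phi> s (\<lambda>x. u x + v x) (\<lambda>x. u x + v x)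
      - spectral_frac_laplacian A \<mu> \<phi> s (\<lambda>x. u x - v x) (\<lambda>x. u x - v x)) / 4"
proof -
  have A': "A \<in> sets borel" using A by simp
  have sq: "sq_int (restrict_space lborel A) u" "sq_int (restrict_space lborel A) v"
    "\<And>j. sq_int (restrict_space lborel A) (\<phi> j)"
    using L2 by (simp_all add: L2_on_iff_sq_int[OF A'])
  have lin: "L2_inner A (\<lambda>x. u x + v x) (\<phi> j) = L2_inner A u (\<phi> j) + L2_inner A v (\<phi> j)"
    "L2_inner A (\<lambda>x. u x - v x) (\<phi> j) = L2_inner A u (\<phi> j) - L2_inner A v (\<phi> j)" for j
    unfolding L2_inner_eq_ip[OF A'] by (intro ip_add_left ip_diff_left sq)+
  note sm = spectral_frac_laplacian_eq_frac_form(1)[OF assms(1)] spectral_frac_laplacian_eq_frac_form(1)[OF assms(2)]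
  have "spectral_frac_laplacian A \<mu> \<phi> s (\<lambda>x. u x + v x) (\<lambda>x. u x + v x)
      - spectral_frac_laplacian A \<mu> \<phi> s (\<lambda>x. u x - v x) (\<lambda>x. u x - v x)
    = (\<Sum>j. \<mu> j powr s * (L2_inner A (\<lambda>x. u x + v x) (\<phi> j))\<^sup>2 - \<mu> j powr s * (L2_inner A (\<lambda>x. u x - v x) (\<phi> j))\<^sup>2)"
    unfolding suminf_diff[OF sm, symmetric]
    by (simp add: spectral_frac_laplacian_def power2_eq_square mult.assoc)
  also have "\<dots> = (\<Sum>j. 4 * (\<mu> j powr s * L2_inner A u (\<phi> j) * L2_inner A v (\<phi> j)))"
    unfolding lin by (simp add: power2_eq_square algebra_simps)
  also have "\<dots> = 4 * spectral_frac_laplacian A \<mu> \<phi> s u v"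
  proof -
    have "summable (\<lambda>j. 4 * (\<mu> j powr s * L2_inner A u (\<phi> j) * L2_inner A v (\<phi> j)))"
      using summable_diff[OF sm] unfolding lin by (simp add: power2_eq_square algebra_simps)
    then have "summable (\<lambda>j. \<mu> j powr s * L2_inner A u (\<phi> j) * L2_inner A v (\<phi> j))"
      by (simp add: summable_cmult_iff)
    then show ?thesis unfolding spectral_frac_laplacian_def by (rule suminf_mult)
  qed
  finally show ?thesis by simp
qed

section \<open>Linear combinations, and reduction to functions vanishing off the domain\<close>

lemma Hs_zero_lincomb:
  assumes u: "u \<in> Hs_zero s \<Omega>" and v: "v \<in> Hs_zero s \<Omega>"
  shows "(\<lambda>x. u x + c * v x) \<in> Hs_zero s \<Omega>"
proof -
  have [measurable]: "u \<in> borel_measurable borel" "v \<in> borel_measurable borel"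
    using u v by (auto simp: Hs_zero_def sq_int_def)
  let ?N = "\<lambda>x y::'a. norm (x - y) powr (real DIM('a) + 2 * s)"
  have "gagliardo s (\<lambda>x. u x + c * v x) \<le> (\<integral>\<^sup>+x. \<integral>\<^sup>+y. 2 * ennreal ((u x - u y)\<^sup>2 / ?N x y)
      + ennreal (2 * c\<^sup>2) * ennreal ((v x - v y)\<^sup>2 / ?N x y) \<partial>lborel \<partial>lborel)"
    unfolding gagliardo_def
  proof (intro nn_integral_mono)
    fix x y
    let ?a = "u x - u y" and ?b = "c * (v x - v y)"
    have "(u x + c * v x - (u y + c * v y))\<^sup>2 = (?a + ?b)\<^sup>2" by (simp add: algebra_simps)
    also have "\<dots> \<le> 2 * ?a\<^sup>2 + 2 * ?b\<^sup>2" using zero_le_power2[of "?a - ?b"] by (simp add: power2_sum power2_diff)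
    finally have "(u x + c * v x - (u y + c * v y))\<^sup>2 / ?N x y \<le> (2 * ?a\<^sup>2 + 2 * ?b\<^sup>2) / ?N x y"
      by (rule divide_right_mono) simp
    also have "\<dots> = 2 * (?a\<^sup>2 / ?N x y) + 2 * c\<^sup>2 * ((v x - v y)\<^sup>2 / ?N x y)"
      by (simp add: add_divide_distrib power_mult_distrib)
    finally have "ennreal ((u x + c * v x - (u y + c * v y))\<^sup>2 / ?N x y)
        \<le> ennreal (2 * (?a\<^sup>2 / ?N x y) + 2 * c\<^sup>2 * ((v x - v y)\<^sup>2 / ?N x y))" by (rule ennreal_leI)
    also have "\<dots> = 2 * ennreal (?a\<^sup>2 / ?N x y) + ennreal (2 * c\<^sup>2) * ennreal ((v x - v y)\<^sup>2 / ?N x y)"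
    proof -
      define X where "X = ?a\<^sup>2 / ?N x y"
      define Y where "Y = (v x - v y)\<^sup>2 / ?N x y"
      have XY: "0 \<le> X" "0 \<le> Y" by (simp_all add: X_def Y_def)
      have "ennreal (2 * X + 2 * c\<^sup>2 * Y) = ennreal (2 * X) + ennreal (2 * c\<^sup>2 * Y)"
        using XY by (intro ennreal_plus) auto
      also have "ennreal (2 * X) = 2 * ennreal X" using XY by (simp add: ennreal_mult)
      also have "ennreal (2 * c\<^sup>2 * Y) = ennreal (2 * c\<^sup>2) * ennreal Y"
        using XY by (intro ennreal_mult) auto
      finally show ?thesis unfolding X_def Y_def .
    qed
    finally show "ennreal ((u x + c * v x - (u y + c * v y))\<^sup>2 / ?N x y)
        \<le> 2 * ennreal (?a\<^sup>2 / ?N x y) + ennreal (2 * c\<^sup>2) * ennreal ((v x - v y)\<^sup>2 / ?N x y)" .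
  qed
  also have "\<dots> = 2 * gagliardo s u + ennreal (2 * c\<^sup>2) * gagliardo s v"
    unfolding gagliardo_def by (simp add: nn_integral_add nn_integral_cmult)
  also have "\<dots> < top" using u v by (simp add: Hs_zero_def ennreal_mult_less_top)
  finally have "gagliardo s (\<lambda>x. u x + c * v x) < top" .
  then show ?thesis
    using u v sq_int_add[OF _ sq_int_cmult] by (auto simp: Hs_zero_def)
qed

text \<open>Off the closure u is already zero almost everywhere and the frontier is a null set, so
  the cutoff changes u on a null set only. The Gagliardo integral is unchanged because it ignores
  null sets in each of its two variables.\<close>

lemma Hs_tilde_cut_off:
  fixes \<Omega> :: "'a::euclidean_space set"
  assumes \<Omega>: "open \<Omega>" "frontier \<Omega> \<in> null_sets lborel" and u: "u \<in> Hs_tilde s \<Omega>"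
  shows "(\<lambda>x. indicator \<Omega> x * u x) \<in> Hs_zero s \<Omega>" "AE x in lborel. indicator \<Omega> x * u x = u x"
    "sq_int lborel u"
proof -
  have u': "u \<in> L2_on UNIV" "gagliardo s u < top" "AE x in lborel. x \<notin> closure \<Omega> \<longrightarrow> u x = 0"
    using u by (auto simp: Hs_tilde_def Hs_def gagliardo_def)
  show sq: "sq_int lborel u"
    using u'(1) by (auto simp: L2_on_def sq_int_def set_borel_measurable_lborel_iff set_integrable_def)
  have [measurable]: "u \<in> borel_measurable borel" "\<Omega> \<in> sets borel" using sq \<Omega>(1) by (auto simp: sq_int_def)
  let ?u = "\<lambda>x. indicator \<Omega> x * u x"
  have "AE x in lborel. x \<notin> frontier \<Omega>" by (rule AE_not_in[OF \<Omega>(2)])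
  with u'(3) show ae: "AE x in lborel. ?u x = u x"
    by eventually_elim (auto simp: indicator_def frontier_def interior_open \<Omega>(1))
  have "gagliardo s ?u = gagliardo s u"
    unfolding gagliardo_def
  proof (rule nn_integral_cong_AE)
    show "AE x in lborel. (\<integral>\<^sup>+y. ennreal ((?u x - ?u y)\<^sup>2 / norm (x - y) powr (real DIM('a) + 2 * s)) \<partial>lborel)
      = (\<integral>\<^sup>+y. ennreal ((u x - u y)\<^sup>2 / norm (x - y) powr (real DIM('a) + 2 * s)) \<partial>lborel)"
      using ae
    proof eventually_elim
      case (elim x)
      show ?case
        by (rule nn_integral_cong_AE) (use ae in eventually_elim, simp only: elim)
    qed
  qed
  moreover have "sq_int lborel ?u"
  proof -
    have eq: "(norm (?u x))\<^sup>2 = indicator \<Omega> x *\<^sub>R (norm (u x))\<^sup>2" for x by (simp add: indicator_def)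
    have "?u \<in> borel_measurable lborel" by measurable
    moreover have "integrable lborel (\<lambda>x. indicator \<Omega> x *\<^sub>R (norm (u x))\<^sup>2)"
      by (rule integrable_mult_indicator) (use sq \<Omega>(1) in \<open>auto simp: sq_int_def\<close>)
    ultimately show ?thesis unfolding sq_int_def eq by blast
  qed
  ultimately show "?u \<in> Hs_zero s \<Omega>" using u'(2) by (auto simp: Hs_zero_def)
qed

lemma L2_inner_cong_AE:
  assumes A: "open A" and "AE x in lborel. u x = v x" and L2: "u \<in> L2_on A" "v \<in> L2_on A" "w \<in> L2_on A"
  shows "L2_inner A u w = L2_inner A v w"
proof -
  have A': "A \<in> sets borel" using A by simp
  have "AE x in restrict_space lborel A. u x = v x"
    unfolding AE_restrict_lborel[OF A'] using assms(2) by eventually_elim simp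
  then show ?thesis
    unfolding L2_inner_eq_ip[OF A'] ip_def
    using L2 by (intro integral_cong_AE) (auto simp: L2_on_iff_sq_int[OF A'] sq_int_def)
qed

theorem lemma2p3:
  fixes s :: real
    and \<Omega> :: "'a::euclidean_space set"
    and \<Omega>h :: "nat \<Rightarrow> 'a set"
    and \<mu> :: "nat \<Rightarrow> real" and \<phi> :: "nat \<Rightarrow> 'a \<Rightarrow> real"
    and \<mu>h :: "nat \<Rightarrow> nat \<Rightarrow> real" and \<phi>h :: "nat \<Rightarrow> nat \<Rightarrow> 'a \<Rightarrow> real"
    and u :: "'a \<Rightarrow> real"
  assumes "0 < s" and "s < 1"
    and "bounded \<Omega>" and "lipschitz_domain \<Omega>"
    and "uniformly_lipschitz_domains (\<Omega>h ` {1..})"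
    and "\<And>h. h \<ge> 1 \<Longrightarrow> closure \<Omega> \<subseteq> \<Omega>h h"
    and "\<And>h. h \<ge> 1 \<Longrightarrow> \<Omega>h h \<subseteq> {x. infdist x \<Omega> < 1 / real h}"
    and "dirichlet_eigenbasis \<Omega> \<mu> \<phi>"
    and "\<And>h. h \<ge> 1 \<Longrightarrow> dirichlet_eigenbasis (\<Omega>h h) (\<mu>h h) (\<phi>h h)"
    and "u \<in> Hs_tilde s \<Omega>"
  shows "(\<lambda>h. spectral_frac_laplacian (\<Omega>h h) (\<mu>h h) (\<phi>h h) s u u)
           \<longlonglongrightarrow> spectral_frac_laplacian \<Omega> \<mu> \<phi> s u u \<and>
         (\<forall>v \<in> Hs_tilde s \<Omega>.
           (\<lambda>h. spectral_frac_laplacian (\<Omega>h h) (\<mu>h h) (\<phi>h h) s u v)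
             \<longlonglongrightarrow> spectral_frac_laplacian \<Omega> \<mu> \<phi> s u v)"
proof -
  note s = assms(1,2) and \<Omega> = assms(3,4) and eb = assms(8)
  have op: "open \<Omega>" and ne: "\<Omega> \<noteq> {}" using \<Omega>(2) by (auto simp: lipschitz_domain_def open_domain_def)
  have null: "frontier \<Omega> \<in> null_sets lborel" by (rule frontier_lipschitz_domain_null[OF \<Omega>])
  \<comment> \<open>The hypotheses on the domains start at h = 1; the shift makes every natural
    number an admissible index.\<close>
  define A where "A h = \<Omega>h (Suc h)" for h
  have A: "open (A h)" for h
    using assms(5) by (auto simp: uniformly_lipschitz_domains_def open_domain_def A_def)
  have ebA: "dirichlet_eigenbasis (A h) (\<mu>h (Suc h)) (\<phi>h (Suc h))" for h
    unfolding A_def by (rule assms(9)) simp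
  have sub: "\<Omega> \<subseteq> A h" for h
    unfolding A_def using assms(6)[of "Suc h"] closure_subset by auto
  have near: "A h \<subseteq> (\<Union>y\<in>\<Omega>. ball y (1 / real (Suc h)))" for h
  proof
    fix x assume "x \<in> A h"
    then have "infdist x \<Omega> < 1 / real (Suc h)" using assms(7)[of "Suc h"] by (auto simp: A_def)
    \<comment> \<open>A strict bound on the infimum of distances is attained by some point of
      \<Omega>, which gives the neighbourhood as a union of open balls.\<close>
    then obtain y where "y \<in> \<Omega>" "dist x y < 1 / real (Suc h)"
      unfolding infdist_notempty[OF ne] by (subst (asm) cINF_less_iff) (auto simp: ne intro: bdd_belowI2)
    then show "x \<in> (\<Union>y\<in>\<Omega>. ball y (1 / real (Suc h)))" by (auto simp: dist_commute)
  qed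
  let ?S = "spectral_frac_laplacian \<Omega> \<mu> \<phi> s"
    and ?Sh = "\<lambda>h. spectral_frac_laplacian (A h) (\<mu>h (Suc h)) (\<phi>h (Suc h)) s"
  have fin: "frac_form \<Omega> \<mu> \<phi> s w < top" if "w \<in> Hs_zero s \<Omega>" for w
    by (rule frac_form_finite[OF \<Omega> eb s that])
  have finh: "frac_form (A h) (\<mu>h (Suc h)) (\<phi>h (Suc h)) s w < top" if "w \<in> Hs_zero s \<Omega>" for w h
    by (rule frac_form_convergence(2)[OF \<Omega> eb s that A ebA sub near])
  have diag: "(\<lambda>h. ?Sh h w w) \<longlonglongrightarrow> ?S w w" if w: "w \<in> Hs_zero s \<Omega>" for w
  proof (rule tendsto_ennrealD)
    show "(\<lambda>h. ennreal (?Sh h w w)) \<longlonglongrightarrow> ennreal (?S w w)"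
      unfolding spectral_frac_laplacian_eq_frac_form(2)[OF fin[OF w]]
        spectral_frac_laplacian_eq_frac_form(2)[OF finh[OF w]]
      by (rule frac_form_convergence(1)[OF \<Omega> eb s w A ebA sub near])
  qed (auto simp: spectral_frac_laplacian_eq_frac_form(3) fin finh w)
  have phiL2: "\<phi> j \<in> L2_on \<Omega>" "\<phi>h (Suc h) j \<in> L2_on (A h)" for h j
    using eb ebA[of h] by (auto simp: dirichlet_eigenbasis_def dirichlet_laplacian_def H1_0_def has_weak_grad_def)
  have polar: "(\<lambda>h. ?Sh h w v) \<longlonglongrightarrow> ?S w v" if w: "w \<in> Hs_zero s \<Omega>" and v: "v \<in> Hs_zero s \<Omega>" for w v
  proof -
    have p: "(\<lambda>x. w x + v x) \<in> Hs_zero s \<Omega>" using Hs_zero_lincomb[OF w v, of 1] by simp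
    have m: "(\<lambda>x. w x - v x) \<in> Hs_zero s \<Omega>" using Hs_zero_lincomb[OF w v, of "-1"] by simp
    have L2: "f \<in> L2_on B" if "f \<in> Hs_zero s \<Omega>" "open B" for f and B :: "'a set"
      using that by (intro sq_int_lborel_L2_on) (auto simp: Hs_zero_def)
    show ?thesis
      unfolding spectral_frac_laplacian_polarization[OF fin[OF p] fin[OF m] L2[OF w op] L2[OF v op] phiL2(1) op]
        spectral_frac_laplacian_polarization[OF finh[OF p] finh[OF m] L2[OF w A] L2[OF v A] phiL2(2) A]
      by (intro tendsto_intros diag p m) simp
  qed
  let ?cut = "\<lambda>w x. indicator \<Omega> x * w x"
  have cut: "L2_inner B w f = L2_inner B (?cut w) f"
    if w: "w \<in> Hs_tilde s \<Omega>" and B: "open B" and f: "f \<in> L2_on B" for w f B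
  proof (rule L2_inner_cong_AE[OF B _ _ _ f])
    show "AE x in lborel. w x = ?cut w x"
      using Hs_tilde_cut_off(2)[OF op null w] by eventually_elim simp
    show "w \<in> L2_on B" "?cut w \<in> L2_on B"
      using Hs_tilde_cut_off(1,3)[OF op null w] B by (auto intro!: sq_int_lborel_L2_on simp: Hs_zero_def)
  qed
  \<comment> \<open>The forms depend on their arguments only through L2 products with the
    eigenfunctions, so passing to the cut-off representatives leaves them unchanged on \<Omega> and
    on every \<open>A h\<close>.\<close>
  have S_cut: "?S w v = ?S (?cut w) (?cut v)" "?Sh h w v = ?Sh h (?cut w) (?cut v)"
    if "w \<in> Hs_tilde s \<Omega>" "v \<in> Hs_tilde s \<Omega>" for w v h
    unfolding spectral_frac_laplacian_def
    by (simp_all only: cut[OF that(1) op phiL2(1)] cut[OF that(2) op phiL2(1)]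
        cut[OF that(1) A phiL2(2)] cut[OF that(2) A phiL2(2)])
  have main: "(\<lambda>h. spectral_frac_laplacian (\<Omega>h h) (\<mu>h h) (\<phi>h h) s u v) \<longlonglongrightarrow> ?S u v"
    if v: "v \<in> Hs_tilde s \<Omega>" for v
  proof -
    have "(\<lambda>h. ?Sh h u v) \<longlonglongrightarrow> ?S u v"
      unfolding S_cut[OF assms(10) v]
      by (rule polar[OF Hs_tilde_cut_off(1)[OF op null assms(10)] Hs_tilde_cut_off(1)[OF op null v]])
    then have "(\<lambda>h. spectral_frac_laplacian (\<Omega>h (Suc h)) (\<mu>h (Suc h)) (\<phi>h (Suc h)) s u v) \<longlonglongrightarrow> ?S u v"
      unfolding A_def .
    \<comment> \<open>Undoes the index shift: the term at h = 0 does not affect the limit.\<close>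
    then show ?thesis by (rule LIMSEQ_imp_Suc)
  qed
  with assms(10) show ?thesis by blast
qed

end
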